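(* Let $c\ge1$ be an integer and $\mu,\nu\in\mathbb R$ with $\mu\ne0$. Let $\Xi$ be the left $E^c_{\mu\nu}$–right $D^c_{\mu\nu}$ projective bimodule, and let $\mathfrak h$ be the Heisenberg Lie algebra with basis $\{X,Y,Z\}$, $[X,Y]=cZ$ and $Z$ central. Then $\nabla$ is a Yang–Mills connection on $\Xi$ with constant curvature $\Theta_\nabla$ if and only if $\nabla$ is a compatible connection on $\Xi$ over $D^c_{\mu\nu}$ with constant curvature $\Theta_\nabla$ of the form $$\Theta_\nabla(X,Y)=0,\qquad \Theta_\nabla(X,Z)=0,\qquad \Theta_\nabla(Y,Z)=\frac{\pi i}{\mu}\mathrm{Id}_E.$$
   Context: Notation: $e(t)=\exp(2\pi i t)$, $\bar e(t)=\overline{e(t)}$, $\mathbb T=\mathbb R/\mathbb Z$, $M=\mathbb R\times\mathbb T$, $\delta_0(p)=1$ if $p=0$ and $0$ otherwise. Algebras. $\mathbb Z$ acts on $M$ by $\lambda_p(x,y)=(x+2p\mu,y+2p\nu)$ and $\sigma_p(x,y)=(x-p,y)$. In $C_b(M)\rtimes_\lambda\mathbb Z$: $(\Phi\ast\Psi)(x,y,p)=\sum_q\Phi(x,y,q)\Psi(x-2q\mu,y-2q\nu,p-q)$, $\Phi^*(x,y,p)=\overline{\Phi}(x-2p\mu,y-2p\nu,-p)$. In $C_b(M)\rtimes_\sigma\mathbb Z$: $(\Phi\ast\Psi)(x,y,p)=\sum_q\Phi(x,y,q)\Psi(x+q,y,p-q)$, $\Phi^*(x,y,p)=\overline\Phi(x+p,y,-p)$.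 The quantum Heisenberg manifold $D^c_{\mu\nu}$ is the closure, in the multiplier algebra of $C_b(M)\rtimes_\lambda\mathbb Z$, of the $*$-algebra $D_0$ of bounded continuous functions $\Phi$ on $M\times\mathbb Z$ with compact support in $\mathbb Z$ and $\bar e(ckp(y-p\nu))\Phi(x+k,y,p)=\Phi(x,y,p)$ for all $k\in\mathbb Z$. $E^c_{\mu\nu}$ is the closure, in the multiplier algebra of $C_b(M)\rtimes_\sigma\mathbb Z$, of the $*$-algebra $E_0$ of bounded continuous functions $\Psi$ on $M\times\mathbb Z$ with compact support in $\mathbb Z$ and $e(cpk(y-k\nu))\Psi(x-2k\mu,y-2k\nu,p)=\Psi(x,y,p)$ for all $k\in\mathbb Z$. $\mathrm{Id}_E(x,y,p)=\delta_0(p)$ is the identity of $E^c_{\mu\nu}$. Bimodule. $\Xi$ is the $E^c_{\mu\nu}$–$D^c_{\mu\nu}$ equivalence bimodule obtained by completing $C_c(\mathbb R\times\mathbb T)$ for $\langle f,g\rangle_R^D(x,y,p)=\sum_k\bar e(ckp(y-p\nu))f(x+k,y)\overline g(x-2p\mu+k,y-2p\nu)$, $\langle f,g\rangle_L^E(x,y,p)=\sum_k e(cpk(y-k\nu))\overline f(x-2k\mu,y-2k\nu)g(x-2k\mu+p,y-2k\nu)$, with actions $(\Psi\cdot f)(x,y)=\sum_q\overline\Psi(x,y,q)f(x+q,y)$ and $(g\cdot\Phi)(x,y)=\sum_q g(x+2q\mu,y+2q\nu)\overline\Phi(x+2q\mu,y+2q\nu,q)$. Derivations. $\mathfrak h$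 acts on the smooth subalgebra of $D^c_{\mu\nu}$ by $\delta_X(\Phi)=2\pi i c p(x-p\mu)\Phi-\frac{\partial\Phi}{\partial y}$, $\delta_Y(\Phi)=-\frac{\partial\Phi}{\partial x}$, $\delta_Z(\Phi)=2\pi i p\,\Phi$ at $(x,y,p)$. By convention all algebras and modules are replaced by their smooth dense versions, with no change in notation. Connections. A linear connection on $\Xi$ is a linear map $\nabla:\Xi\to\Xi\otimes\mathfrak h^*$ with $\nabla_W(\xi\cdot\Phi)=\nabla_W(\xi)\cdot\Phi+\xi\cdot\delta_W(\Phi)$; it is compatible if $\delta_W(\langle\xi,\eta\rangle_R^D)=\langle\nabla_W\xi,\eta\rangle_R^D+\langle\xi,\nabla_W\eta\rangle_R^D$. $CC(\Xi)$ is the set of compatible connections. The curvature is $\Theta_\nabla(W,W')=\nabla_W\nabla_{W'}-\nabla_{W'}\nabla_W-\nabla_{[W,W']}$; curvature operators are identified with the elements of $E^c_{\mu\nu}$ (skew-adjoint) that induce them by the left action. The curvature is constant if all its values are scalar multiples of $\mathrm{Id}_E$. Yang–Mills functional. $\tau(\Phi)=\int_{\mathbb T^2}\Phi(x,y,0)\,dx\,dy$ on $D^c_{\mu\nu}$; the induced trace on $E^c_{\mu\nu}$ is $\tau_E(\langle\xi,\eta\rangle_L^E)=\tau(\langle\eta,\xi\rangle_R^D)$, which for $\mu>0$ is $\tau_E(\Psi)=\int_0^{2\mu}\int_0^1\Psi(x,y,0)\,dy\,dx$. $\mathrm{YM}(\nabla)=-\tau_E\big(\Theta_\nabla(X,Y)^2+\Theta_\nabla(X,Z)^2+\Theta_\nabla(Y,Z)^2\big)$.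 $\nabla\in CC(\Xi)$ is a critical point if the derivative of $t\mapsto\mathrm{YM}(\nabla+t\mathbb H)$ at $0$ vanishes for every linear map $\mathbb H$ from $\mathfrak h$ to the skew-adjoint elements of $E^c_{\mu\nu}$; by a known result this holds exactly when (1) $[\nabla_Y,\Theta_\nabla(X,Y)]+[\nabla_Z,\Theta_\nabla(X,Z)]=0$, (2) $[\nabla_X,\Theta_\nabla(Y,X)]+[\nabla_Z,\Theta_\nabla(Y,Z)]=0$, (3) $[\nabla_X,\Theta_\nabla(Z,X)]+[\nabla_Y,\Theta_\nabla(Z,Y)]-c\,\Theta_\nabla(X,Y)=0$. A Yang–Mills connection is a compatible connection that is both a critical point and a minimizer of $\mathrm{YM}$; for a Yang–Mills connection with constant curvature, "minimizer" is meant subject to the constant curvature constraint: $\mathrm{YM}(\nabla)\le\mathrm{YM}(\nabla')$ for every $\nabla'\in CC(\Xi)$ with constant curvature. *)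

theory Defs
  imports "HOL-Analysis.Analysis"
begin

text \<open>
  A function on \<open>M = \<real> \<times> \<real>/\<int>\<close> is a function of two real variables that is 1-periodic in the second;
  a function on \<open>M \<times> \<int>\<close> has a further integer argument.
\<close>

type_synonym mfun = "real \<Rightarrow> real \<Rightarrow> complex"
type_synonym mzfun = "real \<Rightarrow> real \<Rightarrow> int \<Rightarrow> complex"

definition ee :: "real \<Rightarrow> complex"
  where "ee t = exp (2 * of_real pi * \<i> * of_real t)"

definition bounded_cont_fin_supp :: "mzfun \<Rightarrow> bool"
  where "bounded_cont_fin_supp \<Phi> \<longleftrightarrow>
    (\<forall>p. continuous_on UNIV (\<lambda>(x, y). \<Phi> x y p)) \<and>
    (\<forall>x y p. \<Phi> x (y + 1) p = \<Phi> x y p) \<and>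
    (\<exists>B. \<forall>x y p. norm (\<Phi> x y p) \<le> B) \<and>
    finite {p. \<exists>x y. \<Phi> x y p \<noteq> 0}"

definition partial_x :: "mfun \<Rightarrow> mfun"
  where "partial_x f = (\<lambda>x y. vector_derivative (\<lambda>t. f t y) (at x))"

definition partial_y :: "mfun \<Rightarrow> mfun"
  where "partial_y f = (\<lambda>x y. vector_derivative (\<lambda>t. f x t) (at y))"

definition partially_differentiable :: "mfun \<Rightarrow> bool"
  where "partially_differentiable f \<longleftrightarrow>
    (\<forall>x y. (\<lambda>t. f t y) differentiable (at x) \<and> (\<lambda>t. f x t) differentiable (at y))"

text \<open>\<open>C\<^sup>\<infinity>\<close>: all iterated partial derivatives exist and are continuous.\<close>

coinductive smooth :: "mfun \<Rightarrow> bool"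
  where "continuous_on UNIV (\<lambda>(x, y). f x y) \<Longrightarrow> partially_differentiable f \<Longrightarrow>
    smooth (partial_x f) \<Longrightarrow> smooth (partial_y f) \<Longrightarrow> smooth f"

text \<open>
  The smooth version of the bimodule \<open>\<Xi>\<close> is the Schwartz space of \<open>M\<close>. It is the submodule generated by
  the compactly supported smooth functions over the smooth version of \<open>D\<close>.
\<close>

definition Xi :: "mfun set"
  where "Xi = {f. smooth f \<and> (\<forall>x y. f x (y + 1) = f x y) \<and>
    (\<forall>n i j. \<exists>B. \<forall>x y. norm (of_real (x ^ n) * ((partial_x ^^ i) ((partial_y ^^ j) f)) x y) \<le> B)}"

text \<open>The matrix \<open>A\<close> defines an operator of norm at most \<open>C\<close> on \<open>\<ell>\<^sup>2(\<int>)\<close>.\<close>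

definition l2_norm_le :: "(int \<Rightarrow> int \<Rightarrow> complex) \<Rightarrow> real \<Rightarrow> bool"
  where "l2_norm_le A C \<longleftrightarrow> (\<forall>S u v. finite S \<longrightarrow>
    norm (\<Sum>r\<in>S. \<Sum>s\<in>S. cnj (v r) * A r s * u s)
      \<le> C * L2_set (\<lambda>s. norm (u s)) S * L2_set (\<lambda>r. norm (v r)) S)"

text \<open>The real Lie algebra with basis \<open>X, Y, Z\<close>, \<open>[X, Y] = c Z\<close> and \<open>Z\<close> central.\<close>

type_synonym heis = "real \<times> real \<times> real"

definition hX :: heis where "hX = (1, 0, 0)"
definition hY :: heis where "hY = (0, 1, 0)"
definition hZ :: heis where "hZ = (0, 0, 1)"

definition bracket :: "int \<Rightarrow> heis \<Rightarrow> heis \<Rightarrow> heis"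
  where "bracket c V W = (case (V, W) of
    ((v1, v2, v3), (w1, w2, w3)) \<Rightarrow> (0, 0, of_int c * (v1 * w2 - v2 * w1)))"

text \<open>Multiples of the identity of \<open>E\<close> are central and act on \<open>\<Xi>\<close> through the conjugate scalar, see \<open>lact\<close>.\<close>

definition Id_E :: mzfun
  where "Id_E = (\<lambda>x y p. if p = 0 then 1 else 0)"

definition lact :: "mzfun \<Rightarrow> mfun \<Rightarrow> mfun"
  where "lact \<Psi> f = (\<lambda>x y. \<Sum>\<^sub>\<infinity>q. cnj (\<Psi> x y q) * f (x + of_int q) y)"

definition mult_E :: "mzfun \<Rightarrow> mzfun \<Rightarrow> mzfun"
  where "mult_E \<Phi> \<Psi> = (\<lambda>x y p. \<Sum>\<^sub>\<infinity>q. \<Phi> x y q * \<Psi> (x + of_int q) y (p - q))"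

definition adj_E :: "mzfun \<Rightarrow> mzfun"
  where "adj_E \<Phi> = (\<lambda>x y p. cnj (\<Phi> (x + of_int p) y (- p)))"

definition skew_adjoint_E :: "mzfun \<Rightarrow> bool"
  where "skew_adjoint_E \<Psi> \<longleftrightarrow> adj_E \<Psi> = (\<lambda>x y p. - \<Psi> x y p)"

definition tau_D :: "mzfun \<Rightarrow> complex"
  where "tau_D \<Phi> = integral {0..1} (\<lambda>x. integral {0..1} (\<lambda>y. \<Phi> x y 0))"

context
  fixes c :: int and \<mu> \<nu> :: real
begin

definition D0 :: "mzfun set"
  where "D0 = {\<Phi>. bounded_cont_fin_supp \<Phi> \<and>
    (\<forall>k x y p. cnj (ee (of_int (c * k * p) * (y - of_int p * \<nu>))) * \<Phi> (x + of_int k) y p = \<Phi> x y p)}"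

definition E0 :: "mzfun set"
  where "E0 = {\<Psi>. bounded_cont_fin_supp \<Psi> \<and>
    (\<forall>k x y p. ee (of_int (c * p * k) * (y - of_int k * \<nu>)) *
       \<Psi> (x - 2 * of_int k * \<mu>) (y - 2 * of_int k * \<nu>) p = \<Psi> x y p)}"

text \<open>
  The crossed products of \<open>C\<^sub>b(M)\<close> by \<open>\<int>\<close> are unital, hence equal to their multiplier algebras, and as
  \<open>\<int>\<close> is amenable their elements are determined by their coefficient functions on \<open>M \<times> \<int>\<close>. The \<open>C\<^sup>*\<close>-norm
  is the supremum over the points of \<open>M\<close> of the norms of the regular representations on \<open>\<ell>\<^sup>2(\<int>)\<close>
  along the orbits. The matrices below turn the two convolutions into matrix products and the involutions into
  adjoints.
\<close>

definition orbit_matrix_D :: "mzfun \<Rightarrow> real \<Rightarrow> real \<Rightarrow> int \<Rightarrow> int \<Rightarrow> complex"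
  where "orbit_matrix_D \<Phi> x y r s = \<Phi> (x - 2 * of_int r * \<mu>) (y - 2 * of_int r * \<nu>) (s - r)"

definition orbit_matrix_E :: "mzfun \<Rightarrow> real \<Rightarrow> real \<Rightarrow> int \<Rightarrow> int \<Rightarrow> complex"
  where "orbit_matrix_E \<Psi> x y r s = \<Psi> (x + of_int r) y (s - r)"

definition D_cstar :: "mzfun set"
  where "D_cstar = {\<Phi>. \<forall>\<epsilon>>0. \<exists>\<Phi>0\<in>D0. \<forall>x y.
    l2_norm_le (orbit_matrix_D (\<lambda>x y p. \<Phi> x y p - \<Phi>0 x y p) x y) \<epsilon>}"

definition E_cstar :: "mzfun set"
  where "E_cstar = {\<Psi>. \<forall>\<epsilon>>0. \<exists>\<Psi>0\<in>E0. \<forall>x y.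
    l2_norm_le (orbit_matrix_E (\<lambda>x y p. \<Psi> x y p - \<Psi>0 x y p) x y) \<epsilon>}"

definition delta_X :: "mzfun \<Rightarrow> mzfun"
  where "delta_X \<Phi> = (\<lambda>x y p.
    2 * of_real pi * \<i> * of_int c * of_int p * of_real (x - of_int p * \<mu>) * \<Phi> x y p
    - partial_y (\<lambda>x y. \<Phi> x y p) x y)"

definition delta_Y :: "mzfun \<Rightarrow> mzfun"
  where "delta_Y \<Phi> = (\<lambda>x y p. - partial_x (\<lambda>x y. \<Phi> x y p) x y)"

definition delta_Z :: "mzfun \<Rightarrow> mzfun"
  where "delta_Z \<Phi> = (\<lambda>x y p. 2 * of_real pi * \<i> * of_int p * \<Phi> x y p)"

definition delta :: "heis \<Rightarrow> mzfun \<Rightarrow> mzfun"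
  where "delta W \<Phi> = (case W of (a, b, z) \<Rightarrow> \<lambda>x y p.
    of_real a * delta_X \<Phi> x y p + of_real b * delta_Y \<Phi> x y p + of_real z * delta_Z \<Phi> x y p)"

text \<open>
  The smooth subalgebra of \<open>D\<close>: the elements to which the three derivations can be applied arbitrarily often
  without leaving \<open>D\<close>. These are the smooth vectors of the action of the Heisenberg group.
\<close>

coinductive_set D_smooth :: "mzfun set"
  where "\<Phi> \<in> D_cstar \<Longrightarrow> (\<And>p. partially_differentiable (\<lambda>x y. \<Phi> x y p)) \<Longrightarrow>
    delta_X \<Phi> \<in> D_smooth \<Longrightarrow> delta_Y \<Phi> \<in> D_smooth \<Longrightarrow> delta_Z \<Phi> \<in> D_smooth \<Longrightarrow>
    \<Phi> \<in> D_smooth"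

text \<open>
  The smooth version of \<open>E\<close> is the endomorphism algebra of the smooth right \<open>D\<close>-module \<open>\<Xi>\<close>, that is, the
  elements of \<open>E\<close> whose left action preserves the smooth version of \<open>\<Xi>\<close>.
\<close>

definition E_smooth :: "mzfun set"
  where "E_smooth = {\<Psi> \<in> E_cstar. \<forall>f\<in>Xi. lact \<Psi> f \<in> Xi}"

definition inner_R :: "mfun \<Rightarrow> mfun \<Rightarrow> mzfun"
  where "inner_R f g = (\<lambda>x y p. \<Sum>\<^sub>\<infinity>k.
    cnj (ee (of_int (c * k * p) * (y - of_int p * \<nu>))) * f (x + of_int k) y *
    cnj (g (x - 2 * of_int p * \<mu> + of_int k) (y - 2 * of_int p * \<nu>)))"

definition inner_L :: "mfun \<Rightarrow> mfun \<Rightarrow> mzfun"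
  where "inner_L f g = (\<lambda>x y p. \<Sum>\<^sub>\<infinity>k.
    ee (of_int (c * p * k) * (y - of_int k * \<nu>)) *
    cnj (f (x - 2 * of_int k * \<mu>) (y - 2 * of_int k * \<nu>)) *
    g (x - 2 * of_int k * \<mu> + of_int p) (y - 2 * of_int k * \<nu>))"

definition ract :: "mfun \<Rightarrow> mzfun \<Rightarrow> mfun"
  where "ract g \<Phi> = (\<lambda>x y. \<Sum>\<^sub>\<infinity>q.
    g (x + 2 * of_int q * \<mu>) (y + 2 * of_int q * \<nu>) *
    cnj (\<Phi> (x + 2 * of_int q * \<mu>) (y + 2 * of_int q * \<nu>) q))"

text \<open>
  The trace induced by \<open>tau_D\<close>: the inner products \<open>inner_L \<xi> \<eta>\<close> span the smooth version of \<open>E\<close>, and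
  \<open>tau_E (inner_L \<xi> \<eta>) = tau_D (inner_R \<eta> \<xi>)\<close>.
\<close>

definition tau_E :: "mzfun \<Rightarrow> complex"
  where "tau_E \<Psi> = (THE t. \<exists>(n::nat) \<xi> \<eta>. (\<forall>i<n. \<xi> i \<in> Xi \<and> \<eta> i \<in> Xi) \<and>
    \<Psi> = (\<lambda>x y p. \<Sum>i<n. inner_L (\<xi> i) (\<eta> i) x y p) \<and>
    t = (\<Sum>i<n. tau_D (inner_R (\<eta> i) (\<xi> i))))"

text \<open>
  A map \<open>\<Xi> \<rightarrow> \<Xi> \<otimes> \<hh>\<^sup>*\<close> is given by its components \<open>nabla W\<close>; only the values on \<open>\<Xi>\<close> matter.
\<close>

definition linear_connection :: "(heis \<Rightarrow> mfun \<Rightarrow> mfun) \<Rightarrow> bool"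
  where "linear_connection nabla \<longleftrightarrow>
    (\<forall>W. \<forall>f\<in>Xi. nabla W f \<in> Xi) \<and>
    (\<forall>W a b. \<forall>f\<in>Xi. \<forall>g\<in>Xi. nabla W (\<lambda>x y. a * f x y + b * g x y) =
       (\<lambda>x y. a * nabla W f x y + b * nabla W g x y)) \<and>
    (\<forall>V W a b. \<forall>f\<in>Xi. nabla (a *\<^sub>R V + b *\<^sub>R W) f =
       (\<lambda>x y. of_real a * nabla V f x y + of_real b * nabla W f x y)) \<and>
    (\<forall>W. \<forall>f\<in>Xi. \<forall>\<Phi>\<in>D_smooth. nabla W (ract f \<Phi>) =
       (\<lambda>x y. ract (nabla W f) \<Phi> x y + ract f (delta W \<Phi>) x y))"

definition compatible_connections :: "(heis \<Rightarrow> mfun \<Rightarrow> mfun) set"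
  where "compatible_connections = {nabla. linear_connection nabla \<and>
    (\<forall>W. \<forall>f\<in>Xi. \<forall>g\<in>Xi. delta W (inner_R f g) =
       (\<lambda>x y p. inner_R (nabla W f) g x y p + inner_R f (nabla W g) x y p))}"

definition curvature_op :: "(heis \<Rightarrow> mfun \<Rightarrow> mfun) \<Rightarrow> heis \<Rightarrow> heis \<Rightarrow> mfun \<Rightarrow> mfun"
  where "curvature_op nabla V W f = (\<lambda>x y.
    nabla V (nabla W f) x y - nabla W (nabla V f) x y - nabla (bracket c V W) f x y)"

definition curvature :: "(heis \<Rightarrow> mfun \<Rightarrow> mfun) \<Rightarrow> heis \<Rightarrow> heis \<Rightarrow> mzfun"
  where "curvature nabla V W =
    (THE \<Psi>. \<Psi> \<in> E_smooth \<and> (\<forall>f\<in>Xi. lact \<Psi> f = curvature_op nabla V W f))"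

definition constant_curvature :: "(heis \<Rightarrow> mfun \<Rightarrow> mfun) \<Rightarrow> bool"
  where "constant_curvature nabla \<longleftrightarrow>
    (\<forall>V W. \<exists>a. curvature nabla V W = (\<lambda>x y p. a * Id_E x y p))"

text \<open>The curvatures are skew-adjoint, so the trace is real here.\<close>

definition YM :: "(heis \<Rightarrow> mfun \<Rightarrow> mfun) \<Rightarrow> real"
  where "YM nabla = - Re (tau_E (\<lambda>x y p.
    mult_E (curvature nabla hX hY) (curvature nabla hX hY) x y p +
    mult_E (curvature nabla hX hZ) (curvature nabla hX hZ) x y p +
    mult_E (curvature nabla hY hZ) (curvature nabla hY hZ) x y p))"

definition linear_skew_adjoint :: "(heis \<Rightarrow> mzfun) \<Rightarrow> bool"
  where "linear_skew_adjoint H \<longleftrightarrow>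
    (\<forall>W. H W \<in> E_smooth \<and> skew_adjoint_E (H W)) \<and>
    (\<forall>V W a b. H (a *\<^sub>R V + b *\<^sub>R W) =
       (\<lambda>x y p. of_real a * H V x y p + of_real b * H W x y p))"

definition critical_point :: "(heis \<Rightarrow> mfun \<Rightarrow> mfun) \<Rightarrow> bool"
  where "critical_point nabla \<longleftrightarrow> (\<forall>H. linear_skew_adjoint H \<longrightarrow>
    ((\<lambda>t. YM (\<lambda>W f x y. nabla W f x y + of_real t * lact (H W) f x y))
       has_real_derivative 0) (at 0))"

definition Yang_Mills_constant_curvature :: "(heis \<Rightarrow> mfun \<Rightarrow> mfun) \<Rightarrow> bool"
  where "Yang_Mills_constant_curvature nabla \<longleftrightarrow>
    nabla \<in> compatible_connections \<and> constant_curvature nabla \<and> critical_point nabla \<and>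
    (\<forall>nabla'\<in>compatible_connections. constant_curvature nabla' \<longrightarrow> YM nabla \<le> YM nabla')"

end

end

(*
  The module Xi has a finite frame: xi_i, eta_i with f = sum xi_i <eta_i, f> for all f. Hence every endomorphism T of the
  right D-module Xi is the left action of the element sum <T xi_i, eta_i> of E, and tau_E of this element is
  tr T = sum tau_D <eta_i, T xi_i>. For a compatible connection nabla and an endomorphism B the commutator [nabla_V, B]
  has trace tau_D of a derivative, that is 0. Two compatible connections differ by endomorphisms, so the traces of
  Theta(X, Z) and Theta(Y, Z), where the bracket vanishes, are the same for all of them and can be read off the
  connection with nabla_Y = - d/dx and nabla_Z = pi i x / mu. For constant curvature this fixes Theta(X, Z) = 0 and
  Theta(Y, Z) = pi i / mu, so the functional is minimal exactly when the remaining scalar Theta(X, Y) vanishes, a value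
  that the standard connection attains. Criticality follows from the same trace identity, since the first variation is
  the trace of Theta(Y, Z) times [nabla_Y, H_Z] - [nabla_Z, H_Y].
*)

theory Submission
  imports Defs
begin

subsection \<open>The Schwartz space of \<open>M\<close>\<close>

text \<open>An element of \<open>E_cstar\<close> is given only by its coefficients, so nothing
  algebraic comes for free. The frame supplies the algebra: \<open>Id_E\<close> is a finite sum of
  \<open>L (\<xi> i) (\<eta> i)\<close>, and multiplying by it shows that an element is determined
  by its action on the \<open>\<xi> i\<close>. This makes \<open>curvature\<close> well defined. The
  trace \<open>tau_E\<close> is well defined for another reason: it is an integral over a strip of
  width \<open>2 * \<bar>\<mu>\<bar>\<close>, and it agrees with \<open>tau_D\<close> because
  periodizations of one Schwartz function with different periods have equal integrals. Curvature
  operators are module maps because they are skew for \<open>R\<close>; skewness follows from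
  compatibility and a computation for a single connection. Conjugates need care: \<open>lact\<close>
  uses conjugate coefficients, so the element \<open>a * Id_E\<close> acts as the scalar
  \<open>cnj a\<close> and the trace of operators is conjugate-linear. Thus the operator - pi i /
  \<mu> of the standard connection belongs to the element pi i / \<mu>. Membership in the Schwartz
  space is shown by coinduction: a family suffices whose span is closed under both partial
  derivatives and under multiplication by x.\<close>

definition partials :: "mfun \<Rightarrow> mfun \<Rightarrow> mfun \<Rightarrow> bool"
  where "partials f fx fy \<longleftrightarrow> (\<forall>x y. ((\<lambda>t. f t y) has_vector_derivative fx x y) (at x) \<and>
    ((\<lambda>t. f x t) has_vector_derivative fy x y) (at y))"

abbreviation continuous2 :: "mfun \<Rightarrow> bool"
  where "continuous2 f \<equiv> continuous_on UNIV (\<lambda>(x, y). f x y)"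

abbreviation periodic2 :: "mfun \<Rightarrow> bool"
  where "periodic2 f \<equiv> \<forall>x y. f x (y + 1) = f x y"

abbreviation bounded2 :: "mfun \<Rightarrow> bool"
  where "bounded2 f \<equiv> \<exists>B. \<forall>x y. norm (f x y) \<le> B"

lemma partialsI:
  assumes "\<And>x y. ((\<lambda>t. f t y) has_vector_derivative fx x y) (at x)"
    and "\<And>x y. ((\<lambda>t. f x t) has_vector_derivative fy x y) (at y)"
  shows "partials f fx fy"
  using assms by (simp add: partials_def)

lemma partials_x: "partials f fx fy \<Longrightarrow> ((\<lambda>t. f t y) has_vector_derivative fx x y) (at x)"
  and partials_y: "partials f fx fy \<Longrightarrow> ((\<lambda>t. f x t) has_vector_derivative fy x y) (at y)"
  by (simp_all add: partials_def)

lemma partials_imp: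
  assumes "partials f fx fy"
  shows "partially_differentiable f" "partial_x f = fx" "partial_y f = fy"
  using assms unfolding partials_def partially_differentiable_def partial_x_def partial_y_def
  by (auto intro!: ext vector_derivative_at intro: differentiableI_vector)

lemma partially_differentiable_partials:
  "partially_differentiable f \<Longrightarrow> partials f (partial_x f) (partial_y f)"
  unfolding partials_def partially_differentiable_def partial_x_def partial_y_def
  by (simp add: vector_derivative_works)

lemma partials_add:
  "partials f fx fy \<Longrightarrow> partials g gx gy \<Longrightarrow>
    partials (\<lambda>x y. f x y + g x y) (\<lambda>x y. fx x y + gx x y) (\<lambda>x y. fy x y + gy x y)"
  unfolding partials_def by (auto intro!: derivative_intros)

lemma partials_cmult:
  "partials f fx fy \<Longrightarrow> partials (\<lambda>x y. a * f x y) (\<lambda>x y. a * fx x y) (\<lambda>x y. a * fy x y)"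
  unfolding partials_def by (auto intro!: has_vector_derivative_mult_right)

lemma partials_mult:
  "partials f fx fy \<Longrightarrow> partials g gx gy \<Longrightarrow>
    partials (\<lambda>x y. f x y * g x y) (\<lambda>x y. fx x y * g x y + f x y * gx x y)
      (\<lambda>x y. fy x y * g x y + f x y * gy x y)"
  unfolding partials_def by (auto intro!: has_vector_derivative_eq_rhs[OF has_vector_derivative_mult])

lemma partials_cnj:
  "partials f fx fy \<Longrightarrow> partials (\<lambda>x y. cnj (f x y)) (\<lambda>x y. cnj (fx x y)) (\<lambda>x y. cnj (fy x y))"
  unfolding partials_def
  by (auto intro!: bounded_linear.has_vector_derivative[OF bounded_linear_cnj])

lemma has_vector_derivative_shift:
  assumes "(g has_vector_derivative d) (at (x + a))"
  shows "((\<lambda>t. g (t + a)) has_vector_derivative d) (at (x::real))"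
proof -
  have "((\<lambda>t. t + a) has_vector_derivative 1) (at x)"
    by (auto intro!: derivative_eq_intros)
  from vector_diff_chain_at[OF this, of g d] assms show ?thesis by (simp add: o_def)
qed

lemma partials_shift:
  assumes "partials f fx fy"
  shows "partials (\<lambda>x y. f (x + a) (y + b)) (\<lambda>x y. fx (x + a) (y + b)) (\<lambda>x y. fy (x + a) (y + b))"
  using assms unfolding partials_def
  by (auto intro!: has_vector_derivative_shift[of "\<lambda>t. f t _"] has_vector_derivative_shift[of "\<lambda>t. f _ t"])

lemma partials_x_only:
  assumes "\<And>x. (g has_vector_derivative g' x) (at x)"
  shows "partials (\<lambda>x y. g x) (\<lambda>x y. g' x) (\<lambda>x y. 0)"
  using assms by (auto simp: partials_def)

lemma partials_x_mult:
  assumes "partials f fx fy"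
  shows "partials (\<lambda>x y. of_real x * f x y) (\<lambda>x y. f x y + of_real x * fx x y) (\<lambda>x y. of_real x * fy x y)"
proof -
  have "partials (\<lambda>x y. of_real x) (\<lambda>x y. 1) (\<lambda>x y. 0)"
    by (rule partials_x_only) (auto intro!: derivative_eq_intros simp: of_real_def)
  from partials_mult[OF this assms] show ?thesis by simp
qed

lemma continuous2_cong_shift:
  assumes "continuous2 f" shows "continuous2 (\<lambda>x y. f (x + a) (y + b))"
proof -
  have "continuous_on UNIV ((\<lambda>(x, y). f x y) \<circ> (\<lambda>(x, y). (x + a, y + b)))"
  proof (rule continuous_on_compose)
    show "continuous_on UNIV (\<lambda>(x, y). (x + a, y + b))"
      unfolding case_prod_unfold by (intro continuous_intros)
  qed (rule continuous_on_subset[OF assms], simp)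
  then show ?thesis by (simp add: o_def case_prod_unfold)
qed

lemma continuous2_y: "continuous2 f \<Longrightarrow> continuous_on A (f x)"
proof -
  assume f: "continuous2 f"
  have "continuous_on A ((\<lambda>(x, y). f x y) \<circ> (\<lambda>t. (x, t)))"
    by (rule continuous_on_compose) (auto intro!: continuous_intros continuous_on_subset[OF f])
  then show ?thesis by (simp add: o_def)
qed

text \<open>Schwarz's theorem through integration: f is the integral of \<open>fy\<close> in y,
  differentiation in x under the integral sign exhibits \<open>fx\<close> as the integral of
  \<open>fyx\<close>, and the fundamental theorem in y then identifies \<open>fxy\<close>.\<close>

lemma symmetric_partials:
  assumes f: "partials f fx fy" and fx: "partials fx fxx fxy" and fy: "partials fy fyx fyy"
    and cfy: "continuous2 fy" and cfyx: "continuous2 fyx"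
  shows "fxy = fyx"
proof (intro ext)
  fix x0 y0
  \<comment> \<open>The base point lies strictly below y0 and the end point strictly above, so that
    one-sided derivatives at y0 become two-sided.\<close>
  define a b :: real where "a = y0 - 1" and "b = y0 + 1"
  have ftc: "f x y = f x a + integral {a..y} (fy x)" if "a \<le> y" for x and y :: real
  proof -
    have "((fy x) has_integral (f x y - f x a)) {a..y}"
      by (rule fundamental_theorem_of_calculus[OF that])
        (use partials_y[OF f] in \<open>auto intro: has_vector_derivative_at_within\<close>)
    then show ?thesis by (simp add: integral_unique)
  qed
  have fx_eq: "fx x0 y = fx x0 a + integral {a..y} (fyx x0)" if "a \<le> y" for y :: real
  proof -
    have "((\<lambda>x. integral (cbox a y) (fy x)) has_vector_derivative integral (cbox a y) (fyx x0)) (at x0 within UNIV)"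
    proof (rule leibniz_rule_vector_derivative)
      show "((\<lambda>x. fy x t) has_vector_derivative fyx x t) (at x within UNIV)" for x t
        using partials_x[OF fy] by simp
      show "fy x integrable_on cbox a y" for x
        by (intro integrable_continuous continuous2_y cfy)
      show "continuous_on (UNIV \<times> cbox a y) (\<lambda>(x, t). fyx x t)"
        by (rule continuous_on_subset[OF cfyx]) auto
    qed auto
    then have "((\<lambda>x. f x a + integral {a..y} (fy x)) has_vector_derivative
        fx x0 a + integral {a..y} (fyx x0)) (at x0)"
      by (intro has_vector_derivative_add partials_x[OF f]) (simp_all add: box_real)
    moreover have "((\<lambda>x. f x a + integral {a..y} (fy x)) has_vector_derivative fx x0 y) (at x0)"
      using partials_x[OF f, of y x0] ftc[OF that] by simp
    ultimately show ?thesis by (metis vector_derivative_unique_at)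
  qed
  have "((\<lambda>u. integral {a..u} (fyx x0)) has_vector_derivative fyx x0 y0) (at y0 within {a..b})"
    by (rule integral_has_vector_derivative) (auto intro: continuous2_y cfyx simp: a_def b_def)
  then have "((\<lambda>u. integral {a..u} (fyx x0)) has_vector_derivative fyx x0 y0) (at y0)"
    by (simp add: at_within_Icc_at a_def b_def)
  then have "((\<lambda>u. fx x0 a + integral {a..u} (fyx x0)) has_vector_derivative fyx x0 y0) (at y0)"
    by (auto intro!: derivative_eq_intros)
  moreover have "((\<lambda>u. fx x0 a + integral {a..u} (fyx x0)) has_vector_derivative fxy x0 y0) (at y0)"
  proof (rule has_vector_derivative_transform_within_open[OF partials_y[OF fx], of "{a<..}"])
    show "fx x0 u = fx x0 a + integral {a..u} (fyx x0)" if "u \<in> {a<..}" for u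
      using fx_eq[of u] that by simp
  qed (auto simp: a_def)
  ultimately show "fxy x0 y0 = fyx x0 y0" by (metis vector_derivative_unique_at)
qed

lemma smooth_partials:
  assumes "smooth f"
  shows "partials f (partial_x f) (partial_y f)" "smooth (partial_x f)" "smooth (partial_y f)" "continuous2 f"
  using assms by (auto elim: smooth.cases intro: partially_differentiable_partials)

lemma smooth_commute:
  assumes "smooth f" shows "partial_y (partial_x f) = partial_x (partial_y f)"
  using assms symmetric_partials[of f "partial_x f" "partial_y f"] smooth_partials by blast

lemma smooth_funpow: "smooth f \<Longrightarrow> smooth ((partial_x ^^ i) ((partial_y ^^ j) f))"
proof (induction i)
  case 0 then show ?case by (induction j) (auto intro: smooth_partials)
qed (auto intro: smooth_partials)

lemma smooth_commute_funpow:
  assumes "smooth f" shows "partial_y ((partial_x ^^ i) f) = (partial_x ^^ i) (partial_y f)"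
proof (induction i)
  case (Suc i)
  have "partial_y ((partial_x ^^ Suc i) f) = partial_x (partial_y ((partial_x ^^ i) f))"
    using smooth_commute[OF smooth_funpow[OF assms, of i 0]] by simp
  then show ?case using Suc by simp
qed simp

section \<open>Coinductive description of Schwartz functions and closure properties\<close>

inductive_set lspan :: "mfun set \<Rightarrow> mfun set" for S
  where base: "f \<in> S \<Longrightarrow> f \<in> lspan S"
  | add: "f \<in> lspan S \<Longrightarrow> g \<in> lspan S \<Longrightarrow> (\<lambda>x y. f x y + g x y) \<in> lspan S"
  | scale: "f \<in> lspan S \<Longrightarrow> (\<lambda>x y. a * f x y) \<in> lspan S"

text \<open>One unfolding of the Schwartz conditions, with T as the set in which the derivatives and
  the product with x have to lie.\<close>

abbreviation schwartz_step :: "mfun set \<Rightarrow> mfun \<Rightarrow> bool"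
  where "schwartz_step T f \<equiv> continuous2 f \<and> periodic2 f \<and> bounded2 f \<and>
    (\<exists>fx fy. partials f fx fy \<and> fx \<in> T \<and> fy \<in> T) \<and> (\<lambda>x y. of_real x * f x y) \<in> T"

text \<open>All functions that enter the seminorms arise from f by applying the closure conditions
  finitely often, hence are bounded as members of S. Together with \<open>Xi_props\<close> this
  makes \<open>Xi\<close> the largest set that satisfies \<open>schwartz_step\<close> relative to
  itself.\<close>

lemma Xi_largest:
  assumes S: "\<And>f. f \<in> S \<Longrightarrow> schwartz_step S f"
  shows "S \<subseteq> Xi"
proof
  fix f assume f: "f \<in> S"
  have px: "partial_x g \<in> S" and py: "partial_y g \<in> S" if "g \<in> S" for g
    using S[OF that] partials_imp by blast+
  have "(partial_y ^^ j) f \<in> S" for j by (induction j) (auto intro: py f)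
  then have d: "(partial_x ^^ i) ((partial_y ^^ j) f) \<in> S" for i j by (induction i) (auto intro: px)
  have xn: "(\<lambda>x y. of_real (x ^ n) * g x y) \<in> S" if "g \<in> S" for g n
  proof (induction n)
    case (Suc n)
    then have "(\<lambda>x y. of_real x * (of_real (x ^ n) * g x y)) \<in> S" using S by blast
    then show ?case by (simp add: mult.assoc)
  qed (use that in simp)
  have "smooth f" using f
  proof (coinduction arbitrary: f rule: smooth.coinduct)
    case smooth then show ?case using S px py partials_imp(1) by metis
  qed
  then show "f \<in> Xi" unfolding Xi_def using S[OF f] S[OF xn[OF d]] by blast
qed

text \<open>Coinduction up to linear combinations, which is what the Leibniz rule produces.\<close>

lemma lspan_subset_Xi:
  assumes S: "\<And>f. f \<in> S \<Longrightarrow> schwartz_step (lspan S) f"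
  shows "lspan S \<subseteq> Xi"
proof (rule Xi_largest)
    fix f assume "f \<in> lspan S"
    then show "schwartz_step (lspan S) f"
    proof induction
      case (base f) then show ?case by (rule S)
    next
      case (add f g)
      then obtain B1 B2 where "\<And>x y. norm (f x y) \<le> B1" "\<And>x y. norm (g x y) \<le> B2" by blast
      then have "\<forall>x y. norm (f x y + g x y) \<le> B1 + B2" by (meson norm_add_rule_thm)
      moreover have "continuous2 (\<lambda>x y. f x y + g x y)"
        using add.IH by (simp add: case_prod_unfold continuous_on_add)
      moreover have "(\<lambda>x y. of_real x * (f x y + g x y)) \<in> lspan S"
        using lspan.add[of "\<lambda>x y. of_real x * f x y" S "\<lambda>x y. of_real x * g x y"] add.IH
        by (simp add: distrib_left)
      moreover have "periodic2 (\<lambda>x y. f x y + g x y)" using add.IH by simp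
      moreover have "\<exists>fx fy. partials (\<lambda>x y. f x y + g x y) fx fy \<and> fx \<in> lspan S \<and> fy \<in> lspan S"
        using add.IH partials_add lspan.add by blast
      ultimately show ?case by blast
    next
      case (scale f a)
      then obtain B where B: "\<And>x y. norm (f x y) \<le> B" by blast
      have "\<forall>x y. norm (a * f x y) \<le> norm a * B" by (simp add: B mult_left_mono norm_mult)
      moreover have "continuous2 (\<lambda>x y. a * f x y)"
        using scale.IH by (simp add: case_prod_unfold continuous_on_mult_left)
      moreover have "(\<lambda>x y. of_real x * (a * f x y)) \<in> lspan S"
        using lspan.scale[of "\<lambda>x y. of_real x * f x y" S a] scale.IH
        by (simp add: mult.left_commute)
      moreover have "periodic2 (\<lambda>x y. a * f x y)" using scale.IH by simp
      moreover have "\<exists>fx fy. partials (\<lambda>x y. a * f x y) fx fy \<and> fx \<in> lspan S \<and> fy \<in> lspan S"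
        using scale.IH partials_cmult lspan.scale by blast
      ultimately show ?case by blast
    qed
qed

lemma Xi_coinduct:
  assumes "\<And>f. f \<in> S \<Longrightarrow> schwartz_step (lspan S) f"
    and "f \<in> S"
  shows "f \<in> Xi"
  using lspan_subset_Xi[OF assms(1)] lspan.base[OF assms(2)] by blast

lemma periodic2_partial_x: "periodic2 f \<Longrightarrow> periodic2 (partial_x f)"
  by (simp add: partial_x_def)

lemma periodic2_partial_y:
  assumes "periodic2 f" "partials f fx fy" shows "periodic2 fy"
proof (intro allI)
  fix x y
  have "((\<lambda>t. f x (t + 1)) has_vector_derivative fy x (y + 1)) (at y)"
    by (rule has_vector_derivative_shift[of "\<lambda>t. f x t"]) (rule partials_y[OF assms(2)])
  then show "fy x (y + 1) = fy x y"
    using assms(1) partials_y[OF assms(2), of x y] vector_derivative_unique_at by fastforce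
qed

text \<open>Monomials times iterated derivatives of f are closed under \<open>partial_x\<close> only
  up to linear combinations, since the Leibniz rule adds a term with x ^ (n - 1). For
  \<open>partial_y\<close> the symmetry of second derivatives restores the order in which
  \<open>Xi\<close> lists the derivatives.\<close>

lemma Xi_monomial_derivative:
  assumes f: "f \<in> Xi"
  shows "(\<lambda>x y. of_real (x ^ n) * (partial_x ^^ i) ((partial_y ^^ j) f) x y) \<in> Xi"
proof -
  define D where "D i j = (partial_x ^^ i) ((partial_y ^^ j) f)" for i j
  define S where "S = {g. \<exists>n i j. g = (\<lambda>x y. of_real (x ^ n) * D i j x y)}"
  have sf: "smooth f" using f by (simp add: Xi_def)
  have sD: "smooth (D i j)" for i j unfolding D_def by (rule smooth_funpow[OF sf])
  have Dx: "partial_x (D i j) = D (Suc i) j" for i j by (simp add: D_def)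
  have Dy: "partial_y (D i j) = D i (Suc j)" for i j
    using smooth_commute_funpow[OF smooth_funpow[OF sf, of 0 j], of i] by (simp add: D_def)
  have per0: "periodic2 (D 0 j)" for j
  proof (induction j)
    case 0 then show ?case using f by (simp add: Xi_def D_def)
  next
    case (Suc j) show ?case
      using periodic2_partial_y[OF Suc smooth_partials(1)[OF sD]] unfolding Dy .
  qed
  have per: "periodic2 (D i j)" for i j
  proof (induction i)
    case (Suc i) show ?case using periodic2_partial_x[OF Suc.IH] unfolding Dx .
  qed (rule per0)
  have "g \<in> Xi" if "g \<in> S" for g
  proof (rule Xi_coinduct[OF _ that])
    fix g assume "g \<in> S"
    then obtain n i j where g: "g = (\<lambda>x y. of_real (x ^ n) * D i j x y)" unfolding S_def by blast
    have mem: "(\<lambda>x y. of_real (x ^ n) * D i j x y) \<in> lspan S" for n i j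
      by (rule lspan.base) (auto simp: S_def)
    have "partials (\<lambda>x y. of_real (x ^ n)) (\<lambda>x y. of_nat n * of_real (x ^ (n - 1))) (\<lambda>x y. 0)"
      by (rule partials_x_only)
        (rule has_vector_derivative_eq_rhs[OF has_vector_derivative_of_real],
          auto intro!: derivative_eq_intros)
    from partials_mult[OF this smooth_partials(1)[OF sD[of i j]]]
    have "partials g (\<lambda>x y. of_nat n * (of_real (x ^ (n - 1)) * D i j x y) + of_real (x ^ n) * D (Suc i) j x y)
        (\<lambda>x y. of_real (x ^ n) * D i (Suc j) x y)"
      by (simp add: g Dx Dy mult.assoc)
    moreover have "(\<lambda>x y. of_nat n * (of_real (x ^ (n - 1)) * D i j x y) + of_real (x ^ n) * D (Suc i) j x y) \<in> lspan S"
      by (intro lspan.add lspan.scale mem)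
    moreover have "(\<lambda>x y. of_real x * g x y) \<in> lspan S"
      using mem[of "Suc n" i j] by (simp add: g mult.assoc)
    moreover have "continuous2 g"
      using smooth_partials(4)[OF sD[of i j]] unfolding g case_prod_unfold
      by (intro continuous_intros) auto
    moreover have "bounded2 g" using f unfolding g D_def Xi_def by blast
    moreover have "periodic2 g" using per by (simp add: g)
    ultimately show "schwartz_step (lspan S) g"
      using mem[of n i "Suc j"] by blast
  qed
  then show ?thesis by (auto simp: S_def D_def)
qed

lemma Xi_x: "f \<in> Xi \<Longrightarrow> (\<lambda>x y. of_real x * f x y) \<in> Xi"
  using Xi_monomial_derivative[of f 1 0 0] by simp

lemma Xi_partial_x: "f \<in> Xi \<Longrightarrow> partial_x f \<in> Xi"
  using Xi_monomial_derivative[of f 0 1 0] by simp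

lemma Xi_partial_y: "f \<in> Xi \<Longrightarrow> partial_y f \<in> Xi"
  using Xi_monomial_derivative[of f 0 0 1] by simp

lemma Xi_smooth: "f \<in> Xi \<Longrightarrow> smooth f"
  and Xi_continuous: "f \<in> Xi \<Longrightarrow> continuous2 f"
  and Xi_periodic: "f \<in> Xi \<Longrightarrow> f x (y + 1) = f x y"
  and Xi_partials: "f \<in> Xi \<Longrightarrow> partials f (partial_x f) (partial_y f)"
  by (auto simp: Xi_def intro: smooth_partials)

lemma Xi_bounded: "f \<in> Xi \<Longrightarrow> bounded2 f"
proof -
  assume "f \<in> Xi"
  then have "\<exists>B. \<forall>x y. norm (of_real (x ^ 0) * ((partial_x ^^ 0) ((partial_y ^^ 0) f)) x y) \<le> B"
    unfolding Xi_def by blast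
  then show ?thesis by simp
qed

lemma Xi_props:
  assumes "f \<in> Xi"
  shows "schwartz_step Xi f"
  using Xi_continuous[OF assms] Xi_bounded[OF assms] Xi_periodic[OF assms] Xi_partials[OF assms]
    Xi_x[OF assms] Xi_partial_x[OF assms] Xi_partial_y[OF assms] by blast

lemma lspan_Xi: "lspan Xi \<subseteq> Xi"
proof (rule lspan_subset_Xi)
  fix f assume "f \<in> Xi"
  moreover have "Xi \<subseteq> lspan Xi" by (auto intro: lspan.base)
  ultimately show "schwartz_step (lspan Xi) f"
    using Xi_props by blast
qed

lemma Xi_add: "f \<in> Xi \<Longrightarrow> g \<in> Xi \<Longrightarrow> (\<lambda>x y. f x y + g x y) \<in> Xi"
  and Xi_cmult: "f \<in> Xi \<Longrightarrow> (\<lambda>x y. a * f x y) \<in> Xi"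
  using lspan_Xi by (auto intro: lspan.intros)

lemma Xi_shift:
  assumes "f \<in> Xi" shows "(\<lambda>x y. f (x + a) (y + b)) \<in> Xi"
proof -
  define S where "S = {\<lambda>x y. g (x + a) (y + b) | g. g \<in> Xi}"
  have "(\<lambda>x y. f (x + a) (y + b)) \<in> S" using assms by (auto simp: S_def)
  then show ?thesis
  proof (rule Xi_coinduct[rotated])
    fix h assume "h \<in> S"
    then obtain g where g: "g \<in> Xi" and h: "h = (\<lambda>x y. g (x + a) (y + b))" by (auto simp: S_def)
    have mem: "(\<lambda>x y. g (x + a) (y + b)) \<in> lspan S" if "g \<in> Xi" for g
      by (rule lspan.base) (use that in \<open>auto simp: S_def\<close>)
    \<comment> \<open>Multiplication by x does not commute with the shift; the span absorbs the
      difference, since x = (x + a) - a.\<close>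
    have "(\<lambda>x y. of_real (x + a) * g (x + a) (y + b) + (- of_real a) * g (x + a) (y + b)) \<in> lspan S"
      by (intro lspan.add lspan.scale mem[OF Xi_x[OF g]] mem[OF g])
    then have "(\<lambda>x y. of_real x * h x y) \<in> lspan S"
      by (simp add: h algebra_simps)
    moreover have "\<exists>fx fy. partials h fx fy \<and> fx \<in> lspan S \<and> fy \<in> lspan S"
      using partials_shift[OF Xi_partials[OF g]] mem[OF Xi_partial_x[OF g]] mem[OF Xi_partial_y[OF g]]
      unfolding h by blast
    moreover have "continuous2 h" unfolding h by (rule continuous2_cong_shift[OF Xi_continuous[OF g]])
    moreover have "periodic2 h" using Xi_periodic[OF g, of _ "_ + b"] by (simp add: h algebra_simps)
    moreover have "bounded2 h" using Xi_bounded[OF g] unfolding h by blast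
    ultimately show "schwartz_step (lspan S) h"
      by blast
  qed
qed

lemma continuous2_mult:
  "continuous2 f \<Longrightarrow> continuous2 g \<Longrightarrow> continuous2 (\<lambda>x y. f x y * g x y)"
  by (simp add: case_prod_unfold continuous_on_mult)

lemma continuous2_cnj: "continuous2 f \<Longrightarrow> continuous2 (\<lambda>x y. cnj (f x y))"
  by (simp add: case_prod_unfold continuous_on_cnj)

lemma Xi_cnj:
  assumes "f \<in> Xi" shows "(\<lambda>x y. cnj (f x y)) \<in> Xi"
proof -
  define S where "S = {\<lambda>x y. cnj (g x y) | g. g \<in> Xi}"
  have "(\<lambda>x y. cnj (f x y)) \<in> S" using assms by (auto simp: S_def)
  then show ?thesis
  proof (rule Xi_coinduct[rotated])
    fix h assume "h \<in> S"
    then obtain g where g: "g \<in> Xi" and h: "h = (\<lambda>x y. cnj (g x y))" by (auto simp: S_def)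
    have mem: "(\<lambda>x y. cnj (g x y)) \<in> lspan S" if "g \<in> Xi" for g
      by (rule lspan.base) (use that in \<open>auto simp: S_def\<close>)
    have "(\<lambda>x y. of_real x * h x y) \<in> lspan S"
      using mem[OF Xi_x[OF g]] by (simp add: h)
    moreover have "\<exists>fx fy. partials h fx fy \<and> fx \<in> lspan S \<and> fy \<in> lspan S"
      using partials_cnj[OF Xi_partials[OF g]] mem[OF Xi_partial_x[OF g]] mem[OF Xi_partial_y[OF g]]
      unfolding h by blast
    moreover have "continuous2 h" unfolding h by (rule continuous2_cnj[OF Xi_continuous[OF g]])
    moreover have "periodic2 h" using Xi_periodic[OF g] by (simp add: h)
    moreover have "bounded2 h" using Xi_bounded[OF g] by (simp add: h)
    ultimately show "schwartz_step (lspan S) h"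
      by blast
  qed
qed

lemma Xi_mult:
  assumes "f \<in> Xi" "g \<in> Xi" shows "(\<lambda>x y. f x y * g x y) \<in> Xi"
proof -
  define S where "S = {\<lambda>x y. f x y * g x y | f g. f \<in> Xi \<and> g \<in> Xi}"
  have "(\<lambda>x y. f x y * g x y) \<in> S" using assms by (auto simp: S_def)
  then show ?thesis
  proof (rule Xi_coinduct[rotated])
    fix h assume "h \<in> S"
    then obtain f g where f: "f \<in> Xi" and g: "g \<in> Xi" and h: "h = (\<lambda>x y. f x y * g x y)" by (auto simp: S_def)
    have mem: "(\<lambda>x y. f x y * g x y) \<in> lspan S" if "f \<in> Xi" "g \<in> Xi" for f g
      by (rule lspan.base) (use that in \<open>auto simp: S_def\<close>)
    have "(\<lambda>x y. of_real x * h x y) \<in> lspan S"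
      using mem[OF Xi_x[OF f] g] by (simp add: h mult.assoc)
    moreover have "\<exists>fx fy. partials h fx fy \<and> fx \<in> lspan S \<and> fy \<in> lspan S"
      using partials_mult[OF Xi_partials[OF f] Xi_partials[OF g]]
        lspan.add[OF mem[OF Xi_partial_x[OF f] g] mem[OF f Xi_partial_x[OF g]]]
        lspan.add[OF mem[OF Xi_partial_y[OF f] g] mem[OF f Xi_partial_y[OF g]]]
      unfolding h by blast
    moreover have "continuous2 h"
      unfolding h by (rule continuous2_mult[OF Xi_continuous[OF f] Xi_continuous[OF g]])
    moreover have "periodic2 h" using Xi_periodic[OF f] Xi_periodic[OF g] by (simp add: h)
    moreover have "bounded2 h"
    proof -
      obtain A B where A: "\<And>x y. norm (f x y) \<le> A" and B: "\<And>x y. norm (g x y) \<le> B"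
        using Xi_bounded[OF f] Xi_bounded[OF g] by blast
      have "norm (h x y) \<le> A * B" for x y
        unfolding h norm_mult by (intro mult_mono A B order.trans[OF norm_ge_zero A] norm_ge_zero)
      then show ?thesis by blast
    qed
    ultimately show "schwartz_step (lspan S) h"
      by blast
  qed
qed

lemma Xi_zero: "(\<lambda>x y. 0) \<in> Xi"
  by (rule Xi_coinduct[of "{\<lambda>x y. 0}"]) (auto simp: case_prod_unfold partials_def intro!: exI lspan.base)

lemma Xi_sum: "(\<And>i. i \<in> I \<Longrightarrow> f i \<in> Xi) \<Longrightarrow> (\<lambda>x y. \<Sum>i\<in>I. f i x y) \<in> Xi"
  by (induction I rule: infinite_finite_induct) (simp_all add: Xi_zero Xi_add)

lemma Xi_diff: "f \<in> Xi \<Longrightarrow> g \<in> Xi \<Longrightarrow> (\<lambda>x y. f x y - g x y) \<in> Xi"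
  using Xi_add[OF _ Xi_cmult[of g "-1"], of f] by simp

lemma Xi_uminus: "f \<in> Xi \<Longrightarrow> (\<lambda>x y. - f x y) \<in> Xi"
  using Xi_cmult[of f "-1"] by simp

subsection \<open>Decay and termwise differentiation\<close>

text \<open>The reciprocal is summable over the integers, and \<open>wt_add\<close> and
  \<open>wt_diff\<close> trade decay in a difference of two arguments for decay in each of
  them.\<close>

definition wt :: "real \<Rightarrow> real" where "wt x = 1 + x\<^sup>2"

lemma wt_ge1: "1 \<le> wt x" and wt_pos: "0 < wt x"
  by (simp_all add: wt_def add_pos_nonneg)

lemma wt_minus [simp]: "wt (- x) = wt x"
  by (simp add: wt_def)

text \<open>Peetre's inequality: the right side minus the left side is the sum of squares in the
  first step of the proof.\<close>

lemma wt_add: "wt (x + y) \<le> 2 * wt x * wt y"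
proof -
  have "0 \<le> (x - y)\<^sup>2 + 2 * (x * y)\<^sup>2 + 1" by simp
  then show ?thesis by (simp add: wt_def power2_eq_square algebra_simps)
qed

lemma wt_diff: "wt (x - y) \<le> 2 * wt x * wt y"
  using wt_add[of x "- y"] by simp

lemma wt_scale:
  assumes "h \<noteq> 0" obtains \<kappa> where "\<kappa> \<ge> 1" "\<And>x. wt x \<le> \<kappa> * wt (h * x)"
proof
  show "1 + 1 / h\<^sup>2 \<ge> (1::real)" by simp
  show "wt x \<le> (1 + 1 / h\<^sup>2) * wt (h * x)" for x
  proof -
    have "(1 + 1 / h\<^sup>2) * wt (h * x) = wt x + (h * x)\<^sup>2 + 1 / h\<^sup>2"
      using assms by (simp add: wt_def field_simps power_mult_distrib)
    then show ?thesis by simp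
  qed
qed

lemma wt_power_mono: "m \<le> n \<Longrightarrow> wt x ^ m \<le> wt x ^ n"
  by (rule power_increasing[OF _ wt_ge1])

lemma Xi_decay:
  assumes "f \<in> Xi" obtains C where "0 \<le> C" "\<And>x y. norm (f x y) \<le> C / wt x ^ n"
proof -
  have "(\<lambda>x y. of_real (wt x ^ n) * f x y) \<in> Xi"
  proof (induction n)
    case (Suc n)
    then have "(\<lambda>x y. of_real (wt x ^ n) * f x y + of_real x * (of_real x * (of_real (wt x ^ n) * f x y))) \<in> Xi"
      by (intro Xi_add Xi_x)
    then show ?case by (simp add: wt_def algebra_simps power2_eq_square)
  qed (use assms in simp)
  then obtain B where B: "\<And>x y. norm (of_real (wt x ^ n) * f x y) \<le> B" using Xi_bounded by blast
  have B: "wt x ^ n * norm (f x y) \<le> B" for x y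
    using B[of x y] wt_pos[of x] by (simp add: norm_mult norm_power)
  have "0 \<le> B" using B[of 0 0] by (simp add: wt_def) (meson norm_ge_zero order.trans)
  moreover have "norm (f x y) \<le> B / wt x ^ n" for x y
    using B[of x y] wt_pos[of x] by (simp add: field_simps)
  ultimately show ?thesis using that by blast
qed

lemma summable_inverse_wt_nat: "summable (\<lambda>n. 1 / wt (of_nat n))"
proof (rule summable_comparison_test[OF exI[of _ 1]], intro allI impI)
  show "summable (\<lambda>n. inverse (real n ^ 2))" by (rule inverse_power_summable) simp
  fix n :: nat assume "1 \<le> n"
  then have "1 / (1 + (real n)\<^sup>2) \<le> 1 / (real n)\<^sup>2"
    by (intro frac_le) auto
  then show "norm (1 / wt (real n)) \<le> inverse (real n ^ 2)"
    by (simp add: wt_def inverse_eq_divide)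
qed

lemma summable_on_int:
  fixes g :: "int \<Rightarrow> real"
  assumes "summable (\<lambda>n. g (int n))" "summable (\<lambda>n. g (- int n))" "\<And>k. g k \<ge> 0"
  shows "g summable_on UNIV"
proof -
  have "(\<lambda>n. g (int n)) summable_on UNIV" "(\<lambda>n. g (- int n)) summable_on UNIV"
    using assms by (auto intro!: summable_nonneg_imp_summable_on)
  then have "g summable_on (range int)" "g summable_on (range (\<lambda>n. - int n))"
    by (subst summable_on_reindex; auto simp: inj_on_def o_def)+
  then have "g summable_on (range int \<union> range (\<lambda>n. - int n))"
    by (rule summable_on_union)
  moreover have "range int \<union> range (\<lambda>n. - int n) = UNIV"
    by (auto simp: image_iff) (metis int_cases2)
  ultimately show ?thesis by simp
qed

lemma summable_inverse_wt: "(\<lambda>k. 1 / wt (of_int k)) summable_on (UNIV :: int set)"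
  by (rule summable_on_int) (use summable_inverse_wt_nat wt_pos in \<open>auto simp: less_imp_le\<close>)

lemma summable_inverse_wt2:
  "(\<lambda>(k, q). 1 / (wt (of_int k) * wt (of_int q))) summable_on (UNIV :: (int \<times> int) set)"
proof -
  have "(\<lambda>(k, q). 1 / (wt (of_int k) * wt (of_int q))) summable_on (UNIV :: int set) \<times> (UNIV :: int set)"
  proof (rule summable_on_SigmaI)
    fix k :: int
    have "((\<lambda>q. 1 / wt (of_int k) * (1 / wt (of_int q))) has_sum
        1 / wt (of_int k) * (\<Sum>\<^sub>\<infinity>q::int. 1 / wt (of_int q))) UNIV"
      by (rule has_sum_cmult_right[OF has_sum_infsum[OF summable_inverse_wt]])
    then show "((\<lambda>q. case (k, q) of (k, q) \<Rightarrow> 1 / (wt (of_int k) * wt (of_int q))) has_sum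
        1 / wt (of_int k) * (\<Sum>\<^sub>\<infinity>q::int. 1 / wt (of_int q))) UNIV"
      by simp
  next
    show "(\<lambda>k. 1 / wt (of_int k) * (\<Sum>\<^sub>\<infinity>q::int. 1 / wt (of_int q))) summable_on (UNIV :: int set)"
      by (rule summable_on_cmult_left[OF summable_inverse_wt])
  qed (use wt_pos in \<open>simp add: less_imp_le\<close>)
  then show ?thesis by simp
qed

lemma summable_on_bound:
  fixes f :: "'i \<Rightarrow> complex"
  assumes "M summable_on A" "\<And>i. i \<in> A \<Longrightarrow> norm (f i) \<le> M i"
  shows "f summable_on A"
  by (rule abs_summable_summable, rule Infinite_Sum.abs_summable_on_comparison_test'[OF assms])

text \<open>Weierstrass majorants, uniform in y but only locally uniform in x: this is what
  multiplication by x preserves, and what termwise continuity and differentiation require.\<close>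

definition loc_summable :: "('i \<Rightarrow> mfun) \<Rightarrow> bool"
  where "loc_summable F \<longleftrightarrow>
    (\<forall>r. \<exists>M. M summable_on UNIV \<and> (\<forall>i x y. \<bar>x\<bar> \<le> r \<longrightarrow> norm (F i x y) \<le> M i))"

lemma loc_summableD:
  assumes "loc_summable F" shows "(\<lambda>i. F i x y) summable_on UNIV"
proof -
  obtain M where "M summable_on UNIV" "\<And>i u v. \<bar>u\<bar> \<le> \<bar>x\<bar> \<Longrightarrow> norm (F i u v) \<le> M i"
    using assms unfolding loc_summable_def by metis
  then show ?thesis by (intro summable_on_bound[of M]) auto
qed

lemma loc_summable_add:
  assumes "loc_summable F" "loc_summable G" shows "loc_summable (\<lambda>i x y. F i x y + G i x y)"
  unfolding loc_summable_def
proof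
  fix r
  obtain M where M: "M summable_on UNIV" "\<And>i u v. \<bar>u\<bar> \<le> r \<Longrightarrow> norm (F i u v) \<le> M i"
    using assms(1) unfolding loc_summable_def by metis
  obtain N where N: "N summable_on UNIV" "\<And>i u v. \<bar>u\<bar> \<le> r \<Longrightarrow> norm (G i u v) \<le> N i"
    using assms(2) unfolding loc_summable_def by metis
  have "(\<lambda>i. M i + N i) summable_on UNIV" by (rule summable_on_add[OF M(1) N(1)])
  moreover have "\<forall>i x y. \<bar>x\<bar> \<le> r \<longrightarrow> norm (F i x y + G i x y) \<le> M i + N i"
    by (meson M(2) N(2) norm_add_rule_thm)
  ultimately show "\<exists>M. M summable_on UNIV \<and> (\<forall>i x y. \<bar>x\<bar> \<le> r \<longrightarrow> norm (F i x y + G i x y) \<le> M i)"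
    by blast
qed

lemma loc_summable_mult:
  assumes "loc_summable F" "\<And>x y. norm (a x y) \<le> A * (1 + \<bar>x\<bar>)" "A \<ge> 0"
  shows "loc_summable (\<lambda>i x y. a x y * F i x y)"
  unfolding loc_summable_def
proof
  fix r
  obtain M where M: "M summable_on UNIV" "\<And>i u v. \<bar>u\<bar> \<le> r \<Longrightarrow> norm (F i u v) \<le> M i"
    using assms(1) unfolding loc_summable_def by metis
  have "norm (a x y * F i x y) \<le> (A * (1 + r)) * M i" if "\<bar>x\<bar> \<le> r" for i x y
    unfolding norm_mult
  proof (rule mult_mono)
    show "norm (a x y) \<le> A * (1 + r)"
      using assms(2)[of x y] that assms(3) by (smt (verit) mult_left_mono)
    show "0 \<le> A * (1 + r)" using that assms(3) by simp
  qed (use M(2)[OF that] in auto)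
  then show "\<exists>M. M summable_on UNIV \<and> (\<forall>i x y. \<bar>x\<bar> \<le> r \<longrightarrow> norm (a x y * F i x y) \<le> M i)"
    using summable_on_cmult_right[OF M(1)] by blast
qed

lemma loc_summable_cmult: "loc_summable F \<Longrightarrow> loc_summable (\<lambda>i x y. a * F i x y)"
  by (rule loc_summable_mult[of F "\<lambda>x y. a" "norm a"]) (simp_all add: distrib_left)

lemma loc_summable_x_mult: "loc_summable F \<Longrightarrow> loc_summable (\<lambda>i x y. of_real x * F i x y)"
  by (rule loc_summable_mult[of F "\<lambda>x y. of_real x" 1]) auto

lemma continuous2_infsum:
  assumes F: "loc_summable F" and c: "\<And>i. continuous2 (F i)"
  shows "continuous2 (\<lambda>x y. \<Sum>\<^sub>\<infinity>i. F i x y)"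
proof -
  have "continuous_on ({-r<..<r} \<times> UNIV) (\<lambda>(x, y). \<Sum>\<^sub>\<infinity>i. F i x y)" for r
  proof -
    obtain M where M: "M summable_on UNIV" "\<And>i u v. \<bar>u\<bar> \<le> r \<Longrightarrow> norm (F i u v) \<le> M i"
      using F unfolding loc_summable_def by metis
    have "uniform_limit ({-r<..<r} \<times> UNIV) (\<lambda>X z. \<Sum>i\<in>X. F i (fst z) (snd z)) (\<lambda>z. \<Sum>\<^sub>\<infinity>i. F i (fst z) (snd z))
        (finite_subsets_at_top UNIV)"
      by (rule Weierstrass_m_test_general[OF _ M(1)]) (auto intro!: M(2))
    moreover have "continuous_on ({-r<..<r} \<times> UNIV) (\<lambda>z. \<Sum>i\<in>X. F i (fst z) (snd z))" for X
      using c by (intro continuous_on_sum) (auto simp: case_prod_unfold intro: continuous_on_subset)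
    ultimately show ?thesis
      unfolding case_prod_unfold by (intro uniform_limit_theorem) auto
  qed
  then have "continuous_on (\<Union>r. {-r<..<r} \<times> UNIV) (\<lambda>(x, y). \<Sum>\<^sub>\<infinity>i. F i x y)"
    by (intro continuous_on_open_UN) (auto intro!: open_Times)
  moreover have "(\<Union>r. {-r<..<r} \<times> UNIV) = (UNIV :: (real \<times> real) set)"
  proof (intro set_eqI iffI)
    fix z :: "real \<times> real"
    show "z \<in> (\<Union>r. {-r<..<r} \<times> UNIV)"
      by (cases z) (auto intro!: exI[of _ "\<bar>fst z\<bar> + 1"])
  qed simp
  ultimately show ?thesis by simp
qed

lemma infsum_eq_suminf:
  fixes f :: "'i :: countable \<Rightarrow> complex"
  assumes "infinite (UNIV :: 'i set)" "f summable_on UNIV"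
  shows "(\<lambda>n. f (from_nat_into UNIV n)) sums infsum f UNIV"
proof -
  have bij: "bij_betw (from_nat_into (UNIV :: 'i set)) UNIV UNIV"
    by (rule bij_betw_from_nat_into) (auto simp: assms)
  have "((\<lambda>n. f (from_nat_into UNIV n)) has_sum infsum f UNIV) UNIV"
    using has_sum_reindex_bij_betw[OF bij, of f "infsum f UNIV"] has_sum_infsum[OF assms(2)] by simp
  then show ?thesis by (rule has_sum_imp_sums)
qed

text \<open>The index type is enumerated so that the theorem on differentiating a series applies;
  the majorant M gives uniform convergence of the differentiated partial sums by the M-test.\<close>

lemma infsum_has_vector_derivative:
  fixes f :: "'i :: countable \<Rightarrow> real \<Rightarrow> complex"
  assumes inf: "infinite (UNIV :: 'i set)"
    and d: "\<And>i t. t \<in> S \<Longrightarrow> (f i has_vector_derivative f' i t) (at t)"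
    and M: "M summable_on UNIV" "\<And>i t. t \<in> S \<Longrightarrow> norm (f' i t) \<le> M i"
    and s: "\<And>t. t \<in> S \<Longrightarrow> (\<lambda>i. f i t) summable_on UNIV"
    and S: "open S" "convex S" "t0 \<in> S"
  shows "((\<lambda>t. \<Sum>\<^sub>\<infinity>i. f i t) has_vector_derivative (\<Sum>\<^sub>\<infinity>i. f' i t0)) (at t0)"
proof -
  define e where "e = from_nat_into (UNIV :: 'i set)"
  have bij: "bij_betw e UNIV UNIV"
    unfolding e_def by (rule bij_betw_from_nat_into) (auto simp: inf)
  have "(\<lambda>n. M (e n)) summable_on UNIV"
    using M(1) summable_on_reindex_bij_betw[OF bij, of M] by simp
  then have sM: "summable (\<lambda>n. M (e n))" by (rule summable_on_imp_summable)
  have s': "(\<lambda>i. f' i t) summable_on UNIV" if "t \<in> S" for t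
    using M that by (intro summable_on_bound[of M]) auto
  have g': "(\<Sum>n. f' (e n) t) = (\<Sum>\<^sub>\<infinity>i. f' i t)" if "t \<in> S" for t
    using infsum_eq_suminf[OF inf s'[OF that]] by (simp add: e_def sums_iff)
  have ul: "uniform_limit S (\<lambda>n t. \<Sum>i<n. f' (e i) t) (\<lambda>t. \<Sum>\<^sub>\<infinity>i. f' i t) sequentially"
  proof -
    have "uniform_limit S (\<lambda>n t. \<Sum>i<n. f' (e i) t) (\<lambda>t. \<Sum>n. f' (e n) t) sequentially"
      by (rule Weierstrass_m_test[OF _ sM]) (use M(2) in auto)
    then show ?thesis using g' by (simp cong: uniform_limit_cong')
  qed
  have "\<exists>g. \<forall>t\<in>S. (\<lambda>n. f (e n) t) sums g t \<and>
      (g has_derivative (\<lambda>h. h *\<^sub>R (\<Sum>\<^sub>\<infinity>i. f' i t))) (at t within S)"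
  proof (rule has_derivative_series[OF S(2) _ _ S(3)])
    show "(f (e n) has_derivative (\<lambda>h. h *\<^sub>R f' (e n) t)) (at t within S)" if "t \<in> S" for n t
      using d[OF that, of "e n"] by (auto simp: has_vector_derivative_def intro: has_derivative_at_withinI)
    show "(\<lambda>n. f (e n) t0) sums (\<Sum>\<^sub>\<infinity>i. f i t0)"
      using infsum_eq_suminf[OF inf s[OF S(3)]] by (simp add: e_def)
    fix \<epsilon> :: real assume "\<epsilon> > 0"
    show "\<forall>\<^sub>F n in sequentially. \<forall>t\<in>S. \<forall>h. norm ((\<Sum>i<n. h *\<^sub>R f' (e i) t) - h *\<^sub>R (\<Sum>\<^sub>\<infinity>i. f' i t)) \<le> \<epsilon> * norm h"
      using uniform_limitD[OF ul \<open>\<epsilon> > 0\<close>]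
    proof eventually_elim
      case (elim n)
      show ?case
      proof (intro ballI allI)
        fix t h :: real assume "t \<in> S"
        have "norm ((\<Sum>i<n. h *\<^sub>R f' (e i) t) - h *\<^sub>R (\<Sum>\<^sub>\<infinity>i. f' i t)) =
            norm ((\<Sum>i<n. f' (e i) t) - (\<Sum>\<^sub>\<infinity>i. f' i t)) * norm h"
          by (simp flip: scaleR_sum_right scaleR_diff_right)
        also have "\<dots> \<le> \<epsilon> * norm h"
          using elim \<open>t \<in> S\<close> by (intro mult_right_mono) (auto simp: dist_norm less_imp_le)
        finally show "norm ((\<Sum>i<n. h *\<^sub>R f' (e i) t) - h *\<^sub>R (\<Sum>\<^sub>\<infinity>i. f' i t)) \<le> \<epsilon> * norm h" .
      qed
    qed
  qed
  then obtain g where g: "\<And>t. t \<in> S \<Longrightarrow> (\<lambda>n. f (e n) t) sums g t"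
    "\<And>t. t \<in> S \<Longrightarrow> (g has_vector_derivative (\<Sum>\<^sub>\<infinity>i. f' i t)) (at t within S)"
    by (auto simp: has_vector_derivative_def)
  have eq: "g t = (\<Sum>\<^sub>\<infinity>i. f i t)" if "t \<in> S" for t
    using g(1)[OF that] infsum_eq_suminf[OF inf s[OF that]] sums_unique2 unfolding e_def by blast
  have "(g has_vector_derivative (\<Sum>\<^sub>\<infinity>i. f' i t0)) (at t0)"
    using g(2)[OF S(3)] at_within_open[OF S(3,1)] by simp
  from has_vector_derivative_transform_within_open[OF this S(1,3) eq] show ?thesis .
qed

lemma partials_infsum:
  fixes F :: "'i :: countable \<Rightarrow> mfun"
  assumes inf: "infinite (UNIV :: 'i set)"
    and F: "loc_summable F" and Fx: "loc_summable Fx" and Fy: "loc_summable Fy"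
    and p: "\<And>i. partials (F i) (Fx i) (Fy i)"
  shows "partials (\<lambda>x y. \<Sum>\<^sub>\<infinity>i. F i x y) (\<lambda>x y. \<Sum>\<^sub>\<infinity>i. Fx i x y) (\<lambda>x y. \<Sum>\<^sub>\<infinity>i. Fy i x y)"
proof (rule partialsI)
  fix x y :: real
  obtain M where M: "M summable_on UNIV" "\<And>i u v. \<bar>u\<bar> \<le> \<bar>x\<bar> + 1 \<Longrightarrow> norm (Fx i u v) \<le> M i"
    using Fx unfolding loc_summable_def by metis
  show "((\<lambda>t. \<Sum>\<^sub>\<infinity>i. F i t y) has_vector_derivative (\<Sum>\<^sub>\<infinity>i. Fx i x y)) (at x)"
    by (rule infsum_has_vector_derivative[OF inf partials_x[OF p] M(1), of "{x-1<..<x+1}"])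
      (auto intro!: M(2) loc_summableD[OF F])
  obtain N where N: "N summable_on UNIV" "\<And>i u v. \<bar>u\<bar> \<le> \<bar>x\<bar> \<Longrightarrow> norm (Fy i u v) \<le> N i"
    using Fy unfolding loc_summable_def by metis
  show "((\<lambda>t. \<Sum>\<^sub>\<infinity>i. F i x t) has_vector_derivative (\<Sum>\<^sub>\<infinity>i. Fy i x y)) (at y)"
    by (rule infsum_has_vector_derivative[OF inf partials_y[OF p] N(1), of UNIV])
      (auto intro!: N(2) loc_summableD[OF F])
qed

subsection \<open>Norm estimates in the crossed products\<close>

lemma ee_add: "ee (s + t) = ee s * ee t"
  by (simp add: ee_def exp_add distrib_left)

lemma ee_of_int [simp]: "ee (of_int n) = 1"
  unfolding ee_def exp_eq_1 by (auto intro!: exI[of _ n])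

lemma ee_0 [simp]: "ee 0 = 1"
  by (simp add: ee_def)

lemma norm_ee [simp]: "norm (ee t) = 1"
  by (simp add: ee_def norm_exp_eq_Re)

lemma cnj_ee: "cnj (ee t) = ee (- t)"
  by (simp add: ee_def exp_cnj)

lemma ee_derivative: "((\<lambda>y. ee (a * (y - b))) has_vector_derivative 2 * of_real pi * \<i> * of_real a * ee (a * (y - b))) (at y)"
proof -
  have "((\<lambda>z. exp (2 * of_real pi * \<i> * (of_real a * (z - of_real b)))) has_field_derivative
      2 * of_real pi * \<i> * of_real a * ee (a * (y - b))) (at (of_real y))"
    by (auto intro!: derivative_eq_intros simp: ee_def)
  from has_vector_derivative_real_field[OF this] show ?thesis by (simp add: ee_def)
qed

lemma partials_ee:
  "partials (\<lambda>x y. ee (a * (y - b))) (\<lambda>x y. 0) (\<lambda>x y. 2 * of_real pi * \<i> * of_real a * ee (a * (y - b)))"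
  unfolding partials_def using ee_derivative by simp

lemma continuous2_ee: "continuous2 (\<lambda>x y. ee (a * (y - b)))"
  unfolding ee_def case_prod_unfold by (intro continuous_intros)

lemma ee_shift_int: "ee (of_int n * (y + 1 - b)) = ee (of_int n * (y - b))"
proof -
  have "of_int n * (y + 1 - b) = of_int n * (y - b) + of_int n" by (simp add: algebra_simps)
  then show ?thesis by (simp only: ee_add ee_of_int mult_1_right)
qed

text \<open>Schur's test. The majorant a (s - r) is split as a product of two square roots, one
  given to v and one to u, and the Cauchy-Schwarz inequality on S x S leaves row and column sums of
  a, all at most \<epsilon>.\<close>

lemma l2_norm_leI:
  assumes A: "\<And>r s. norm (A r s) \<le> a (s - r)" and a: "\<And>T. finite T \<Longrightarrow> sum a T \<le> \<epsilon>"
  shows "l2_norm_le A \<epsilon>"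
  unfolding l2_norm_le_def
proof (intro allI impI)
  fix S :: "int set" and u v :: "int \<Rightarrow> complex" assume S: "finite S"
  have a0: "0 \<le> a d" for d using order.trans[OF norm_ge_zero A[of 0 d]] by simp
  have e0: "0 \<le> \<epsilon>" using a[of "{}"] by simp
  \<comment> \<open>The flag b decides whether w is read at the row or at the column index, so one
    estimate serves both factors.\<close>
  have L2: "L2_set (\<lambda>(r, s). sqrt (a (s - r)) * norm (w (if b then r else s))) (S \<times> S)
      \<le> sqrt \<epsilon> * L2_set (\<lambda>r. norm (w r)) S" for w :: "int \<Rightarrow> complex" and b
  proof -
    have row: "(\<Sum>s\<in>S. a (s - r)) \<le> \<epsilon>" "(\<Sum>s\<in>S. a (r - s)) \<le> \<epsilon>" for r
      using a[of "(\<lambda>s. s - r) ` S"] a[of "(\<lambda>s. r - s) ` S"] S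
      by (simp_all add: sum.reindex inj_on_def o_def)
    have "(\<Sum>(r, s)\<in>S \<times> S. (sqrt (a (s - r)) * norm (w (if b then r else s)))\<^sup>2) =
        (\<Sum>r\<in>S. \<Sum>s\<in>S. a (s - r) * (norm (w (if b then r else s)))\<^sup>2)"
      by (simp add: sum.cartesian_product power_mult_distrib a0)
    also have "\<dots> = (\<Sum>r\<in>S. (norm (w r))\<^sup>2 * (\<Sum>s\<in>S. a (if b then s - r else r - s)))"
    proof (cases b)
      case True then show ?thesis by (simp add: sum_distrib_left sum_distrib_right mult.commute)
    next
      case False
      then show ?thesis by (simp, subst sum.swap) (simp add: sum_distrib_left sum_distrib_right mult.commute)
    qed
    also have "\<dots> \<le> (\<Sum>r\<in>S. (norm (w r))\<^sup>2 * \<epsilon>)"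
      using row by (intro sum_mono mult_left_mono) (cases b; auto)+
    also have "\<dots> = \<epsilon> * (\<Sum>r\<in>S. (norm (w r))\<^sup>2)" by (simp add: sum_distrib_left mult.commute)
    finally show ?thesis
      unfolding L2_set_def by (simp add: case_prod_unfold flip: real_sqrt_mult)
  qed
  have "norm (\<Sum>r\<in>S. \<Sum>s\<in>S. cnj (v r) * A r s * u s) \<le> (\<Sum>r\<in>S. \<Sum>s\<in>S. norm (cnj (v r) * A r s * u s))"
    by (intro order.trans[OF norm_sum] sum_mono norm_sum)
  also have "\<dots> \<le> (\<Sum>r\<in>S. \<Sum>s\<in>S. \<bar>sqrt (a (s - r)) * norm (v r)\<bar> * \<bar>sqrt (a (s - r)) * norm (u s)\<bar>)"
  proof (intro sum_mono)
    fix r s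
    have "\<bar>sqrt (a (s - r)) * norm (v r)\<bar> * \<bar>sqrt (a (s - r)) * norm (u s)\<bar> = norm (v r) * a (s - r) * norm (u s)"
      using a0[of "s - r"] by (simp add: algebra_simps)
    then show "norm (cnj (v r) * A r s * u s) \<le> \<bar>sqrt (a (s - r)) * norm (v r)\<bar> * \<bar>sqrt (a (s - r)) * norm (u s)\<bar>"
      using A[of r s] by (simp add: norm_mult mult_left_mono mult_right_mono)
  qed
  also have "\<dots> = (\<Sum>z\<in>S \<times> S. \<bar>(\<lambda>(r, s). sqrt (a (s - r)) * norm (v r)) z\<bar> * \<bar>(\<lambda>(r, s). sqrt (a (s - r)) * norm (u s)) z\<bar>)"
    by (simp add: sum.cartesian_product case_prod_unfold)
  also have "\<dots> \<le> L2_set (\<lambda>(r, s). sqrt (a (s - r)) * norm (v r)) (S \<times> S) * L2_set (\<lambda>(r, s). sqrt (a (s - r)) * norm (u s)) (S \<times> S)"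
    by (rule L2_set_mult_ineq)
  also have "\<dots> \<le> (sqrt \<epsilon> * L2_set (\<lambda>r. norm (v r)) S) * (sqrt \<epsilon> * L2_set (\<lambda>s. norm (u s)) S)"
    using L2[of v True] L2[of u False] e0 by (intro mult_mono) (simp_all add: L2_set_nonneg)
  also have "\<dots> = (sqrt \<epsilon> * sqrt \<epsilon>) * L2_set (\<lambda>s. norm (u s)) S * L2_set (\<lambda>r. norm (v r)) S"
    by (simp only: mult_ac)
  finally show "norm (\<Sum>r\<in>S. \<Sum>s\<in>S. cnj (v r) * A r s * u s) \<le> \<epsilon> * L2_set (\<lambda>s. norm (u s)) S * L2_set (\<lambda>r. norm (v r)) S"
    using e0 by simp
qed

text \<open>Testing on unit vectors. This turns closeness in the operator norm into uniform
  closeness of coefficients.\<close>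

lemma l2_norm_le_entry:
  assumes "l2_norm_le A C" shows "norm (A r s) \<le> C"
proof -
  define u v where "u = (\<lambda>i. if i = s then 1 else 0 :: complex)" and "v = (\<lambda>i. if i = r then 1 else 0 :: complex)"
  have "(\<Sum>i\<in>{r, s}. \<Sum>j\<in>{r, s}. cnj (v i) * A i j * u j) = A r s"
    by (cases "r = s") (auto simp: u_def v_def)
  moreover have "L2_set (\<lambda>i. norm (u i)) {r, s} = 1" "L2_set (\<lambda>i. norm (v i)) {r, s} = 1"
    by (cases "r = s"; simp add: u_def v_def L2_set_def)+
  ultimately show ?thesis
    using assms[unfolded l2_norm_le_def, rule_format, of "{r, s}" v u] by simp
qed

text \<open>The decay in p makes the coefficients absolutely summable, uniformly over M, which by
  Schur's test suffices for approximation by finitely supported functions.\<close>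

definition rapid :: "mzfun \<Rightarrow> bool"
  where "rapid \<Phi> \<longleftrightarrow> (\<forall>p. continuous2 (\<lambda>x y. \<Phi> x y p)) \<and> (\<forall>x y p. \<Phi> x (y + 1) p = \<Phi> x y p) \<and>
    (\<exists>C. \<forall>x y p. norm (\<Phi> x y p) \<le> C / wt (of_int p))"

definition truncate :: "int set \<Rightarrow> mzfun \<Rightarrow> mzfun"
  where "truncate T \<Phi> = (\<lambda>x y p. if p \<in> T then \<Phi> x y p else 0)"

lemma rapid_truncate:
  assumes "rapid \<Phi>" "finite T" shows "bounded_cont_fin_supp (truncate T \<Phi>)"
proof -
  obtain C where C: "\<And>x y p. norm (\<Phi> x y p) \<le> C / wt (of_int p)" using assms(1) by (auto simp: rapid_def)
  have "norm (truncate T \<Phi> x y p) \<le> C" for x y p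
  proof -
    have "0 \<le> C / wt (of_int p)" by (rule order.trans[OF norm_ge_zero C])
    then have "0 \<le> C" using wt_pos[of "of_int p"] by (simp add: zero_le_divide_iff)
    then have "C / wt (of_int p) \<le> C" using wt_ge1[of "of_int p"] wt_pos[of "of_int p"]
      by (simp add: divide_le_eq mult_le_cancel_left1)
    then show ?thesis using C[of x y p] \<open>0 \<le> C\<close> by (auto simp: truncate_def)
  qed
  moreover have "continuous_on UNIV (\<lambda>(x, y). truncate T \<Phi> x y p)" for p
    using assms(1) by (cases "p \<in> T") (simp_all add: rapid_def truncate_def case_prod_unfold)
  moreover have "finite {p. \<exists>x y. truncate T \<Phi> x y p \<noteq> 0}"
    by (rule finite_subset[OF _ assms(2)]) (auto simp: truncate_def)
  ultimately show ?thesis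
    using assms(1) unfolding bounded_cont_fin_supp_def rapid_def
    by (intro conjI exI[of _ C] allI) (simp_all add: truncate_def)
qed

text \<open>The tail outside a large finite T has small sum. The points x, y may vary with r and s,
  so the same T serves the orbit matrices of both crossed products at every point of M.\<close>

lemma rapid_approx:
  assumes "rapid \<Phi>" "\<epsilon> > 0"
  obtains T where "finite T"
    "\<And>A. (\<And>r s. \<exists>x y. A r s = \<Phi> x y (s - r) - truncate T \<Phi> x y (s - r)) \<Longrightarrow> l2_norm_le A \<epsilon>"
proof -
  obtain C where C: "\<And>x y p. norm (\<Phi> x y p) \<le> C / wt (of_int p)" using assms(1) by (auto simp: rapid_def)
  have "0 \<le> C / wt (of_int p)" for p :: int by (rule order.trans[OF norm_ge_zero C])
  then have C0: "0 \<le> C" using wt_pos[of 0] by (metis divide_neg_pos linorder_not_less of_int_0)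
  define b where "b p = C / wt (of_int p)" for p :: int
  have b: "b summable_on UNIV"
    using summable_on_cmult_right[OF summable_inverse_wt, of C] by (simp add: b_def[abs_def])
  have b0: "0 \<le> b p" for p using C0 wt_pos[of "of_int p"] by (simp add: b_def)
  obtain T where T: "finite T" "dist (sum b T) (infsum b UNIV) \<le> \<epsilon>"
    using infsum_finite_approximation[OF b assms(2)] by blast
  have "l2_norm_le A \<epsilon>" if A: "\<And>r s. \<exists>x y. A r s = \<Phi> x y (s - r) - truncate T \<Phi> x y (s - r)" for A
  proof (rule l2_norm_leI)
    fix r s
    obtain x y where "A r s = \<Phi> x y (s - r) - truncate T \<Phi> x y (s - r)" using A by blast
    then show "norm (A r s) \<le> (\<lambda>p. if p \<in> T then 0 else b p) (s - r)"
      using C[of x y "s - r"] by (auto simp: truncate_def b_def)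
  next
    fix U :: "int set" assume "finite U"
    have "sum (\<lambda>p. if p \<in> T then 0 else b p) U = sum b (U - T)"
      using \<open>finite U\<close> by (simp add: sum.If_cases Diff_eq)
    moreover have "sum b (U - T) + sum b T = sum b (U \<union> T)"
      using \<open>finite U\<close> T(1) by (subst sum.union_disjoint[symmetric]) (auto simp: Un_commute)
    moreover have "sum b (U \<union> T) \<le> infsum b UNIV"
      using \<open>finite U\<close> T(1) b b0 by (intro finite_sum_le_infsum) auto
    ultimately show "sum (\<lambda>p. if p \<in> T then 0 else b p) U \<le> \<epsilon>"
      using T(2) by (simp add: dist_real_def)
  qed
  then show ?thesis using that T(1) by blast
qed

lemma rapid_add:
  assumes "rapid \<Phi>" "rapid \<Psi>" shows "rapid (\<lambda>x y p. \<Phi> x y p + \<Psi> x y p)"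
proof -
  obtain A where A: "\<And>x y p. norm (\<Phi> x y p) \<le> A / wt (of_int p)" using assms(1) by (auto simp: rapid_def)
  obtain B where B: "\<And>x y p. norm (\<Psi> x y p) \<le> B / wt (of_int p)" using assms(2) by (auto simp: rapid_def)
  have "norm (\<Phi> x y p + \<Psi> x y p) \<le> (A + B) / wt (of_int p)" for x y p
    using norm_add_rule_thm[OF A B] by (simp add: add_divide_distrib)
  then show ?thesis using assms unfolding rapid_def
    by (auto simp: case_prod_unfold intro!: continuous_on_add)
qed

lemma rapid_zero: "rapid (\<lambda>x y p. 0)"
  by (auto simp: rapid_def case_prod_unfold intro!: exI[of _ 0])

lemma rapid_sum: "(\<And>i. i \<in> I \<Longrightarrow> rapid (F i)) \<Longrightarrow> rapid (\<lambda>x y p. \<Sum>i\<in>I. F i x y p)"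
  by (induction I rule: infinite_finite_induct) (simp_all add: rapid_zero rapid_add)

text \<open>The sum over the lattice of step h is periodic in x; shifting the index by the floor of
  x / h replaces x / h by its fractional part. In the constant \<open>4 * \<kappa>\<close> one
  factor 2 comes from \<open>wt_diff\<close>, the other from the weight of a number in [0, 1], and
  \<kappa> from rescaling by h.\<close>

lemma wt_sum_bound:
  assumes "h \<noteq> 0"
  obtains S where "0 \<le> S" "\<And>x. (\<lambda>k::int. 1 / wt (x + of_int k * h)) summable_on UNIV"
    "\<And>x. (\<Sum>\<^sub>\<infinity>k::int. 1 / wt (x + of_int k * h)) \<le> S"
proof -
  obtain \<kappa> where \<kappa>: "\<kappa> \<ge> 1" "\<And>x. wt x \<le> \<kappa> * wt (h * x)" using wt_scale[OF assms] by blast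
  define S0 where "S0 = (\<Sum>\<^sub>\<infinity>k::int. 4 * \<kappa> * (1 / wt (of_int k)))"
  have sm: "(\<lambda>k::int. 4 * \<kappa> * (1 / wt (of_int k))) summable_on UNIV"
    by (rule summable_on_cmult_right[OF summable_inverse_wt])
  have bound: "1 / wt (x + of_int (k - \<lfloor>x / h\<rfloor>) * h) \<le> 4 * \<kappa> * (1 / wt (of_int k))" for x and k :: int
  proof -
    have "x + of_int (k - \<lfloor>x / h\<rfloor>) * h = h * (frac (x / h) + of_int k)"
      using assms by (simp add: frac_def field_simps)
    then have 1: "wt (frac (x / h) + of_int k) \<le> \<kappa> * wt (x + of_int (k - \<lfloor>x / h\<rfloor>) * h)"
      using \<kappa>(2) by simp
    have "wt (of_int k) \<le> 2 * wt (frac (x / h) + of_int k) * wt (frac (x / h))"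
      using wt_diff[of "frac (x / h) + of_int k" "frac (x / h)"] by simp
    also have "\<dots> \<le> 2 * wt (frac (x / h) + of_int k) * 2"
      using wt_pos[of "frac (x / h) + of_int k"] frac_ge_0[of "x/h"] frac_lt_1[of "x/h"]
      by (intro mult_left_mono) (auto simp: wt_def power_le_one less_imp_le)
    also have "\<dots> \<le> 4 * (\<kappa> * wt (x + of_int (k - \<lfloor>x / h\<rfloor>) * h))" using 1 by simp
    finally show ?thesis using wt_pos[of "of_int k"] wt_pos[of "x + of_int (k - \<lfloor>x / h\<rfloor>) * h"]
      by (simp add: field_simps)
  qed
  have bij: "bij (\<lambda>k. k - \<lfloor>x / h\<rfloor>)" for x
    by (rule o_bij[of "\<lambda>k. k + \<lfloor>x / h\<rfloor>"]) (auto simp: o_def)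
  have sx': "(\<lambda>k::int. 1 / wt (x + of_int (k - \<lfloor>x / h\<rfloor>) * h)) summable_on UNIV" for x
    by (rule summable_on_comparison_test[OF sm]) (use bound wt_pos in \<open>auto simp: less_imp_le\<close>)
  have sx: "(\<lambda>k::int. 1 / wt (x + of_int k * h)) summable_on UNIV" for x
    using sx'[of x] summable_on_reindex_bij_betw[OF bij, of "\<lambda>k. 1 / wt (x + of_int k * h)"] by simp
  have "(\<Sum>\<^sub>\<infinity>k::int. 1 / wt (x + of_int k * h)) \<le> S0" for x
  proof -
    have "(\<Sum>\<^sub>\<infinity>k::int. 1 / wt (x + of_int k * h)) = (\<Sum>\<^sub>\<infinity>k::int. 1 / wt (x + of_int (k - \<lfloor>x / h\<rfloor>) * h))"
      using infsum_reindex_bij_betw[OF bij, of "\<lambda>k. 1 / wt (x + of_int k * h)"] by simp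
    also have "\<dots> \<le> S0" unfolding S0_def by (rule infsum_mono[OF sx' sm bound])
    finally show ?thesis .
  qed
  moreover have "0 \<le> S0" unfolding S0_def
    using \<kappa>(1) wt_pos by (intro infsum_nonneg) (auto simp: less_imp_le)
  ultimately show ?thesis using that sx by blast
qed

lemmas wt_simps [simp] = wt_pos wt_pos[THEN less_imp_le] wt_pos[THEN less_imp_neq, THEN not_sym]

subsection \<open>Inner products\<close>

definition xmul :: "mfun \<Rightarrow> mfun"
  where "xmul f = (\<lambda>x y. of_real x * f x y)"

lemma Xi_xmul: "f \<in> Xi \<Longrightarrow> xmul f \<in> Xi"
  unfolding xmul_def by (rule Xi_x)

text \<open>Both factors are taken with decay of order 3: two orders pass through
  \<open>wt_diff\<close> to the difference u - v, and one order in u is kept for summing over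
  translates.\<close>

lemma Xi_product_decay:
  assumes "f \<in> Xi" "g \<in> Xi"
  obtains C where "0 \<le> C" "\<And>u v y z. norm (f u y) * norm (g v z) \<le> C / (wt (u - v) ^ 2 * wt u)"
proof -
  obtain A where A: "0 \<le> A" "\<And>x y. norm (f x y) \<le> A / wt x ^ 3" using Xi_decay[OF assms(1)] by blast
  obtain B where B: "0 \<le> B" "\<And>x y. norm (g x y) \<le> B / wt x ^ 3" using Xi_decay[OF assms(2)] by blast
  have "norm (f u y) * norm (g v z) \<le> (4 * A * B) / (wt (u - v) ^ 2 * wt u)" for u v y z
  proof -
    have "norm (f u y) * norm (g v z) \<le> (A / wt u ^ 3) * (B / wt v ^ 3)"
      using A B wt_pos[of u] by (intro mult_mono) auto
    also have "\<dots> = (4 * A * B) / (4 * wt u ^ 3 * wt v ^ 3)" by simp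
    also have "\<dots> \<le> (4 * A * B) / (wt (u - v) ^ 2 * wt u)"
    proof (rule divide_left_mono)
      have "wt (u - v) ^ 2 * wt u \<le> (2 * wt u * wt v) ^ 2 * wt u"
        using wt_pos[of u] wt_pos[of "u - v"] by (intro mult_right_mono power_mono wt_diff) auto
      also have "\<dots> = 4 * wt u ^ 3 * wt v ^ 2" by (simp add: power2_eq_square power3_eq_cube)
      also have "\<dots> \<le> 4 * wt u ^ 3 * wt v ^ 3"
        using wt_pos[of u] by (intro mult_left_mono wt_power_mono) auto
      finally show "wt (u - v) ^ 2 * wt u \<le> 4 * wt u ^ 3 * wt v ^ 3" .
    qed (use A B in \<open>simp_all add: zero_less_mult_iff\<close>)
    finally show ?thesis .
  qed
  then show ?thesis using that[of "4 * A * B"] A B by simp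
qed

lemma loc_summable_wt:
  fixes F :: "int \<Rightarrow> mfun"
  assumes "h \<noteq> 0" "\<And>k x y. norm (F k x y) \<le> C / wt (x + of_int k * h)"
  shows "loc_summable F"
  unfolding loc_summable_def
proof
  fix r
  obtain \<kappa> where \<kappa>: "\<kappa> \<ge> 1" "\<And>x. wt x \<le> \<kappa> * wt (h * x)" using wt_scale[OF assms(1)] by blast
  have "0 \<le> C / wt (0 + of_int 0 * h)" by (rule order.trans[OF norm_ge_zero assms(2)])
  then have C0: "0 \<le> C" by (simp add: wt_def)
  have "norm (F k x y) \<le> (C * (2 * \<kappa> * wt r)) * (1 / wt (of_int k))" if x: "\<bar>x\<bar> \<le> r" for k x y
  proof -
    have "wt x \<le> wt r" using x by (simp add: wt_def abs_le_square_iff[symmetric])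
    have "wt (of_int k) \<le> \<kappa> * wt (of_int k * h)" using \<kappa>(2)[of "of_int k"] by (simp add: mult.commute)
    also have "\<dots> \<le> \<kappa> * (2 * wt (x + of_int k * h) * wt x)"
      using wt_diff[of "x + of_int k * h" x] \<kappa>(1) by simp
    also have "\<dots> \<le> \<kappa> * (2 * wt (x + of_int k * h) * wt r)"
      using \<open>wt x \<le> wt r\<close> \<kappa>(1) wt_pos[of "x + of_int k * h"] by simp
    finally have "C * wt (of_int k) \<le> C * (2 * \<kappa> * wt r * wt (x + of_int k * h))"
      using C0 by (intro mult_left_mono) (simp_all add: mult_ac)
    then have "C / wt (x + of_int k * h) \<le> (C * (2 * \<kappa> * wt r)) * (1 / wt (of_int k))"
      using wt_pos[of "x + of_int k * h"] wt_pos[of "of_int k"] by (simp add: field_simps)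
    then show ?thesis using assms(2) order.trans by blast
  qed
  then show "\<exists>M. M summable_on UNIV \<and> (\<forall>i x y. \<bar>x\<bar> \<le> r \<longrightarrow> norm (F i x y) \<le> M i)"
    using summable_on_cmult_right[OF summable_inverse_wt, of "C * (2 * \<kappa> * wt r)"] by blast
qed

text \<open>The point is that S depends on h only, so the resulting bounds on inner products are
  uniform on M.\<close>

lemma infsum_wt_bound:
  assumes "h \<noteq> 0"
  obtains S where "0 \<le> S"
    "\<And>(F :: int \<Rightarrow> complex) C x. (\<And>k. norm (F k) \<le> C / wt (x + of_int k * h)) \<Longrightarrow> norm (\<Sum>\<^sub>\<infinity>k. F k) \<le> C * S"
proof -
  obtain S where S: "0 \<le> S" "\<And>x. (\<lambda>k::int. 1 / wt (x + of_int k * h)) summable_on UNIV"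
    "\<And>x. (\<Sum>\<^sub>\<infinity>k::int. 1 / wt (x + of_int k * h)) \<le> S"
    using wt_sum_bound[OF assms] by blast
  have "norm (\<Sum>\<^sub>\<infinity>k. F k) \<le> C * S" if F: "\<And>k. norm (F k) \<le> C / wt (x + of_int k * h)" for F :: "int \<Rightarrow> complex" and C x
  proof -
    have "0 \<le> C / wt (x + of_int 0 * h)" by (rule order.trans[OF norm_ge_zero F])
    then have C0: "0 \<le> C" using wt_pos[of x] by (simp add: zero_le_divide_iff)
    have sC: "(\<lambda>k::int. C * (1 / wt (x + of_int k * h))) summable_on UNIV"
      by (rule summable_on_cmult_right[OF S(2)])
    have "norm (\<Sum>\<^sub>\<infinity>k. F k) \<le> (\<Sum>\<^sub>\<infinity>k. C * (1 / wt (x + of_int k * h)))"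
      by (rule norm_infsum_le[OF has_sum_infsum has_sum_infsum[OF sC]])
        (use F in \<open>auto intro!: summable_on_bound[OF sC]\<close>)
    also have "\<dots> = C * (\<Sum>\<^sub>\<infinity>k. 1 / wt (x + of_int k * h))" by (rule infsum_cmult_right) (rule S(2))
    also have "\<dots> \<le> C * S" by (rule mult_left_mono[OF S(3) C0])
    finally show ?thesis .
  qed
  then show ?thesis using that S(1) by blast
qed

lemma infsum_shift_int: "(\<Sum>\<^sub>\<infinity>k::int. F (k + j)) = (\<Sum>\<^sub>\<infinity>k. F k)"
  by (rule infsum_reindex_bij_betw[of "\<lambda>k. k + j" UNIV UNIV])
    (rule o_bij[of "\<lambda>k. k - j"]; auto simp: o_def)

locale heisenberg =
  fixes c :: int and \<mu> \<nu> :: real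
  assumes mu: "\<mu> \<noteq> 0"
begin

abbreviation R where "R \<equiv> inner_R c \<mu> \<nu>"
abbreviation L where "L \<equiv> inner_L c \<mu> \<nu>"
abbreviation ra where "ra \<equiv> ract \<mu> \<nu>"

definition R_term :: "mfun \<Rightarrow> mfun \<Rightarrow> int \<Rightarrow> int \<Rightarrow> mfun"
  where "R_term f g p k = (\<lambda>x y. cnj (ee (of_int (c * k * p) * (y - of_int p * \<nu>))) * f (x + of_int k) y *
    cnj (g (x - 2 * of_int p * \<mu> + of_int k) (y - 2 * of_int p * \<nu>)))"

definition L_term :: "mfun \<Rightarrow> mfun \<Rightarrow> int \<Rightarrow> int \<Rightarrow> mfun"
  where "L_term f g p k = (\<lambda>x y. ee (of_int (c * p * k) * (y - of_int k * \<nu>)) *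
    cnj (f (x - 2 * of_int k * \<mu>) (y - 2 * of_int k * \<nu>)) *
    g (x - 2 * of_int k * \<mu> + of_int p) (y - 2 * of_int k * \<nu>))"

lemma inner_R_eq_sum: "R f g x y p = (\<Sum>\<^sub>\<infinity>k. R_term f g p k x y)"
  by (simp add: inner_R_def R_term_def)

lemma inner_L_eq_sum: "L f g x y p = (\<Sum>\<^sub>\<infinity>k. L_term f g p k x y)"
  by (simp add: inner_L_def L_term_def)

text \<open>The two first arguments differ by \<open>2 * of_int p * \<mu>\<close> for every k, which
  yields the decay in p (here \<mu> is nonzero); the remaining weight is summed over k. For
  \<open>L_term\<close> the difference is p itself and the sum runs in steps of -2 \<mu>.\<close>

lemma R_term_bound:
  assumes "f \<in> Xi" "g \<in> Xi"
  obtains C where "0 \<le> C" "\<And>p k x y. norm (R_term f g p k x y) \<le> (C / wt (of_int p) ^ 2) / wt (x + of_int k * 1)"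
proof -
  obtain C where C: "0 \<le> C" "\<And>u v y z. norm (f u y) * norm (g v z) \<le> C / (wt (u - v) ^ 2 * wt u)"
    using Xi_product_decay[OF assms] by blast
  obtain \<kappa> where \<kappa>: "\<kappa> \<ge> 1" "\<And>x. wt x \<le> \<kappa> * wt ((2 * \<mu>) * x)" using wt_scale[of "2 * \<mu>"] mu by auto
  have "norm (R_term f g p k x y) \<le> (C * \<kappa> ^ 2 / wt (of_int p) ^ 2) / wt (x + of_int k * 1)" for p k x y
  proof -
    have "norm (R_term f g p k x y) = norm (f (x + of_int k) y) *
        norm (g (x - 2 * of_int p * \<mu> + of_int k) (y - 2 * of_int p * \<nu>))"
      by (simp add: R_term_def norm_mult)
    also have "\<dots> \<le> C / (wt (x + of_int k - (x - 2 * of_int p * \<mu> + of_int k)) ^ 2 * wt (x + of_int k))" by (rule C(2))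
    also have "x + of_int k - (x - 2 * of_int p * \<mu> + of_int k) = 2 * \<mu> * of_int p" by simp
    also have "C / (wt (2 * \<mu> * of_int p) ^ 2 * wt (x + of_int k)) =
        C * \<kappa> ^ 2 / ((\<kappa> * wt (2 * \<mu> * of_int p)) ^ 2 * wt (x + of_int k))"
      using \<kappa>(1) by (simp add: power_mult_distrib)
    also have "\<dots> \<le> C * \<kappa> ^ 2 / (wt (of_int p) ^ 2 * wt (x + of_int k))"
      using C(1) wt_pos \<kappa> by (intro divide_left_mono mult_right_mono power_mono mult_pos_pos zero_less_power)
        (auto simp: less_imp_le intro!: mult_pos_pos intro: less_le_trans[OF zero_less_one])
    finally show ?thesis by simp
  qed
  then show ?thesis using that[of "C * \<kappa> ^ 2"] C(1) by simp
qed

lemma L_term_bound: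
  assumes "f \<in> Xi" "g \<in> Xi"
  obtains C where "0 \<le> C" "\<And>p k x y. norm (L_term f g p k x y) \<le> (C / wt (of_int p) ^ 2) / wt (x + of_int k * (- 2 * \<mu>))"
proof -
  obtain C where C: "0 \<le> C" "\<And>u v y z. norm (f u y) * norm (g v z) \<le> C / (wt (u - v) ^ 2 * wt u)"
    using Xi_product_decay[OF assms] by blast
  have "norm (L_term f g p k x y) \<le> (C / wt (of_int p) ^ 2) / wt (x + of_int k * (- 2 * \<mu>))" for p k x y
  proof -
    have "norm (L_term f g p k x y) = norm (f (x - 2 * of_int k * \<mu>) (y - 2 * of_int k * \<nu>)) *
        norm (g (x - 2 * of_int k * \<mu> + of_int p) (y - 2 * of_int k * \<nu>))"
      by (simp add: L_term_def norm_mult)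
    also have "\<dots> \<le> C / (wt (x - 2 * of_int k * \<mu> - (x - 2 * of_int k * \<mu> + of_int p)) ^ 2 * wt (x - 2 * of_int k * \<mu>))" by (rule C(2))
    finally show ?thesis by (simp add: mult_ac)
  qed
  then show ?thesis using that[of C] C(1) by blast
qed

lemma two_mu: "- 2 * \<mu> \<noteq> 0" using mu by simp

lemma R_term_loc_summable:
  assumes "f \<in> Xi" "g \<in> Xi" shows "loc_summable (R_term f g p)"
proof -
  obtain C where "0 \<le> C" and C: "\<And>p k x y. norm (R_term f g p k x y) \<le> (C / wt (of_int p) ^ 2) / wt (x + of_int k * 1)"
    using R_term_bound[OF assms] by blast
  show ?thesis by (rule loc_summable_wt[OF _ C]) simp
qed

lemma L_term_loc_summable:
  assumes "f \<in> Xi" "g \<in> Xi" shows "loc_summable (L_term f g p)"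
proof -
  obtain C where "0 \<le> C" and C: "\<And>p k x y. norm (L_term f g p k x y) \<le> (C / wt (of_int p) ^ 2) / wt (x + of_int k * (- 2 * \<mu>))"
    using L_term_bound[OF assms] by blast
  show ?thesis by (rule loc_summable_wt[OF _ C]) (rule two_mu)
qed

lemma inner_R_decay:
  assumes "f \<in> Xi" "g \<in> Xi"
  obtains C where "0 \<le> C" "\<And>p x y. norm (R f g x y p) \<le> C / wt (of_int p) ^ 2"
proof -
  obtain C where C: "0 \<le> C" "\<And>p k x y. norm (R_term f g p k x y) \<le> (C / wt (of_int p) ^ 2) / wt (x + of_int k * 1)"
    using R_term_bound[OF assms] by blast
  obtain S where S: "0 \<le> S" "\<And>(F :: int \<Rightarrow> complex) C x. (\<And>k. norm (F k) \<le> C / wt (x + of_int k * 1)) \<Longrightarrow> norm (\<Sum>\<^sub>\<infinity>k. F k) \<le> C * S"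
    using infsum_wt_bound[of 1] by auto
  have "norm (R f g x y p) \<le> (C * S) / wt (of_int p) ^ 2" for p x y
    unfolding inner_R_eq_sum using S(2)[OF C(2)[of p _ x y]] by simp
  then show ?thesis using that[of "C * S"] C S by simp
qed

lemma inner_L_decay:
  assumes "f \<in> Xi" "g \<in> Xi"
  obtains C where "0 \<le> C" "\<And>p x y. norm (L f g x y p) \<le> C / wt (of_int p) ^ 2"
proof -
  obtain C where C: "0 \<le> C" "\<And>p k x y. norm (L_term f g p k x y) \<le> (C / wt (of_int p) ^ 2) / wt (x + of_int k * (- 2 * \<mu>))"
    using L_term_bound[OF assms] by blast
  obtain S where S: "0 \<le> S" "\<And>(F :: int \<Rightarrow> complex) C x. (\<And>k. norm (F k) \<le> C / wt (x + of_int k * (- 2 * \<mu>))) \<Longrightarrow> norm (\<Sum>\<^sub>\<infinity>k. F k) \<le> C * S"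
    using infsum_wt_bound[OF two_mu] by blast
  have "norm (L f g x y p) \<le> (C * S) / wt (of_int p) ^ 2" for p x y
    unfolding inner_L_eq_sum using S(2)[OF C(2)[of p _ x y]] by simp
  then show ?thesis using that[of "C * S"] C S by simp
qed

lemma divide_wt_square_le: "0 \<le> C \<Longrightarrow> C / wt x ^ 2 \<le> C / wt x"
  using wt_power_mono[of 1 2 x] wt_pos[of x] by (intro divide_left_mono) auto

lemma R_term_alt: "R_term f g p k = (\<lambda>x y. ee (of_int (- (c * k * p)) * (y - of_int p * \<nu>)) * f (x + of_int k) (y + 0) *
    cnj (g (x + (of_int k - 2 * of_int p * \<mu>)) (y + (- 2 * of_int p * \<nu>))))"
  by (simp add: R_term_def cnj_ee add_diff_eq diff_add_eq)

lemma L_term_alt: "L_term f g p k = (\<lambda>x y. ee (of_int (c * p * k) * (y - of_int k * \<nu>)) *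
    cnj (f (x + (- 2 * of_int k * \<mu>)) (y + (- 2 * of_int k * \<nu>))) *
    g (x + (of_int p - 2 * of_int k * \<mu>)) (y + (- 2 * of_int k * \<nu>)))"
  by (simp add: L_term_def add_diff_eq diff_add_eq)

lemma R_term_continuous: "f \<in> Xi \<Longrightarrow> g \<in> Xi \<Longrightarrow> continuous2 (R_term f g p k)"
  unfolding R_term_alt
  by (intro continuous2_mult continuous2_cnj continuous2_ee continuous2_cong_shift Xi_continuous)

lemma L_term_continuous: "f \<in> Xi \<Longrightarrow> g \<in> Xi \<Longrightarrow> continuous2 (L_term f g p k)"
  unfolding L_term_alt
  by (intro continuous2_mult continuous2_cnj continuous2_ee continuous2_cong_shift Xi_continuous)

lemma Xi_periodic_diff: "f \<in> Xi \<Longrightarrow> f x (y + 1 - b) = f x (y - b)"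
  using Xi_periodic[of f x "y - b"] by (simp add: diff_add_eq)

lemma R_term_periodic: "f \<in> Xi \<Longrightarrow> g \<in> Xi \<Longrightarrow> R_term f g p k x (y + 1) = R_term f g p k x y"
  by (simp only: R_term_def ee_shift_int Xi_periodic Xi_periodic_diff)

lemma L_term_periodic: "f \<in> Xi \<Longrightarrow> g \<in> Xi \<Longrightarrow> L_term f g p k x (y + 1) = L_term f g p k x y"
  by (simp only: L_term_def ee_shift_int Xi_periodic_diff)

lemma inner_R_continuous: "f \<in> Xi \<Longrightarrow> g \<in> Xi \<Longrightarrow> continuous2 (\<lambda>x y. R f g x y p)"
  unfolding inner_R_eq_sum by (intro continuous2_infsum R_term_loc_summable R_term_continuous)

lemma inner_L_continuous: "f \<in> Xi \<Longrightarrow> g \<in> Xi \<Longrightarrow> continuous2 (\<lambda>x y. L f g x y p)"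
  unfolding inner_L_eq_sum by (intro continuous2_infsum L_term_loc_summable L_term_continuous)

lemma rapid_inner_R:
  assumes "f \<in> Xi" "g \<in> Xi" shows "rapid (R f g)"
proof -
  obtain C where C: "0 \<le> C" "\<And>p x y. norm (R f g x y p) \<le> C / wt (of_int p) ^ 2"
    using inner_R_decay[OF assms] by blast
  have "\<forall>x y p. norm (R f g x y p) \<le> C / wt (of_int p)"
    using order.trans[OF C(2) divide_wt_square_le[OF C(1)]] by blast
  moreover have "\<forall>x y p. R f g x (y + 1) p = R f g x y p"
    using assms by (simp add: inner_R_eq_sum R_term_periodic)
  ultimately show ?thesis using inner_R_continuous[OF assms] unfolding rapid_def by blast
qed

lemma rapid_inner_L:
  assumes "f \<in> Xi" "g \<in> Xi" shows "rapid (L f g)"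
proof -
  obtain C where C: "0 \<le> C" "\<And>p x y. norm (L f g x y p) \<le> C / wt (of_int p) ^ 2"
    using inner_L_decay[OF assms] by blast
  have "\<forall>x y p. norm (L f g x y p) \<le> C / wt (of_int p)"
    using order.trans[OF C(2) divide_wt_square_le[OF C(1)]] by blast
  moreover have "\<forall>x y p. L f g x (y + 1) p = L f g x y p"
    using assms by (simp add: inner_L_eq_sum L_term_periodic)
  ultimately show ?thesis using inner_L_continuous[OF assms] unfolding rapid_def by blast
qed

section \<open>Quasi-periodicity and membership in the C-star completions\<close>

definition D_invariant :: "mzfun \<Rightarrow> bool"
  where "D_invariant \<Phi> \<longleftrightarrow> (\<forall>k x y p. cnj (ee (of_int (c * k * p) * (y - of_int p * \<nu>))) * \<Phi> (x + of_int k) y p = \<Phi> x y p)"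

definition E_invariant :: "mzfun \<Rightarrow> bool"
  where "E_invariant \<Psi> \<longleftrightarrow> (\<forall>k x y p. ee (of_int (c * p * k) * (y - of_int k * \<nu>)) *
       \<Psi> (x - 2 * of_int k * \<mu>) (y - 2 * of_int k * \<nu>) p = \<Psi> x y p)"

lemma inner_R_invariant: "D_invariant (R f g)"
  unfolding D_invariant_def
proof (intro allI)
  fix k x y p
  have "cnj (ee (of_int (c * k * p) * (y - of_int p * \<nu>))) * R_term f g p j (x + of_int k) y = R_term f g p (j + k) x y" for j
  proof -
    have e: "cnj (ee (of_int (c * k * p) * (y - of_int p * \<nu>))) * cnj (ee (of_int (c * j * p) * (y - of_int p * \<nu>))) =
        cnj (ee (of_int (c * (j + k) * p) * (y - of_int p * \<nu>)))"
      unfolding complex_cnj_mult[symmetric] ee_add[symmetric]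
      by (rule arg_cong[of _ _ "\<lambda>t. cnj (ee t)"]) (simp add: algebra_simps)
    have x: "x + of_int k + of_int j = x + of_int (j + k)"
      "x + of_int k - 2 * of_int p * \<mu> + of_int j = x - 2 * of_int p * \<mu> + of_int (j + k)" by simp_all
    show ?thesis unfolding R_term_def x e[symmetric] by (simp only: mult.assoc)
  qed
  then have "cnj (ee (of_int (c * k * p) * (y - of_int p * \<nu>))) * R f g (x + of_int k) y p = (\<Sum>\<^sub>\<infinity>j. R_term f g p (j + k) x y)"
    unfolding inner_R_eq_sum by (simp flip: infsum_cmult_right')
  then show "cnj (ee (of_int (c * k * p) * (y - of_int p * \<nu>))) * R f g (x + of_int k) y p = R f g x y p"
    by (simp add: inner_R_eq_sum infsum_shift_int[of "\<lambda>j. R_term f g p j x y"])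
qed

text \<open>A shift of the summation index. The phases match because k (y - k \<nu>) + j (y - 2 k
  \<nu> - j \<nu>) = (j + k) (y - (j + k) \<nu>): the quadratic term in the phase is compensated by
  the translation of y.\<close>

lemma inner_L_invariant: "E_invariant (L f g)"
  unfolding E_invariant_def
proof (intro allI)
  fix k x y p
  have "ee (of_int (c * p * k) * (y - of_int k * \<nu>)) * L_term f g p j (x - 2 * of_int k * \<mu>) (y - 2 * of_int k * \<nu>) = L_term f g p (j + k) x y" for j
  proof -
    have e: "ee (of_int (c * p * k) * (y - of_int k * \<nu>)) * ee (of_int (c * p * j) * (y - 2 * of_int k * \<nu> - of_int j * \<nu>)) =
        ee (of_int (c * p * (j + k)) * (y - of_int (j + k) * \<nu>))"
      unfolding ee_add[symmetric] by (rule arg_cong[of _ _ ee]) (simp add: algebra_simps)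
    have x: "x - 2 * of_int k * \<mu> - 2 * of_int j * \<mu> = x - 2 * of_int (j + k) * \<mu>"
      "y - 2 * of_int k * \<nu> - 2 * of_int j * \<nu> = y - 2 * of_int (j + k) * \<nu>" by (simp_all add: algebra_simps)
    show ?thesis unfolding L_term_def x e[symmetric] by (simp only: mult.assoc)
  qed
  then have "ee (of_int (c * p * k) * (y - of_int k * \<nu>)) * L f g (x - 2 * of_int k * \<mu>) (y - 2 * of_int k * \<nu>) p = (\<Sum>\<^sub>\<infinity>j. L_term f g p (j + k) x y)"
    unfolding inner_L_eq_sum by (simp flip: infsum_cmult_right')
  then show "ee (of_int (c * p * k) * (y - of_int k * \<nu>)) * L f g (x - 2 * of_int k * \<mu>) (y - 2 * of_int k * \<nu>) p = L f g x y p"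
    by (simp add: inner_L_eq_sum infsum_shift_int[of "\<lambda>j. L_term f g p j x y"])
qed

lemma D_invariant_add: "D_invariant \<Phi> \<Longrightarrow> D_invariant \<Psi> \<Longrightarrow> D_invariant (\<lambda>x y p. \<Phi> x y p + \<Psi> x y p)"
  by (simp add: D_invariant_def distrib_left)

lemma E_invariant_sum: "(\<And>i. i \<in> I \<Longrightarrow> E_invariant (F i)) \<Longrightarrow> E_invariant (\<lambda>x y p. \<Sum>i\<in>I. F i x y p)"
  by (simp add: E_invariant_def sum_distrib_left)

lemma D_cstarI:
  assumes "rapid \<Phi>" "D_invariant \<Phi>" shows "\<Phi> \<in> D_cstar c \<mu> \<nu>"
  unfolding D_cstar_def
proof (intro CollectI allI impI)
  fix \<epsilon> :: real assume "\<epsilon> > 0"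
  then obtain T where T: "finite T"
    "\<And>A. (\<And>r s. \<exists>x y. A r s = \<Phi> x y (s - r) - truncate T \<Phi> x y (s - r)) \<Longrightarrow> l2_norm_le A \<epsilon>"
    using rapid_approx[OF assms(1)] by metis
  have "truncate T \<Phi> \<in> D0 c \<nu>"
    using rapid_truncate[OF assms(1) T(1)] assms(2)
    unfolding D0_def D_invariant_def by (simp add: truncate_def)
  moreover have "l2_norm_le (orbit_matrix_D \<mu> \<nu> (\<lambda>x y p. \<Phi> x y p - truncate T \<Phi> x y p) x y) \<epsilon>" for x y
    by (rule T(2)) (auto simp: orbit_matrix_D_def)
  ultimately show "\<exists>\<Phi>0\<in>D0 c \<nu>. \<forall>x y. l2_norm_le (orbit_matrix_D \<mu> \<nu> (\<lambda>x y p. \<Phi> x y p - \<Phi>0 x y p) x y) \<epsilon>"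
    by blast
qed

lemma E_cstarI:
  assumes "rapid \<Psi>" "E_invariant \<Psi>" shows "\<Psi> \<in> E_cstar c \<mu> \<nu>"
  unfolding E_cstar_def
proof (intro CollectI allI impI)
  fix \<epsilon> :: real assume "\<epsilon> > 0"
  then obtain T where T: "finite T"
    "\<And>A. (\<And>r s. \<exists>x y. A r s = \<Psi> x y (s - r) - truncate T \<Psi> x y (s - r)) \<Longrightarrow> l2_norm_le A \<epsilon>"
    using rapid_approx[OF assms(1)] by metis
  have "truncate T \<Psi> \<in> E0 c \<mu> \<nu>"
    using rapid_truncate[OF assms(1) T(1)] assms(2)
    unfolding E0_def E_invariant_def by (simp add: truncate_def)
  moreover have "l2_norm_le (orbit_matrix_E (\<lambda>x y p. \<Psi> x y p - truncate T \<Psi> x y p) x y) \<epsilon>" for x y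
    by (rule T(2)) (auto simp: orbit_matrix_E_def)
  ultimately show "\<exists>\<Psi>0\<in>E0 c \<mu> \<nu>. \<forall>x y. l2_norm_le (orbit_matrix_E (\<lambda>x y p. \<Psi> x y p - \<Psi>0 x y p) x y) \<epsilon>"
    by blast
qed

lemma D_cstar_bounded:
  assumes "\<Phi> \<in> D_cstar c \<mu> \<nu>" obtains B where "0 \<le> B" "\<And>x y p. norm (\<Phi> x y p) \<le> B"
proof -
  obtain \<Phi>0 where 0: "\<Phi>0 \<in> D0 c \<nu>" "\<And>x y. l2_norm_le (orbit_matrix_D \<mu> \<nu> (\<lambda>x y p. \<Phi> x y p - \<Phi>0 x y p) x y) 1"
    using assms zero_less_one[where 'a = real] unfolding D_cstar_def by blast
  obtain B where B: "\<And>x y p. norm (\<Phi>0 x y p) \<le> B" using 0(1) by (auto simp: D0_def bounded_cont_fin_supp_def)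
  have *: "norm (\<Phi> x y p) \<le> 1 + B" for x y p
    using l2_norm_le_entry[OF 0(2), of x y 0 p] B[of x y p] norm_triangle_sub[of "\<Phi> x y p" "\<Phi>0 x y p"]
    by (simp add: orbit_matrix_D_def)
  show ?thesis by (rule that[OF order.trans[OF norm_ge_zero *] *])
qed

lemma E_cstar_approx:
  assumes "\<Psi> \<in> E_cstar c \<mu> \<nu>" "\<epsilon> > 0"
  obtains \<Psi>0 where "\<Psi>0 \<in> E0 c \<mu> \<nu>" "\<And>x y p. norm (\<Psi> x y p - \<Psi>0 x y p) \<le> \<epsilon>"
proof -
  obtain \<Psi>0 where 0: "\<Psi>0 \<in> E0 c \<mu> \<nu>" "\<And>x y. l2_norm_le (orbit_matrix_E (\<lambda>x y p. \<Psi> x y p - \<Psi>0 x y p) x y) \<epsilon>"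
    using assms unfolding E_cstar_def by blast
  have "norm (\<Psi> x y p - \<Psi>0 x y p) \<le> \<epsilon>" for x y p
    using l2_norm_le_entry[OF 0(2), of x y 0 p] by (simp add: orbit_matrix_E_def)
  then show ?thesis using that 0(1) by blast
qed

lemma E_cstar_bounded:
  assumes "\<Psi> \<in> E_cstar c \<mu> \<nu>" obtains B where "0 \<le> B" "\<And>x y p. norm (\<Psi> x y p) \<le> B"
proof -
  obtain \<Psi>0 where 0: "\<Psi>0 \<in> E0 c \<mu> \<nu>" "\<And>x y p. norm (\<Psi> x y p - \<Psi>0 x y p) \<le> 1"
    using E_cstar_approx[OF assms zero_less_one] by blast
  obtain B where B: "\<And>x y p. norm (\<Psi>0 x y p) \<le> B" using 0(1) by (auto simp: E0_def bounded_cont_fin_supp_def)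
  have *: "norm (\<Psi> x y p) \<le> 1 + B" for x y p
    using 0(2)[of x y p] B[of x y p] norm_triangle_sub[of "\<Psi> x y p" "\<Psi>0 x y p"] by linarith
  show ?thesis by (rule that[OF order.trans[OF norm_ge_zero *] *])
qed

text \<open>The condition survives uniform limits of coefficients because its phase has modulus 1.
  It is the source of the phases that make the left action fit the inner products.\<close>

lemma E_cstar_invariant:
  assumes "\<Psi> \<in> E_cstar c \<mu> \<nu>" shows "E_invariant \<Psi>"
  unfolding E_invariant_def
proof (intro allI)
  fix k x y p
  define e where "e = ee (of_int (c * p * k) * (y - of_int k * \<nu>))"
  let ?x = "x - 2 * of_int k * \<mu>" and ?y = "y - 2 * of_int k * \<nu>"
  have "norm (e * \<Psi> ?x ?y p - \<Psi> x y p) \<le> \<epsilon>" if e: "\<epsilon> > 0" for \<epsilon>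
  proof -
    obtain \<Psi>0 where 0: "\<Psi>0 \<in> E0 c \<mu> \<nu>" "\<And>x y p. norm (\<Psi> x y p - \<Psi>0 x y p) \<le> \<epsilon> / 2"
      using E_cstar_approx[OF assms half_gt_zero[OF e]] by blast
    have "e * \<Psi>0 ?x ?y p = \<Psi>0 x y p" using 0(1) by (simp add: E0_def e_def)
    then have "e * \<Psi> ?x ?y p - \<Psi> x y p = e * (\<Psi> ?x ?y p - \<Psi>0 ?x ?y p) - (\<Psi> x y p - \<Psi>0 x y p)"
      by (simp add: algebra_simps)
    also have "norm \<dots> \<le> norm (e * (\<Psi> ?x ?y p - \<Psi>0 ?x ?y p)) + norm (\<Psi> x y p - \<Psi>0 x y p)"
      by (rule norm_triangle_ineq4)
    also have "\<dots> \<le> \<epsilon> / 2 + \<epsilon> / 2"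
      using 0(2)[of ?x ?y p] 0(2)[of x y p] unfolding norm_mult e_def norm_ee mult_1_left
      by (rule add_mono)
    finally show ?thesis by simp
  qed
  then have "norm (e * \<Psi> ?x ?y p - \<Psi> x y p) \<le> 0" by (rule field_le_epsilon) simp
  then show "e * \<Psi> ?x ?y p = \<Psi> x y p" by simp
qed

end

lemma summable_product_wt:
  assumes "\<And>k q. norm (F (k, q)) \<le> C / (wt (of_int k) * wt (of_int q))"
  shows "(F :: int \<times> int \<Rightarrow> complex) summable_on UNIV"
proof (rule summable_on_bound)
  show "(\<lambda>z. C * (case z of (k, q) \<Rightarrow> 1 / (wt (of_int k) * wt (of_int q)))) summable_on (UNIV :: (int \<times> int) set)"
    by (rule summable_on_cmult_right[OF summable_inverse_wt2])
qed (use assms in auto)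

lemma infsum_swap_wt:
  assumes "\<And>k q. norm (F k q) \<le> C / (wt (of_int k) * wt (of_int q))"
  shows "(\<Sum>\<^sub>\<infinity>k::int. \<Sum>\<^sub>\<infinity>q::int. F k q :: complex) = (\<Sum>\<^sub>\<infinity>q. \<Sum>\<^sub>\<infinity>k. F k q)"
  using summable_product_wt[of "\<lambda>(k, q). F k q" C] assms by (intro infsum_swap_banach) simp

lemma infsum_pair_wt:
  assumes "\<And>k q. norm (F (k, q)) \<le> C / (wt (of_int k) * wt (of_int q))"
  shows "(\<Sum>\<^sub>\<infinity>k::int. \<Sum>\<^sub>\<infinity>q::int. F (k, q) :: complex) = infsum F UNIV"
  using infsum_Sigma_banach[of F UNIV "\<lambda>_. UNIV"] summable_product_wt[of F C] assms by simp

lemma partials_eqI: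
  "partials f fx fy \<Longrightarrow> (\<And>x y. fx x y = gx x y) \<Longrightarrow> (\<And>x y. fy x y = gy x y) \<Longrightarrow> partials f gx gy"
  by (simp add: partials_def)

lemma infsum_loc_add:
  "loc_summable F \<Longrightarrow> loc_summable G \<Longrightarrow> (\<Sum>\<^sub>\<infinity>i. F i x y + G i x y) = (\<Sum>\<^sub>\<infinity>i. F i x y) + (\<Sum>\<^sub>\<infinity>i. G i x y)"
  by (rule infsum_add) (auto intro: loc_summableD)

section \<open>Derivatives of inner products and the standard connection\<close>

context heisenberg
begin

lemma inner_R_add_left:
  assumes "f \<in> Xi" "f' \<in> Xi" "g \<in> Xi"
  shows "R (\<lambda>x y. f x y + f' x y) g x y p = R f g x y p + R f' g x y p"
proof -
  have "R_term (\<lambda>x y. f x y + f' x y) g p k x y = R_term f g p k x y + R_term f' g p k x y" for k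
    by (simp add: R_term_def algebra_simps)
  then show ?thesis
    unfolding inner_R_eq_sum by (simp add: infsum_loc_add R_term_loc_summable assms)
qed

lemma inner_R_add_right:
  assumes "f \<in> Xi" "g \<in> Xi" "g' \<in> Xi"
  shows "R f (\<lambda>x y. g x y + g' x y) x y p = R f g x y p + R f g' x y p"
proof -
  have "R_term f (\<lambda>x y. g x y + g' x y) p k x y = R_term f g p k x y + R_term f g' p k x y" for k
    by (simp add: R_term_def algebra_simps)
  then show ?thesis
    unfolding inner_R_eq_sum by (simp add: infsum_loc_add R_term_loc_summable assms)
qed

lemma inner_R_cmult_left: "R (\<lambda>x y. a * f x y) g x y p = a * R f g x y p"
  unfolding inner_R_eq_sum infsum_cmult_right'[symmetric] by (simp add: R_term_def mult_ac)

lemma inner_R_cmult_right: "R f (\<lambda>x y. a * g x y) x y p = cnj a * R f g x y p"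
  unfolding inner_R_eq_sum infsum_cmult_right'[symmetric] by (simp add: R_term_def mult_ac)

lemma inner_R_uminus_left: "R (\<lambda>x y. - f x y) g x y p = - R f g x y p"
  using inner_R_cmult_left[of "-1"] by simp

lemma inner_R_uminus_right: "R f (\<lambda>x y. - g x y) x y p = - R f g x y p"
  using inner_R_cmult_right[of _ "-1"] by simp

lemma inner_L_add_left:
  assumes "f \<in> Xi" "f' \<in> Xi" "g \<in> Xi"
  shows "L (\<lambda>x y. f x y + f' x y) g x y p = L f g x y p + L f' g x y p"
proof -
  have "L_term (\<lambda>x y. f x y + f' x y) g p k x y = L_term f g p k x y + L_term f' g p k x y" for k
    by (simp add: L_term_def algebra_simps)
  then show ?thesis
    unfolding inner_L_eq_sum by (simp add: infsum_loc_add L_term_loc_summable assms)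
qed

text \<open>In every summand the arguments of f and g differ by 2 p \<mu>. Hence multiplication by p
  is a commutator with x, which is how a connection can implement \<open>delta_Z\<close>.\<close>

lemma inner_R_xmul:
  assumes "f \<in> Xi" "g \<in> Xi"
  shows "R (xmul f) g x y p = R f (xmul g) x y p + 2 * of_int p * of_real \<mu> * R f g x y p"
proof -
  have "R_term (xmul f) g p k x y = R_term f (xmul g) p k x y + 2 * of_int p * of_real \<mu> * R_term f g p k x y" for k
    by (simp add: R_term_def xmul_def algebra_simps)
  then show ?thesis
    unfolding inner_R_eq_sum infsum_cmult_right'[symmetric]
    by (subst infsum_add[symmetric])
      (auto intro!: loc_summableD[OF R_term_loc_summable] summable_on_cmult_right Xi_xmul assms)
qed

text \<open>Differentiating the phase in y produces the index k, which is not controlled by the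
  majorants of the term. It is written as (x + k) - x, and x + k is absorbed into
  \<open>xmul f\<close>.\<close>

lemma R_term_partials:
  assumes "f \<in> Xi" "g \<in> Xi"
  shows "partials (R_term f g p k)
    (\<lambda>x y. R_term (partial_x f) g p k x y + R_term f (partial_x g) p k x y)
    (\<lambda>x y. - (2 * of_real pi * \<i> * of_int c * of_int p) * (R_term (xmul f) g p k x y + (- of_real x) * R_term f g p k x y)
      + (R_term (partial_y f) g p k x y + R_term f (partial_y g) p k x y))"
    (is "partials _ ?X ?Y")
proof -
  note P = partials_mult[OF partials_mult[OF partials_ee[of "of_int (- (c * k * p))" "of_int p * \<nu>"]
      partials_shift[OF Xi_partials[OF assms(1)], of "of_int k" 0]]
      partials_cnj[OF partials_shift[OF Xi_partials[OF assms(2)], of "of_int k - 2 * of_int p * \<mu>" "- 2 * of_int p * \<nu>"]]]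
  show ?thesis
    unfolding R_term_alt xmul_def
    by (rule partials_eqI[OF P]) (simp_all add: algebra_simps)
qed

lemma inner_R_partials:
  assumes "f \<in> Xi" "g \<in> Xi"
  shows "partials (\<lambda>x y. R f g x y p)
    (\<lambda>x y. R (partial_x f) g x y p + R f (partial_x g) x y p)
    (\<lambda>x y. - (2 * of_real pi * \<i> * of_int c * of_int p) * (R (xmul f) g x y p + (- of_real x) * R f g x y p)
      + (R (partial_y f) g x y p + R f (partial_y g) x y p))"
proof -
  have ls: "loc_summable (\<lambda>k x y. (- of_real x) * R_term f g p k x y)"
    by (rule loc_summable_mult[of _ _ 1]) (auto intro: R_term_loc_summable assms)
  note I = loc_summable_add loc_summable_cmult ls R_term_loc_summable Xi_xmul Xi_partial_x Xi_partial_y assms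
  have P: "partials (\<lambda>x y. \<Sum>\<^sub>\<infinity>k. R_term f g p k x y)
    (\<lambda>x y. \<Sum>\<^sub>\<infinity>k. R_term (partial_x f) g p k x y + R_term f (partial_x g) p k x y)
    (\<lambda>x y. \<Sum>\<^sub>\<infinity>k. - (2 * of_real pi * \<i> * of_int c * of_int p) * (R_term (xmul f) g p k x y + (- of_real x) * R_term f g p k x y)
      + (R_term (partial_y f) g p k x y + R_term f (partial_y g) p k x y))"
    by (rule partials_infsum[OF infinite_UNIV_int _ _ _ R_term_partials[OF assms]]) (intro I)+
  show ?thesis unfolding inner_R_eq_sum
    by (rule partials_eqI[OF P]) (simp_all only: infsum_add infsum_cmult_right' summable_on_add
      summable_on_cmult_right loc_summableD[OF R_term_loc_summable] Xi_xmul Xi_partial_x Xi_partial_y assms)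
qed

text \<open>The coefficient of x^2 comes from \<open>delta_X\<close>: together with the derivative
  of the phase it contributes 2 pi i c p times \<open>R (xmul f) g\<close> - p \<mu>
  \<open>R f g\<close>, and by \<open>inner_R_xmul\<close> p times this difference is 1 / (4 \<mu>)
  times the commutator of the inner product with x^2.\<close>

definition nab0 :: "heis \<Rightarrow> mfun \<Rightarrow> mfun"
  where "nab0 W f = (case W of (a, b, z) \<Rightarrow> \<lambda>x y.
    of_real a * (- partial_y f x y + of_real pi * \<i> * of_int c / (2 * of_real \<mu>) * xmul (xmul f) x y) +
    of_real b * (- partial_x f x y) + of_real z * (of_real pi * \<i> / of_real \<mu> * xmul f x y))"

lemma Xi_nab0: "f \<in> Xi \<Longrightarrow> nab0 W f \<in> Xi"
  by (cases W) (simp only: nab0_def prod.case,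
    intro Xi_add Xi_cmult Xi_uminus Xi_xmul Xi_partial_x Xi_partial_y)

lemma delta_inner_R:
  assumes "f \<in> Xi" "g \<in> Xi"
  shows "delta c \<mu> W (R f g) = (\<lambda>x y p. R (nab0 W f) g x y p + R f (nab0 W g) x y p)"
proof (intro ext)
  fix x y p
  obtain a b z where W: "W = (a, b, z)" by (cases W)
  note p = partials_imp(2,3)[OF inner_R_partials[OF assms, of p]]
  define \<beta> where "\<beta> = of_real pi * \<i> * of_int c / (2 * of_real \<mu>)"
  define \<alpha> where "\<alpha> = of_real pi * \<i> / of_real \<mu>"
  have ab: "cnj \<beta> = - \<beta>" "cnj \<alpha> = - \<alpha>" by (simp_all add: \<alpha>_def \<beta>_def)
  \<comment> \<open>These factors cancel the 2 p \<mu> of \<open>inner_R_xmul\<close>, which is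
    applied once for x and twice for x^2.\<close>
  have am: "2 * of_real \<mu> * \<alpha> = 2 * of_real pi * \<i>" "4 * of_real \<mu> * \<beta> = 2 * of_real pi * \<i> * of_int c"
    using mu by (simp_all add: \<alpha>_def \<beta>_def)
  note I = assms Xi_xmul Xi_partial_x Xi_partial_y Xi_cmult Xi_add Xi_uminus
  have l: "R (nab0 W f) g x y p = of_real a * (- R (partial_y f) g x y p + \<beta> * R (xmul (xmul f)) g x y p)
      + of_real b * (- R (partial_x f) g x y p) + of_real z * (\<alpha> * R (xmul f) g x y p)"
    unfolding nab0_def W \<beta>_def[symmetric] \<alpha>_def[symmetric]
    by (simp only: prod.case inner_R_add_left inner_R_cmult_left inner_R_uminus_left I)
  have r: "R f (nab0 W g) x y p = of_real a * (- R f (partial_y g) x y p - \<beta> * R f (xmul (xmul g)) x y p)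
      + of_real b * (- R f (partial_x g) x y p) - of_real z * (\<alpha> * R f (xmul g) x y p)"
    unfolding nab0_def W \<beta>_def[symmetric] \<alpha>_def[symmetric]
    by (simp only: prod.case inner_R_add_right inner_R_cmult_right inner_R_uminus_right I ab complex_cnj_complex_of_real)
      simp
  have x1: "R (xmul (xmul f)) g x y p = R (xmul f) (xmul g) x y p + 2 * of_int p * of_real \<mu> * R (xmul f) g x y p"
    by (rule inner_R_xmul) (intro I)+
  have x2: "R (xmul f) (xmul g) x y p = R f (xmul (xmul g)) x y p + 2 * of_int p * of_real \<mu> * R f (xmul g) x y p"
    by (rule inner_R_xmul) (intro I)+
  have x3: "R (xmul f) g x y p = R f (xmul g) x y p + 2 * of_int p * of_real \<mu> * R f g x y p"
    by (rule inner_R_xmul[OF assms])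
  \<comment> \<open>The factor x in \<open>delta_X\<close> cancels against the -x left over from
    differentiating the phase; without this the result would not be a combination of inner
    products.\<close>
  have "delta_X c \<mu> (R f g) x y p = - R (partial_y f) g x y p - R f (partial_y g) x y p +
      2 * of_real pi * \<i> * of_int c * (of_int p * (R (xmul f) g x y p - of_int p * of_real \<mu> * R f g x y p))"
    unfolding delta_X_def p by (simp add: algebra_simps)
  also have "\<dots> = - R (partial_y f) g x y p - R f (partial_y g) x y p + \<beta> * R (xmul (xmul f)) g x y p - \<beta> * R f (xmul (xmul g)) x y p"
    unfolding am(2)[symmetric] x1 x2 x3 by (simp add: algebra_simps)
  finally have X: "delta_X c \<mu> (R f g) x y p = \<dots>" .
  have Z: "delta_Z (R f g) x y p = \<alpha> * R (xmul f) g x y p - \<alpha> * R f (xmul g) x y p"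
    unfolding delta_Z_def am(1)[symmetric] x3 by (simp add: algebra_simps)
  have d: "delta c \<mu> W (R f g) x y p = of_real a * delta_X c \<mu> (R f g) x y p + of_real b * delta_Y (R f g) x y p +
      of_real z * delta_Z (R f g) x y p"
    by (simp add: delta_def W)
  show "delta c \<mu> W (R f g) x y p = R (nab0 W f) g x y p + R f (nab0 W g) x y p"
    unfolding l r d X Z by (simp add: delta_Y_def p algebra_simps)
qed

text \<open>A derivation turns one inner product into a sum of two, so finite sums of inner products
  form the invariant for the coinduction on \<open>D_smooth\<close>.\<close>

inductive_set Rspan :: "mzfun set"
  where base: "f \<in> Xi \<Longrightarrow> g \<in> Xi \<Longrightarrow> R f g \<in> Rspan"
  | add: "\<Phi> \<in> Rspan \<Longrightarrow> \<Psi> \<in> Rspan \<Longrightarrow> (\<lambda>x y p. \<Phi> x y p + \<Psi> x y p) \<in> Rspan"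

lemma delta_XYZ: "delta_X c \<mu> \<Phi> = delta c \<mu> hX \<Phi>" "delta_Y \<Phi> = delta c \<mu> hY \<Phi>" "delta_Z \<Phi> = delta c \<mu> hZ \<Phi>"
  by (simp_all add: delta_def hX_def hY_def hZ_def)

lemma delta_add:
  assumes "\<And>p. partially_differentiable (\<lambda>x y. \<Phi> x y p)" "\<And>p. partially_differentiable (\<lambda>x y. \<Psi> x y p)"
  shows "delta c \<mu> W (\<lambda>x y p. \<Phi> x y p + \<Psi> x y p) = (\<lambda>x y p. delta c \<mu> W \<Phi> x y p + delta c \<mu> W \<Psi> x y p)"
proof (intro ext)
  fix x y p
  note P = partials_imp(2,3)[OF partials_add[OF partially_differentiable_partials[OF assms(1)]
      partially_differentiable_partials[OF assms(2)]], of p p]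
  show "delta c \<mu> W (\<lambda>x y p. \<Phi> x y p + \<Psi> x y p) x y p = delta c \<mu> W \<Phi> x y p + delta c \<mu> W \<Psi> x y p"
    by (cases W) (simp add: delta_def delta_X_def delta_Y_def delta_Z_def P algebra_simps)
qed

lemma Rspan_props:
  assumes "\<Phi> \<in> Rspan"
  shows "rapid \<Phi> \<and> D_invariant \<Phi> \<and> (\<forall>p. partially_differentiable (\<lambda>x y. \<Phi> x y p)) \<and> (\<forall>W. delta c \<mu> W \<Phi> \<in> Rspan)"
  using assms
proof induction
  case (base f g)
  then show ?case
    using rapid_inner_R inner_R_invariant partials_imp(1)[OF inner_R_partials] delta_inner_R
    by (auto intro!: Rspan.intros Xi_nab0)
next
  case (add \<Phi> \<Psi>)
  have "partially_differentiable (\<lambda>x y. \<Phi> x y p + \<Psi> x y p)" for p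
  proof -
    have "partially_differentiable (\<lambda>x y. \<Phi> x y p)" "partially_differentiable (\<lambda>x y. \<Psi> x y p)"
      using add.IH by blast+
    from this[THEN partially_differentiable_partials] show ?thesis
      by (rule partials_imp(1)[OF partials_add])
  qed
  then show ?case using add.IH delta_add by (auto intro: rapid_add D_invariant_add Rspan.add)
qed

lemma inner_R_D_smooth:
  assumes "f \<in> Xi" "g \<in> Xi" shows "R f g \<in> D_smooth c \<mu> \<nu>"
proof -
  have "R f g \<in> Rspan" using assms by (rule Rspan.base)
  then show ?thesis
  proof (rule D_smooth.coinduct[of "\<lambda>\<Phi>. \<Phi> \<in> Rspan"])
    fix \<Phi> assume "\<Phi> \<in> Rspan"
    then show "\<exists>\<Psi>. \<Phi> = \<Psi> \<and> \<Psi> \<in> D_cstar c \<mu> \<nu> \<and> (\<forall>p. partially_differentiable (\<lambda>x y. \<Psi> x y p)) \<and>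
        (delta_X c \<mu> \<Psi> \<in> Rspan \<or> delta_X c \<mu> \<Psi> \<in> D_smooth c \<mu> \<nu>) \<and>
        (delta_Y \<Psi> \<in> Rspan \<or> delta_Y \<Psi> \<in> D_smooth c \<mu> \<nu>) \<and>
        (delta_Z \<Psi> \<in> Rspan \<or> delta_Z \<Psi> \<in> D_smooth c \<mu> \<nu>)"
      unfolding delta_XYZ using Rspan_props[of \<Phi>] D_cstarI[of \<Phi>] by blast
  qed
qed

section \<open>Triple products: the two inner products and the two actions\<close>

definition triple_term :: "mfun \<Rightarrow> mfun \<Rightarrow> mfun \<Rightarrow> int \<times> int \<Rightarrow> mfun"
  where "triple_term g h f z = (case z of (k, q) \<Rightarrow> \<lambda>x y. ee (of_int (- (c * q * k)) * (y - of_int k * \<nu>)) *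
    g (x + (- 2 * of_int k * \<mu>)) (y + (- 2 * of_int k * \<nu>)) *
    h (x + (of_int q - 2 * of_int k * \<mu>)) (y + (- 2 * of_int k * \<nu>)) * f (x + of_int q) (y + 0))"

text \<open>With u, v, w the first arguments of g, h, f, one has v - u = q and w - v = 2 k \<mu>.
  Two uses of \<open>wt_diff\<close> therefore give decay in q and in k at once.\<close>

lemma triple_term_bound:
  assumes "g \<in> Xi" "h \<in> Xi" "f \<in> Xi"
  obtains C where "0 \<le> C" "\<And>k q x y. norm (triple_term g h f (k, q) x y) \<le> C / (wt (of_int k) * wt (of_int q))"
proof -
  obtain A where A: "0 \<le> A" "\<And>x y. norm (g x y) \<le> A / wt x ^ 2" using Xi_decay[OF assms(1)] by blast
  obtain B where B: "0 \<le> B" "\<And>x y. norm (h x y) \<le> B / wt x ^ 2" using Xi_decay[OF assms(2)] by blast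
  obtain D where D: "0 \<le> D" "\<And>x y. norm (f x y) \<le> D / wt x ^ 2" using Xi_decay[OF assms(3)] by blast
  obtain \<kappa> where \<kappa>: "\<kappa> \<ge> 1" "\<And>x. wt x \<le> \<kappa> * wt ((2 * \<mu>) * x)" using wt_scale[of "2 * \<mu>"] mu by auto
  have "norm (triple_term g h f (k, q) x y) \<le> (A * B * D * (4 * \<kappa>)) / (wt (of_int k) * wt (of_int q))" for k q x y
  proof -
    define u v w where "u = x + (- 2 * of_int k * \<mu>)" and "v = x + (of_int q - 2 * of_int k * \<mu>)" and "w = x + of_int q"
    have q: "wt (of_int q) \<le> 2 * wt v * wt u" using wt_diff[of v u] by (simp add: u_def v_def)
    have "wt (of_int k) \<le> \<kappa> * wt (w - v)" using \<kappa>(2)[of "of_int k"] by (simp add: w_def v_def mult_ac)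
    also have "\<dots> \<le> \<kappa> * (2 * wt w * wt v)" using \<kappa>(1) wt_diff[of w v] by simp
    finally have k: "wt (of_int k) \<le> \<kappa> * (2 * wt w * wt v)" .
    have "norm (triple_term g h f (k, q) x y) \<le> (A / wt u ^ 2) * (B / wt v ^ 2) * (D / wt w ^ 2)"
      unfolding triple_term_def prod.case norm_mult u_def[symmetric] v_def[symmetric] w_def[symmetric]
      using A B D by (intro mult_mono mult_nonneg_nonneg) simp_all
    also have "\<dots> = (A * B * D * (4 * \<kappa>)) / (4 * \<kappa> * wt u ^ 2 * wt v ^ 2 * wt w ^ 2)"
      using \<kappa>(1) by simp
    also have "\<dots> \<le> (A * B * D * (4 * \<kappa>)) / (wt (of_int k) * wt (of_int q))"
    proof (rule divide_left_mono)
      have "wt (of_int k) * wt (of_int q) \<le> (\<kappa> * (2 * wt w * wt v)) * (2 * wt v * wt u)"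
        using \<kappa>(1) by (intro mult_mono k q mult_nonneg_nonneg) simp_all
      also have "\<dots> = 4 * \<kappa> * wt u ^ 1 * wt v ^ 2 * wt w ^ 1" by (simp add: power2_eq_square)
      also have "\<dots> \<le> 4 * \<kappa> * wt u ^ 2 * wt v ^ 2 * wt w ^ 2"
        using \<kappa>(1) by (intro mult_mono mult_nonneg_nonneg wt_power_mono) simp_all
      finally show "wt (of_int k) * wt (of_int q) \<le> 4 * \<kappa> * wt u ^ 2 * wt v ^ 2 * wt w ^ 2" .
    qed (use A B D \<kappa> in \<open>simp_all add: zero_less_mult_iff\<close>)
    finally show ?thesis .
  qed
  then show ?thesis using that[of "A * B * D * (4 * \<kappa>)"] A B D \<kappa> by simp
qed

lemma triple_term_loc_summable:
  assumes "g \<in> Xi" "h \<in> Xi" "f \<in> Xi" shows "loc_summable (triple_term g h f)"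
proof -
  obtain C where C: "0 \<le> C" "\<And>k q x y. norm (triple_term g h f (k, q) x y) \<le> C / (wt (of_int k) * wt (of_int q))"
    using triple_term_bound[OF assms] by blast
  have "(\<lambda>z. C * (case z of (k, q) \<Rightarrow> 1 / (wt (of_int k) * wt (of_int q)))) summable_on (UNIV :: (int \<times> int) set)"
    by (rule summable_on_cmult_right[OF summable_inverse_wt2])
  then show ?thesis unfolding loc_summable_def using C(2) by (auto intro!: exI split: prod.splits)
qed

lemma triple_term_summable:
  "g \<in> Xi \<Longrightarrow> h \<in> Xi \<Longrightarrow> f \<in> Xi \<Longrightarrow> (\<lambda>z. triple_term g h f z x y) summable_on UNIV"
  by (rule loc_summableD[OF triple_term_loc_summable])

definition triple_sum :: "mfun \<Rightarrow> mfun \<Rightarrow> mfun \<Rightarrow> mfun"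
  where "triple_sum g h f = (\<lambda>x y. \<Sum>\<^sub>\<infinity>z. triple_term g h f z x y)"

text \<open>The factors \<open>q\<close> and \<open>2 k \<mu>\<close> that appear when a term is differentiated are differences of the arguments of
  \<open>h\<close>, \<open>g\<close> and \<open>f\<close>, \<open>h\<close>, so they can be absorbed into the functions.\<close>

lemma triple_term_q: "of_int q * triple_term g h f (k, q) x y = triple_term g (xmul h) f (k, q) x y + (- 1) * triple_term (xmul g) h f (k, q) x y"
  and triple_term_k: "2 * of_real \<mu> * of_int k * triple_term g h f (k, q) x y = triple_term g h (xmul f) (k, q) x y + (- 1) * triple_term g (xmul h) f (k, q) x y"
  by (simp_all add: triple_term_def xmul_def algebra_simps)

text \<open>The y-derivative of the phase brings down -2 pi i c q k; the denominator pays for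
  writing k as a difference of arguments divided by 2 \<mu>.\<close>

definition mixed_coeff :: complex where "mixed_coeff = - (2 * of_real pi * \<i> * of_int c) / (2 * of_real \<mu>)"

lemma triple_term_partials:
  assumes "g \<in> Xi" "h \<in> Xi" "f \<in> Xi"
  shows "partials (triple_term g h f z)
    (\<lambda>x y. triple_term (partial_x g) h f z x y + (triple_term g (partial_x h) f z x y + triple_term g h (partial_x f) z x y))
    (\<lambda>x y. mixed_coeff * (triple_term g (xmul h) (xmul f) z x y + (- 1) * triple_term (xmul g) h (xmul f) z x y +
        (- 1) * (triple_term g (xmul (xmul h)) f z x y + (- 1) * triple_term (xmul g) (xmul h) f z x y)) +
      (triple_term (partial_y g) h f z x y + (triple_term g (partial_y h) f z x y + triple_term g h (partial_y f) z x y)))"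
    (is "partials _ ?X ?Y")
proof -
  obtain k q where z: "z = (k, q)" by (cases z)
  note P = partials_mult[OF partials_mult[OF partials_mult[OF partials_ee[of "of_int (- (c * q * k))" "of_int k * \<nu>"]
      partials_shift[OF Xi_partials[OF assms(1)], of "- 2 * of_int k * \<mu>" "- 2 * of_int k * \<nu>"]]
      partials_shift[OF Xi_partials[OF assms(2)], of "of_int q - 2 * of_int k * \<mu>" "- 2 * of_int k * \<nu>"]]
      partials_shift[OF Xi_partials[OF assms(3)], of "of_int q" 0]]
  have P': "partials (triple_term g h f z)
    (\<lambda>x y. triple_term (partial_x g) h f z x y + (triple_term g (partial_x h) f z x y + triple_term g h (partial_x f) z x y))
    (\<lambda>x y. - (2 * of_real pi * \<i> * of_int c) * (of_int q * (of_int k * triple_term g h f z x y)) +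
      (triple_term (partial_y g) h f z x y + (triple_term g (partial_y h) f z x y + triple_term g h (partial_y f) z x y)))"
    unfolding triple_term_def z prod.case
    by (rule partials_eqI[OF P]) (simp_all add: algebra_simps)
  have "- (2 * of_real pi * \<i> * of_int c) * (of_int q * (of_int k * triple_term g h f z x y)) =
      mixed_coeff * (of_int q * (2 * of_real \<mu> * of_int k * triple_term g h f z x y))" for x y
    using mu by (simp add: mixed_coeff_def)
  also have "\<dots> x y = mixed_coeff * (of_int q * triple_term g h (xmul f) z x y + (- 1) * (of_int q * triple_term g (xmul h) f z x y))" for x y
    unfolding z triple_term_k by (simp add: algebra_simps)
  finally show ?thesis using P' unfolding z triple_term_q by simp
qed

text \<open>Both partial derivatives of a triple sum, and its product with x, are linear
  combinations of triple sums, so the coinduction up to span closes. This is what keeps rank-one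
  operators inside the smooth module.\<close>

lemma triple_sum_Xi:
  assumes "g \<in> Xi" "h \<in> Xi" "f \<in> Xi" shows "triple_sum g h f \<in> Xi"
proof -
  define S where "S = {triple_sum g h f | g h f. g \<in> Xi \<and> h \<in> Xi \<and> f \<in> Xi}"
  have "triple_sum g h f \<in> S" using assms by (auto simp: S_def)
  then show ?thesis
  proof (rule Xi_coinduct[rotated])
    fix F assume "F \<in> S"
    then obtain g h f where 1: "g \<in> Xi" "h \<in> Xi" "f \<in> Xi" and F: "F = triple_sum g h f" by (auto simp: S_def)
    note I = 1 Xi_partial_x Xi_partial_y Xi_xmul
    have mem: "triple_sum g h f \<in> lspan S" if "g \<in> Xi" "h \<in> Xi" "f \<in> Xi" for g h f
      by (rule lspan.base) (use that in \<open>auto simp: S_def\<close>)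
    have inf: "infinite (UNIV :: (int \<times> int) set)" by (simp add: finite_prod)
    note ls = loc_summable_add loc_summable_cmult triple_term_loc_summable
    note sm = summable_on_add summable_on_cmult_right triple_term_summable
    note P = partials_infsum[OF inf triple_term_loc_summable[OF 1] _ _ triple_term_partials[OF 1]]
    have "partials F
      (\<lambda>x y. triple_sum (partial_x g) h f x y + (triple_sum g (partial_x h) f x y + triple_sum g h (partial_x f) x y))
      (\<lambda>x y. mixed_coeff * (triple_sum g (xmul h) (xmul f) x y + (- 1) * triple_sum (xmul g) h (xmul f) x y +
          (- 1) * (triple_sum g (xmul (xmul h)) f x y + (- 1) * triple_sum (xmul g) (xmul h) f x y)) +
        (triple_sum (partial_y g) h f x y + (triple_sum g (partial_y h) f x y + triple_sum g h (partial_y f) x y)))"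
      unfolding F triple_sum_def
      by (rule partials_eqI[OF P], (intro ls I)+) (simp_all only: infsum_add infsum_cmult_right' sm I)
    moreover have "(\<lambda>x y. triple_sum (partial_x g) h f x y + (triple_sum g (partial_x h) f x y + triple_sum g h (partial_x f) x y)) \<in> lspan S"
      by (intro lspan.add mem I)
    moreover have "(\<lambda>x y. mixed_coeff * (triple_sum g (xmul h) (xmul f) x y + (- 1) * triple_sum (xmul g) h (xmul f) x y +
          (- 1) * (triple_sum g (xmul (xmul h)) f x y + (- 1) * triple_sum (xmul g) (xmul h) f x y)) +
        (triple_sum (partial_y g) h f x y + (triple_sum g (partial_y h) f x y + triple_sum g h (partial_y f) x y))) \<in> lspan S"
      by (intro lspan.add lspan.scale mem I)
    moreover have "(\<lambda>x y. of_real x * F x y) \<in> lspan S"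
    proof -
      \<comment> \<open>Uses x = (x - 2 k \<mu>) + (x + q) - (x + q - 2 k \<mu>), the arguments of
        g, f and h.\<close>
      have "of_real x * triple_term g h f z x y = triple_term (xmul g) h f z x y + (triple_term g h (xmul f) z x y + (- 1) * triple_term g (xmul h) f z x y)" for z x y
        by (cases z) (simp add: triple_term_def xmul_def algebra_simps)
      then have "(\<lambda>x y. of_real x * F x y) = (\<lambda>x y. triple_sum (xmul g) h f x y + (triple_sum g h (xmul f) x y + (- 1) * triple_sum g (xmul h) f x y))"
        unfolding F triple_sum_def infsum_cmult_right'[symmetric]
        by (simp only: infsum_add infsum_cmult_right' sm I)
      then show ?thesis by (simp only:) (intro lspan.add lspan.scale mem I)
    qed
    moreover have "continuous2 F"
      unfolding F triple_sum_def
    proof (rule continuous2_infsum[OF triple_term_loc_summable[OF 1]])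
      fix z :: "int \<times> int"
      obtain k q where z: "z = (k, q)" by (cases z)
      show "continuous2 (triple_term g h f z)"
        unfolding triple_term_def z prod.case
        by (intro continuous2_mult continuous2_ee continuous2_cong_shift Xi_continuous 1)
    qed
    moreover have "periodic2 F"
    proof -
      have "triple_term g h f z x (y + 1) = triple_term g h f z x y" for z x y
      proof -
        obtain k q where z: "z = (k, q)" by (cases z)
        have y: "y + 1 + b = y + b + 1" for b :: real by simp
        show ?thesis unfolding triple_term_def z prod.case y by (simp only: ee_shift_int Xi_periodic 1)
      qed
      then show ?thesis by (simp add: F triple_sum_def)
    qed
    moreover have "bounded2 F"
    proof -
      obtain C where C: "0 \<le> C" "\<And>k q x y. norm (triple_term g h f (k, q) x y) \<le> C / (wt (of_int k) * wt (of_int q))"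
        using triple_term_bound[OF 1] by blast
      have s: "(\<lambda>z. C * (case z of (k, q) \<Rightarrow> 1 / (wt (of_int k) * wt (of_int q)))) summable_on (UNIV :: (int \<times> int) set)"
        by (rule summable_on_cmult_right[OF summable_inverse_wt2])
      have "norm (F x y) \<le> (\<Sum>\<^sub>\<infinity>z::int \<times> int. C * (case z of (k, q) \<Rightarrow> 1 / (wt (of_int k) * wt (of_int q))))" for x y
        unfolding F triple_sum_def
        by (rule norm_infsum_le[OF has_sum_infsum[OF triple_term_summable[OF 1]] has_sum_infsum[OF s]])
          (use C(2) in \<open>auto split: prod.splits\<close>)
      then show ?thesis by blast
    qed
    ultimately show "schwartz_step (lspan S) F"
      by blast
  qed
qed

text \<open>The imprimitivity identity: \<open>L g h\<close> acting on f equals g acted on by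
  \<open>R h f\<close>. Both are the same double series, summed in different orders.
  \<open>triple_sum\<close> takes the conjugate of h so that it is linear in all three
  slots.\<close>

lemma lact_inner_L:
  assumes "g \<in> Xi" "h \<in> Xi" "f \<in> Xi"
  shows "lact (L g h) f = triple_sum g (\<lambda>x y. cnj (h x y)) f" "ra g (R h f) = triple_sum g (\<lambda>x y. cnj (h x y)) f"
proof -
  let ?T = "triple_term g (\<lambda>x y. cnj (h x y)) f"
  have h': "(\<lambda>x y. cnj (h x y)) \<in> Xi" by (rule Xi_cnj[OF assms(2)])
  obtain C where C: "0 \<le> C" "\<And>k q x y. norm (?T (k, q) x y) \<le> C / (wt (of_int k) * wt (of_int q))"
    using triple_term_bound[OF assms(1) h' assms(3)] by blast
  have triple_sum: "triple_sum g (\<lambda>x y. cnj (h x y)) f x y = (\<Sum>\<^sub>\<infinity>k. \<Sum>\<^sub>\<infinity>q. ?T (k, q) x y)" for x y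
    unfolding triple_sum_def by (rule infsum_pair_wt[OF C(2), symmetric])
  show "lact (L g h) f = triple_sum g (\<lambda>x y. cnj (h x y)) f"
  proof (intro ext)
    fix x y
    have "cnj (L_term g h q k x y) * f (x + of_int q) y = ?T (k, q) x y" for k q
      by (simp add: L_term_alt triple_term_def cnj_ee mult_ac)
    then show "lact (L g h) f x y = triple_sum g (\<lambda>x y. cnj (h x y)) f x y"
      unfolding lact_def inner_L_eq_sum infsum_cnj[symmetric] infsum_cmult_left'[symmetric] triple_sum
      by (subst infsum_swap_wt[OF C(2)]) simp
  qed
  show "ra g (R h f) = triple_sum g (\<lambda>x y. cnj (h x y)) f"
  proof (intro ext)
    fix x y
    have T: "g (x - 2 * of_int k * \<mu>) (y - 2 * of_int k * \<nu>) *
        cnj (R_term h f (- k) q (x - 2 * of_int k * \<mu>) (y - 2 * of_int k * \<nu>)) = ?T (k, q) x y" for k q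
    proof -
      have e: "ee (of_int (c * q * (- k)) * (y - 2 * of_int k * \<nu> - of_int (- k) * \<nu>)) = ee (of_int (- (c * q * k)) * (y - of_int k * \<nu>))"
        by (rule arg_cong[of _ _ ee]) (simp add: algebra_simps)
      have a: "x - 2 * of_int k * \<mu> - 2 * of_int (- k) * \<mu> + of_int q = x + of_int q"
        "y - 2 * of_int k * \<nu> - 2 * of_int (- k) * \<nu> = y + 0"
        "x - 2 * of_int k * \<mu> + of_int q = x + (of_int q - 2 * of_int k * \<mu>)"
        "x - 2 * of_int k * \<mu> = x + (- 2 * of_int k * \<mu>)" "y - 2 * of_int k * \<nu> = y + (- 2 * of_int k * \<nu>)"
        by simp_all
      show ?thesis unfolding R_term_def triple_term_def prod.case e a(1-3) unfolding a by (simp add: mult_ac)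
    qed
    have "ra g (R h f) x y = (\<Sum>\<^sub>\<infinity>k. \<Sum>\<^sub>\<infinity>q. g (x + 2 * of_int k * \<mu>) (y + 2 * of_int k * \<nu>) *
        cnj (R_term h f k q (x + 2 * of_int k * \<mu>) (y + 2 * of_int k * \<nu>)))"
      by (simp add: ract_def inner_R_eq_sum infsum_cmult_right' flip: infsum_cnj)
    \<comment> \<open>The right action translates by +2 k \<mu> and \<open>L_term\<close> by -2 k
      \<mu>, hence the reflection of k.\<close>
    also have "\<dots> = (\<Sum>\<^sub>\<infinity>k. \<Sum>\<^sub>\<infinity>q. g (x + 2 * of_int (- k) * \<mu>) (y + 2 * of_int (- k) * \<nu>) *
        cnj (R_term h f (- k) q (x + 2 * of_int (- k) * \<mu>) (y + 2 * of_int (- k) * \<nu>)))"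
      by (rule infsum_reindex_bij_betw[symmetric]) (rule bij_uminus)
    also have "\<dots> = (\<Sum>\<^sub>\<infinity>k. \<Sum>\<^sub>\<infinity>q. ?T (k, q) x y)" by (simp add: T[symmetric])
    finally show "ra g (R h f) x y = triple_sum g (\<lambda>x y. cnj (h x y)) f x y" by (simp add: triple_sum)
  qed
qed


text \<open>The two double sums agree term by term: transporting \<Psi> along the k-th translation
  and \<open>R g h\<close> along q produces the same phase \<open>ee (- ?t)\<close>. A general
  \<Psi> is merely bounded, so the decay in q must come from f and that in k from the inner
  product.\<close>

lemma lact_ract:
  assumes \<Psi>: "\<Psi> \<in> E_cstar c \<mu> \<nu>" and "f \<in> Xi" "g \<in> Xi" "h \<in> Xi"
  shows "lact \<Psi> (ra f (R g h)) = ra (lact \<Psi> f) (R g h)"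
proof (intro ext)
  fix x y
  obtain B where B: "0 \<le> B" "\<And>x y p. norm (\<Psi> x y p) \<le> B" using E_cstar_bounded[OF \<Psi>] by blast
  obtain A where A: "0 \<le> A" "\<And>x y. norm (f x y) \<le> A / wt x ^ 1" using Xi_decay[OF assms(2)] by blast
  obtain C where C: "0 \<le> C" "\<And>p x y. norm (R g h x y p) \<le> C / wt (of_int p) ^ 2" using inner_R_decay[OF assms(3,4)] by blast
  define K where "K = 1 + (2 * \<mu>)\<^sup>2"
  have K: "0 < K" unfolding K_def by (intro add_pos_nonneg) simp_all
  define u v where "u k = x + 2 * of_int k * \<mu>" and "v k = y + 2 * of_int k * \<nu>" for k :: int
  define G where "G q k = cnj (\<Psi> x y q) * (f (u k + of_int q) (v k) * cnj (R g h (u k + of_int q) (v k) k))" for q k :: int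
  have "norm (G q k) \<le> (B * A * C * (4 * wt x * K)) / (wt (of_int q) * wt (of_int k))" for q k
  proof -
    have k: "wt (2 * of_int k * \<mu>) \<le> K * wt (of_int k)"
      by (simp add: wt_def K_def power_mult_distrib algebra_simps)
    have "wt (of_int q) \<le> 2 * wt (u k + of_int q) * wt (u k)" using wt_diff[of "u k + of_int q" "u k"] by simp
    also have "\<dots> \<le> 2 * wt (u k + of_int q) * (2 * wt x * wt (2 * of_int k * \<mu>))"
      unfolding u_def by (intro mult_left_mono wt_add) simp_all
    also have "\<dots> \<le> 2 * wt (u k + of_int q) * (2 * wt x * (K * wt (of_int k)))"
      using K by (intro mult_left_mono k) simp_all
    finally have q: "wt (of_int q) * wt (of_int k) \<le> 4 * wt x * K * (wt (u k + of_int q) * wt (of_int k) ^ 2)"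
      by (simp add: power2_eq_square mult_ac)
    have p0: "0 < 4 * wt x * K" using K by (intro mult_pos_pos) simp_all
    have "norm (G q k) \<le> B * ((A / wt (u k + of_int q) ^ 1) * (C / wt (of_int k) ^ 2))"
      unfolding G_def norm_mult complex_mod_cnj using A B C
      by (intro mult_mono mult_nonneg_nonneg) simp_all
    also have "\<dots> = (B * A * C * (4 * wt x * K)) / (4 * wt x * K * (wt (u k + of_int q) * wt (of_int k) ^ 2))"
      using K by (simp add: mult_ac)
    also have "\<dots> \<le> (B * A * C * (4 * wt x * K)) / (wt (of_int q) * wt (of_int k))"
      using A(1) B(1) C(1) p0 K by (intro divide_left_mono q mult_nonneg_nonneg mult_pos_pos) simp_all
    finally show ?thesis .
  qed
  from infsum_swap_wt[OF this] have swap: "(\<Sum>\<^sub>\<infinity>q. \<Sum>\<^sub>\<infinity>k. G q k) = (\<Sum>\<^sub>\<infinity>k. \<Sum>\<^sub>\<infinity>q. G q k)" .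
  have "lact \<Psi> (ra f (R g h)) x y = (\<Sum>\<^sub>\<infinity>q. \<Sum>\<^sub>\<infinity>k. G q k)"
    by (simp add: lact_def ract_def G_def infsum_cmult_right' u_def v_def add_ac)
  moreover have "ra (lact \<Psi> f) (R g h) x y = (\<Sum>\<^sub>\<infinity>k. \<Sum>\<^sub>\<infinity>q. G q k)"
  proof -
    have "cnj (\<Psi> (u k) (v k) q) * f (u k + of_int q) (v k) * cnj (R g h (u k) (v k) k) = G q k" for k q
    proof -
      let ?t = "of_int (c * q * k) * (y + of_int k * \<nu>)"
      have "ee (of_int (c * q * (- k)) * (y - of_int (- k) * \<nu>)) * \<Psi> (x - 2 * of_int (- k) * \<mu>) (y - 2 * of_int (- k) * \<nu>) q = \<Psi> x y q"
        using E_cstar_invariant[OF \<Psi>] unfolding E_invariant_def by blast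
      then have 1: "\<Psi> x y q = ee (- ?t) * \<Psi> (u k) (v k) q" by (simp add: u_def v_def)
      have "cnj (ee (of_int (c * q * k) * (v k - of_int k * \<nu>))) * R g h (u k + of_int q) (v k) k = R g h (u k) (v k) k"
        using inner_R_invariant[of g h] unfolding D_invariant_def by blast
      moreover have "v k - of_int k * \<nu> = y + of_int k * \<nu>" by (simp add: v_def)
      ultimately have 2: "R g h (u k) (v k) k = ee (- ?t) * R g h (u k + of_int q) (v k) k" by (simp add: cnj_ee)
      show ?thesis unfolding G_def 1 2 by (simp add: mult_ac)
    qed
    then show ?thesis
      by (simp add: lact_def ract_def u_def v_def flip: infsum_cmult_left')
  qed
  ultimately show "lact \<Psi> (ra f (R g h)) x y = ra (lact \<Psi> f) (R g h) x y" using swap by simp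
qed

text \<open>\<open>lact\<close> conjugates \<Psi> and \<open>L\<close> conjugates its first slot, so
  \<Psi> comes out unconjugated; its invariance under translations supplies the phase in the k-th
  summand.\<close>

lemma mult_E_inner_L:
  assumes \<Psi>: "\<Psi> \<in> E_cstar c \<mu> \<nu>" and "f \<in> Xi" "g \<in> Xi"
  shows "mult_E \<Psi> (L f g) = L (lact \<Psi> f) g"
proof (intro ext)
  fix x y p
  obtain B where B: "0 \<le> B" "\<And>x y p. norm (\<Psi> x y p) \<le> B" using E_cstar_bounded[OF \<Psi>] by blast
  obtain A where A: "0 \<le> A" "\<And>x y. norm (f x y) \<le> A / wt x ^ 1" using Xi_decay[OF assms(2)] by blast
  obtain D where D: "0 \<le> D" "\<And>x y. norm (g x y) \<le> D / wt x ^ 2" using Xi_decay[OF assms(3)] by blast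
  obtain \<kappa> where \<kappa>: "\<kappa> \<ge> 1" "\<And>x. wt x \<le> \<kappa> * wt ((2 * \<mu>) * x)" using wt_scale[of "2 * \<mu>"] mu by auto
  define u v where "u k = x - 2 * of_int k * \<mu>" and "v k = y - 2 * of_int k * \<nu>" for k :: int
  define G where "G q k = \<Psi> x y q * L_term f g (p - q) k (x + of_int q) y" for q k :: int
  have L_term: "L_term f g (p - q) k (x + of_int q) y = ee (of_int (c * (p - q) * k) * (y - of_int k * \<nu>)) *
      cnj (f (u k + of_int q) (v k)) * g (u k + of_int p) (v k)" for q k
  proof -
    have "x + of_int q - 2 * of_int k * \<mu> = u k + of_int q" "u k + of_int q + of_int (p - q) = u k + of_int p"
      by (simp_all add: u_def)
    then show ?thesis by (simp only: L_term_def v_def)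
  qed
  have "norm (G q k) \<le> (B * A * D * (8 * \<kappa> * wt (x + of_int p) * wt (of_int p))) / (wt (of_int q) * wt (of_int k))" for q k
  proof -
    \<comment> \<open>Here x and p are fixed, so their weights may enter the constant; only decay in
      q and k matters. The arguments ?a and ?b differ by q - p, and ?b differs from x + p by 2 k
      \<mu>.\<close>
    let ?K = "8 * \<kappa> * wt (x + of_int p) * wt (of_int p)"
    let ?a = "u k + of_int q" and ?b = "u k + of_int p"
    have "wt (of_int k) \<le> \<kappa> * wt (x + of_int p - ?b)" using \<kappa>(2)[of "of_int k"] by (simp add: u_def mult_ac)
    also have "\<dots> \<le> \<kappa> * (2 * wt (x + of_int p) * wt ?b)" using \<kappa>(1) wt_diff[of "x + of_int p" ?b] by simp
    finally have k: "wt (of_int k) \<le> \<kappa> * (2 * wt (x + of_int p) * wt ?b)" .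
    have "wt (of_int q) \<le> 2 * wt (?a - ?b) * wt (of_int p)" using wt_add[of "?a - ?b" "of_int p"] by simp
    also have "\<dots> \<le> 2 * (2 * wt ?a * wt ?b) * wt (of_int p)" by (intro mult_left_mono mult_right_mono wt_diff) simp_all
    finally have "wt (of_int q) * wt (of_int k) \<le> (2 * (2 * wt ?a * wt ?b) * wt (of_int p)) * (\<kappa> * (2 * wt (x + of_int p) * wt ?b))"
      using \<kappa>(1) by (intro mult_mono k mult_nonneg_nonneg) simp_all
    then have q: "wt (of_int q) * wt (of_int k) \<le> ?K * (wt ?a ^ 1 * wt ?b ^ 2)"
      by (simp add: power2_eq_square mult_ac)
    have p0: "0 < ?K" using \<kappa>(1) by (intro mult_pos_pos) simp_all
    have "norm (G q k) \<le> B * ((A / wt ?a ^ 1) * (D / wt ?b ^ 2))"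
      unfolding G_def L_term norm_mult complex_mod_cnj norm_ee mult_1_left using A B D
      by (intro mult_mono mult_nonneg_nonneg) simp_all
    also have "\<dots> = (B * A * D * ?K) / (?K * (wt ?a ^ 1 * wt ?b ^ 2))"
      using \<kappa>(1) by (simp add: mult_ac)
    also have "\<dots> \<le> (B * A * D * ?K) / (wt (of_int q) * wt (of_int k))"
      using A(1) B(1) D(1) p0 \<kappa>(1) by (intro divide_left_mono q mult_nonneg_nonneg mult_pos_pos) simp_all
    finally show ?thesis .
  qed
  from infsum_swap_wt[OF this] have swap: "(\<Sum>\<^sub>\<infinity>q. \<Sum>\<^sub>\<infinity>k. G q k) = (\<Sum>\<^sub>\<infinity>k. \<Sum>\<^sub>\<infinity>q. G q k)" .
  have "mult_E \<Psi> (L f g) x y p = (\<Sum>\<^sub>\<infinity>q. \<Sum>\<^sub>\<infinity>k. G q k)"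
    by (simp add: mult_E_def inner_L_eq_sum G_def infsum_cmult_right')
  moreover have "L (lact \<Psi> f) g x y p = (\<Sum>\<^sub>\<infinity>k. \<Sum>\<^sub>\<infinity>q. G q k)"
  proof -
    have "ee (of_int (c * p * k) * (y - of_int k * \<nu>)) * (\<Psi> (u k) (v k) q * cnj (f (u k + of_int q) (v k))) * g (u k + of_int p) (v k) = G q k" for k q
    proof -
      have 1: "\<Psi> x y q = ee (of_int (c * q * k) * (y - of_int k * \<nu>)) * \<Psi> (u k) (v k) q"
        using E_cstar_invariant[OF \<Psi>] unfolding E_invariant_def u_def v_def by simp
      have 2: "ee (of_int (c * p * k) * (y - of_int k * \<nu>)) =
          ee (of_int (c * q * k) * (y - of_int k * \<nu>)) * ee (of_int (c * (p - q) * k) * (y - of_int k * \<nu>))"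
        unfolding ee_add[symmetric] by (rule arg_cong[of _ _ ee]) (simp add: algebra_simps)
      show ?thesis unfolding G_def L_term 1 2 by (simp add: mult_ac)
    qed
    then show ?thesis
      by (simp add: lact_def inner_L_def u_def[symmetric] v_def[symmetric] flip: infsum_cmult_left' infsum_cmult_right' infsum_cnj)
  qed
  ultimately show "mult_E \<Psi> (L f g) x y p = L (lact \<Psi> f) g x y p" using swap by simp
qed

section \<open>The right action and the Leibniz rule of the standard connection\<close>

definition ract_term :: "mfun \<Rightarrow> mzfun \<Rightarrow> int \<Rightarrow> mfun"
  where "ract_term f \<Phi> q = (\<lambda>x y. f (x + 2 * of_int q * \<mu>) (y + 2 * of_int q * \<nu>) *
    cnj (\<Phi> (x + 2 * of_int q * \<mu>) (y + 2 * of_int q * \<nu>) q))"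

lemma ract_eq_sum: "ra f \<Phi> x y = (\<Sum>\<^sub>\<infinity>q. ract_term f \<Phi> q x y)"
  by (simp add: ract_def ract_term_def)

definition bounded3 :: "mzfun \<Rightarrow> bool"
  where "bounded3 \<Phi> \<longleftrightarrow> (\<exists>B\<ge>0. \<forall>x y p. norm (\<Phi> x y p) \<le> B)"

lemma bounded3_D_cstar: "\<Phi> \<in> D_cstar c \<mu> \<nu> \<Longrightarrow> bounded3 \<Phi>"
  unfolding bounded3_def using D_cstar_bounded by metis

lemma bounded3_inner_R: "f \<in> Xi \<Longrightarrow> g \<in> Xi \<Longrightarrow> bounded3 (R f g)"
  by (intro bounded3_D_cstar D_cstarI rapid_inner_R inner_R_invariant)

lemma ract_term_loc_summable:
  assumes "f \<in> Xi" "bounded3 \<Phi>" shows "loc_summable (ract_term f \<Phi>)"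
proof -
  obtain A where A: "0 \<le> A" "\<And>x y. norm (f x y) \<le> A / wt x ^ 1" using Xi_decay[OF assms(1)] by blast
  obtain B where B: "0 \<le> B" "\<And>x y p. norm (\<Phi> x y p) \<le> B" using assms(2) by (auto simp: bounded3_def)
  show ?thesis
  proof (rule loc_summable_wt[of "2 * \<mu>"])
    show "norm (ract_term f \<Phi> q x y) \<le> (A * B) / wt (x + of_int q * (2 * \<mu>))" for q x y
    proof -
      have "norm (ract_term f \<Phi> q x y) \<le> (A / wt (x + 2 * of_int q * \<mu>) ^ 1) * B"
        unfolding ract_term_def norm_mult complex_mod_cnj using A B by (intro mult_mono) simp_all
      then show ?thesis by (simp add: mult_ac)
    qed
  qed (use mu in simp)
qed

lemmas ract_term_summable = loc_summableD[OF ract_term_loc_summable]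

lemma ract_add_left:
  assumes "f \<in> Xi" "f' \<in> Xi" "bounded3 \<Phi>"
  shows "ra (\<lambda>x y. f x y + f' x y) \<Phi> x y = ra f \<Phi> x y + ra f' \<Phi> x y"
proof -
  have "ract_term (\<lambda>x y. f x y + f' x y) \<Phi> q x y = ract_term f \<Phi> q x y + ract_term f' \<Phi> q x y" for q
    by (simp add: ract_term_def algebra_simps)
  then show ?thesis unfolding ract_eq_sum by (simp add: infsum_add ract_term_summable assms)
qed

lemma ract_cmult_left: "ra (\<lambda>x y. a * f x y) \<Phi> x y = a * ra f \<Phi> x y"
  unfolding ract_eq_sum infsum_cmult_right'[symmetric] by (simp add: ract_term_def mult_ac)

lemma ract_uminus_left: "ra (\<lambda>x y. - f x y) \<Phi> x y = - ra f \<Phi> x y"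
  using ract_cmult_left[of "-1"] by simp

lemma ract_add_right:
  assumes "f \<in> Xi" "bounded3 \<Phi>" "bounded3 \<Psi>"
  shows "ra f (\<lambda>x y p. \<Phi> x y p + \<Psi> x y p) x y = ra f \<Phi> x y + ra f \<Psi> x y"
proof -
  have "ract_term f (\<lambda>x y p. \<Phi> x y p + \<Psi> x y p) q x y = ract_term f \<Phi> q x y + ract_term f \<Psi> q x y" for q
    by (simp add: ract_term_def algebra_simps)
  then show ?thesis unfolding ract_eq_sum by (simp add: infsum_add ract_term_summable assms)
qed

lemma ract_cmult_right: "ra f (\<lambda>x y p. a * \<Phi> x y p) x y = cnj a * ra f \<Phi> x y"
  unfolding ract_eq_sum infsum_cmult_right'[symmetric] by (simp add: ract_term_def mult_ac)

lemma bounded3_add: "bounded3 \<Phi> \<Longrightarrow> bounded3 \<Psi> \<Longrightarrow> bounded3 (\<lambda>x y p. \<Phi> x y p + \<Psi> x y p)"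
  unfolding bounded3_def by (meson add_nonneg_nonneg norm_add_rule_thm)

lemma bounded3_cmult: "bounded3 \<Phi> \<Longrightarrow> bounded3 (\<lambda>x y p. a * \<Phi> x y p)"
  unfolding bounded3_def norm_mult by (meson mult_left_mono mult_nonneg_nonneg norm_ge_zero)

text \<open>The factor q equals ((x + 2 q \<mu>) - x) / (2 \<mu>), the difference of the positions
  where f and the result are evaluated; conjugation of 2 pi i q reverses its sign.\<close>

lemma ract_delta_Z:
  assumes "f \<in> Xi" "bounded3 \<Phi>"
  shows "ra f (delta_Z \<Phi>) x y = (of_real pi * \<i> / of_real \<mu>) * (of_real x * ra f \<Phi> x y - ra (xmul f) \<Phi> x y)"
proof -
  have "ract_term f (delta_Z \<Phi>) q x y = (of_real pi * \<i> / of_real \<mu>) * (of_real x * ract_term f \<Phi> q x y + (- 1) * ract_term (xmul f) \<Phi> q x y)" for q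
    using mu by (simp add: ract_term_def delta_Z_def xmul_def field_simps)
  then have "ra f (delta_Z \<Phi>) x y = (of_real pi * \<i> / of_real \<mu>) * (of_real x * ra f \<Phi> x y + (- 1) * ra (xmul f) \<Phi> x y)"
    unfolding ract_eq_sum
    by (simp only: infsum_add infsum_cmult_right' summable_on_cmult_right ract_term_summable Xi_xmul assms)
  then show ?thesis by simp
qed

text \<open>Derivatives of \<Phi> are expressed through the three derivations, because only these
  are known to be bounded for elements of \<open>D_smooth\<close>. At the translated point the
  factor x - p \<mu> of \<open>delta_X\<close> becomes x + q \<mu>, the midpoint of x and x + 2 q
  \<mu>; this explains the half-sum with coefficient c / 2.\<close>

lemma ract_partials:
  assumes f: "f \<in> Xi" and \<Phi>: "\<And>p. partially_differentiable (\<lambda>x y. \<Phi> x y p)"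
    and b: "bounded3 \<Phi>" "bounded3 (delta_X c \<mu> \<Phi>)" "bounded3 (delta_Y \<Phi>)" "bounded3 (delta_Z \<Phi>)"
  shows "partials (ra f \<Phi>)
    (\<lambda>x y. ra (partial_x f) \<Phi> x y + (- 1) * ra f (delta_Y \<Phi>) x y)
    (\<lambda>x y. ra (partial_y f) \<Phi> x y + (of_int c / 2 * (of_real x * ra f (delta_Z \<Phi>) x y + ra (xmul f) (delta_Z \<Phi>) x y)
       + (- 1) * ra f (delta_X c \<mu> \<Phi>) x y))"
proof -
  have ls: "loc_summable (\<lambda>q x y. of_real x * ract_term f (delta_Z \<Phi>) q x y)"
    by (rule loc_summable_x_mult) (rule ract_term_loc_summable[OF f b(4)])
  note I = loc_summable_add loc_summable_cmult ls ract_term_loc_summable Xi_xmul Xi_partial_x Xi_partial_y f b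
  have p: "partials (ract_term f \<Phi> q)
      (\<lambda>x y. ract_term (partial_x f) \<Phi> q x y + (- 1) * ract_term f (delta_Y \<Phi>) q x y)
      (\<lambda>x y. ract_term (partial_y f) \<Phi> q x y + (of_int c / 2 * (of_real x * ract_term f (delta_Z \<Phi>) q x y + ract_term (xmul f) (delta_Z \<Phi>) q x y)
       + (- 1) * ract_term f (delta_X c \<mu> \<Phi>) q x y))" for q
    unfolding ract_term_def
    by (rule partials_eqI[OF partials_mult[OF partials_shift[OF Xi_partials[OF f]]
          partials_cnj[OF partials_shift[OF partially_differentiable_partials[OF \<Phi>]]]]])
      (simp_all add: delta_X_def delta_Y_def delta_Z_def xmul_def field_simps)
  note P = partials_infsum[OF infinite_UNIV_int _ _ _ p]
  have ra: "ra f \<Phi> = (\<lambda>x y. \<Sum>\<^sub>\<infinity>q. ract_term f \<Phi> q x y)" by (intro ext) (rule ract_eq_sum)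
  show ?thesis unfolding ra unfolding ract_eq_sum
    by (rule partials_eqI[OF P], (intro I)+)
      (simp_all only: infsum_add infsum_cmult_right' summable_on_add summable_on_cmult_right ract_term_summable
        Xi_xmul Xi_partial_x Xi_partial_y f b)
qed

lemma bounded3_D_smooth: "\<Phi> \<in> D_smooth c \<mu> \<nu> \<Longrightarrow> bounded3 \<Phi>"
  by (erule D_smooth.cases) (simp add: bounded3_D_cstar)

lemma D_smooth_props:
  assumes "\<Phi> \<in> D_smooth c \<mu> \<nu>"
  shows "\<And>p. partially_differentiable (\<lambda>x y. \<Phi> x y p)" "bounded3 \<Phi>" "bounded3 (delta_X c \<mu> \<Phi>)" "bounded3 (delta_Y \<Phi>)" "bounded3 (delta_Z \<Phi>)"
  by (rule D_smooth.cases[OF assms]; simp add: bounded3_D_smooth assms)+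

text \<open>For the X component, \<open>ract_delta_Z\<close> turns the half-sum in
  \<open>ract_partials\<close> into a difference of two x^2 terms; the mixed term x
  \<open>ra (xmul f) \<Phi>\<close> cancels, and what remains is the x^2 part of
  \<open>nab0\<close>.\<close>

lemma nab0_ract:
  assumes f: "f \<in> Xi" and \<Phi>: "\<Phi> \<in> D_smooth c \<mu> \<nu>"
  shows "nab0 W (ra f \<Phi>) = (\<lambda>x y. ra (nab0 W f) \<Phi> x y + ra f (delta c \<mu> W \<Phi>) x y)"
proof (intro ext)
  fix x y
  obtain a b z where W: "W = (a, b, z)" by (cases W)
  note \<Phi>' = D_smooth_props[OF \<Phi>]
  note P = partials_imp(2,3)[OF ract_partials[OF f \<Phi>']]
  define \<beta> where "\<beta> = of_real pi * \<i> * of_int c / (2 * of_real \<mu>)"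
  define \<alpha> where "\<alpha> = of_real pi * \<i> / of_real \<mu>"
  define h :: complex where "h = of_int c / 2"
  have ab: "\<beta> = \<alpha> * of_int c / 2" by (simp add: \<alpha>_def \<beta>_def)
  note I = f \<Phi>' Xi_xmul Xi_partial_x Xi_partial_y Xi_cmult Xi_add Xi_uminus
  have l: "ra (nab0 W f) \<Phi> x y = of_real a * (- ra (partial_y f) \<Phi> x y + \<beta> * ra (xmul (xmul f)) \<Phi> x y)
      + of_real b * (- ra (partial_x f) \<Phi> x y) + of_real z * (\<alpha> * ra (xmul f) \<Phi> x y)"
    unfolding nab0_def W \<beta>_def[symmetric] \<alpha>_def[symmetric]
    by (simp only: prod.case ract_add_left ract_cmult_left ract_uminus_left I)
  have d: "delta c \<mu> W \<Phi> = (\<lambda>x y p. of_real a * delta_X c \<mu> \<Phi> x y p + of_real b * delta_Y \<Phi> x y p + of_real z * delta_Z \<Phi> x y p)"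
    by (simp add: delta_def W)
  have r: "ra f (delta c \<mu> W \<Phi>) x y = of_real a * ra f (delta_X c \<mu> \<Phi>) x y + of_real b * ra f (delta_Y \<Phi>) x y
      + of_real z * ra f (delta_Z \<Phi>) x y"
    unfolding d by (simp only: ract_add_right ract_cmult_right bounded3_add bounded3_cmult I complex_cnj_complex_of_real)
  have Z: "ra f (delta_Z \<Phi>) x y = \<alpha> * (of_real x * ra f \<Phi> x y - ra (xmul f) \<Phi> x y)"
    "ra (xmul f) (delta_Z \<Phi>) x y = \<alpha> * (of_real x * ra (xmul f) \<Phi> x y - ra (xmul (xmul f)) \<Phi> x y)"
    unfolding \<alpha>_def by (rule ract_delta_Z; intro I)+
  have n: "nab0 W (ra f \<Phi>) x y = of_real a * (- partial_y (ra f \<Phi>) x y + \<beta> * (of_real x * (of_real x * ra f \<Phi> x y)))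
      + of_real b * (- partial_x (ra f \<Phi>) x y) + of_real z * (\<alpha> * (of_real x * ra f \<Phi> x y))"
    by (simp add: nab0_def W \<alpha>_def \<beta>_def xmul_def)
  show "nab0 W (ra f \<Phi>) x y = ra (nab0 W f) \<Phi> x y + ra f (delta c \<mu> W \<Phi>) x y"
    unfolding n l r P Z ab times_divide_eq_right[symmetric] h_def[symmetric] by (simp add: algebra_simps)
qed

lemma partials_xmul: "partials f fx fy \<Longrightarrow> partials (xmul f) (\<lambda>x y. f x y + of_real x * fx x y) (\<lambda>x y. of_real x * fy x y)"
  unfolding xmul_def by (rule partials_x_mult)

lemma partials_uminus: "partials f fx fy \<Longrightarrow> partials (\<lambda>x y. - f x y) (\<lambda>x y. - fx x y) (\<lambda>x y. - fy x y)"
  using partials_cmult[of f fx fy "-1"] by simp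

lemma nab0_linear:
  assumes "f \<in> Xi" "g \<in> Xi"
  shows "nab0 W (\<lambda>x y. a * f x y + b * g x y) = (\<lambda>x y. a * nab0 W f x y + b * nab0 W g x y)"
proof -
  note P = partials_imp(2,3)[OF partials_add[OF partials_cmult[OF Xi_partials[OF assms(1)], of a]
        partials_cmult[OF Xi_partials[OF assms(2)], of b]]]
  show ?thesis by (cases W) (simp add: nab0_def P xmul_def algebra_simps fun_eq_iff)
qed

lemma nab0_compatible: "nab0 \<in> compatible_connections c \<mu> \<nu>"
proof -
  have "nab0 (v, w, z) f x y = of_real v * nab0 hX f x y + of_real w * nab0 hY f x y + of_real z * nab0 hZ f x y" for v w z f x y
    by (simp add: nab0_def hX_def hY_def hZ_def)
  then have "nab0 (a *\<^sub>R V + b *\<^sub>R W) f = (\<lambda>x y. of_real a * nab0 V f x y + of_real b * nab0 W f x y)" for V W a b f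
    by (cases V; cases W) (simp add: algebra_simps fun_eq_iff)
  then have "linear_connection c \<mu> \<nu> nab0"
    unfolding linear_connection_def using Xi_nab0 nab0_linear nab0_ract by blast
  then show ?thesis unfolding compatible_connections_def using delta_inner_R by blast
qed

text \<open>The commutator of x^2 with the x-derivative leaves a multiple of c x in the X, Y
  curvature, which the bracket term removes. The commutator of x with the x-derivative leaves the
  scalar in the Y, Z curvature.\<close>

lemma curvature_op_nab0:
  assumes f: "f \<in> Xi"
  shows "curvature_op c nab0 (v1, v2, v3) (w1, w2, w3) f =
    (\<lambda>x y. - (of_real (v2 * w3 - v3 * w2) * (of_real pi * \<i> / of_real \<mu>)) * f x y)"
proof (intro ext)
  fix x y
  define \<alpha> where "\<alpha> = of_real pi * \<i> / of_real \<mu>"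
  have ab: "of_real pi * \<i> * of_int c / (2 * of_real \<mu>) = \<alpha> * of_int c / 2" by (simp add: \<alpha>_def)
  note px = Xi_partials[OF Xi_partial_x[OF f]] and py = Xi_partials[OF Xi_partial_y[OF f]] and p = Xi_partials[OF f]
  have comm: "partial_y (partial_x f) = partial_x (partial_y f)" by (rule smooth_commute[OF Xi_smooth[OF f]])
  have P: "partials (nab0 (a, b, z) f)
     (\<lambda>x y. of_real a * (- partial_x (partial_y f) x y + \<alpha> * of_int c / 2 * (xmul f x y + of_real x * (f x y + of_real x * partial_x f x y))) +
        of_real b * (- partial_x (partial_x f) x y) + of_real z * (\<alpha> * (f x y + of_real x * partial_x f x y)))
     (\<lambda>x y. of_real a * (- partial_y (partial_y f) x y + \<alpha> * of_int c / 2 * (of_real x * (of_real x * partial_y f x y))) +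
        of_real b * (- partial_x (partial_y f) x y) + of_real z * (\<alpha> * (of_real x * partial_y f x y)))" for a b z
    unfolding nab0_def prod.case ab \<alpha>_def[symmetric] comm[symmetric]
    unfolding comm
    by (rule partials_add[OF partials_add[OF partials_cmult[OF partials_add[OF partials_uminus[OF py]
          partials_cmult[OF partials_xmul[OF partials_xmul[OF p]]]]]
          partials_cmult[OF partials_uminus[OF px[unfolded comm]]]] partials_cmult[OF partials_cmult[OF partials_xmul[OF p]]]])
  have n: "nab0 (a, b, z) g x y = of_real a * (- partial_y g x y + \<alpha> * of_int c / 2 * (of_real x * (of_real x * g x y)))
     + of_real b * (- partial_x g x y) + of_real z * (\<alpha> * (of_real x * g x y))" for a b z g
    by (simp add: nab0_def ab \<alpha>_def xmul_def)
  have b: "bracket c (v1, v2, v3) (w1, w2, w3) = (0, 0, of_int c * (v1 * w2 - v2 * w1))"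
    by (simp add: bracket_def)
  show "curvature_op c nab0 (v1, v2, v3) (w1, w2, w3) f x y = - (of_real (v2 * w3 - v3 * w2) * (of_real pi * \<i> / of_real \<mu>)) * f x y"
    unfolding curvature_op_def b \<alpha>_def[symmetric] n[of _ _ _ "nab0 _ _"] partials_imp(2,3)[OF P]
    unfolding n xmul_def
    by (simp add: field_simps)
qed

end

subsection \<open>A frame of the bimodule\<close>

text \<open>These are x^(-n) times the classical smooth function exp (- 1 / x), extended by 0. The
  span of the family is closed under differentiation.\<close>

definition flat :: "nat \<Rightarrow> real \<Rightarrow> real"
  where "flat n x = (if 0 < x then inverse x ^ n * exp (- inverse x) else 0)"

lemma flat_tendsto_0: "(flat n \<longlongrightarrow> 0) (at 0)"
proof (rule filterlim_split_at)
  show "(flat n \<longlongrightarrow> 0) (at_left 0)"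
    by (rule tendsto_eventually) (auto simp: eventually_at_filter flat_def)
  have "((\<lambda>x. inverse x ^ n / exp (inverse x)) \<longlongrightarrow> 0) (at_right (0::real))"
    by (rule filterlim_compose[OF tendsto_power_div_exp_0 filterlim_inverse_at_top_right])
  then show "(flat n \<longlongrightarrow> 0) (at_right 0)"
    by (rule Lim_transform_eventually) (auto simp: eventually_at_filter flat_def exp_minus divide_inverse)
qed

text \<open>Away from 0 this is the product rule. At 0 the difference quotient is
  \<open>flat (n + 1)\<close>, which tends to 0.\<close>

lemma flat_derivative: "(flat n has_real_derivative flat (n + 2) x - real n * flat (n + 1) x) (at x)"
proof (cases x "0 :: real" rule: linorder_cases)
  case less
  have "((\<lambda>x. 0) has_real_derivative 0) (at x)" by simp
  then have "(flat n has_real_derivative 0) (at x)"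
    by (rule has_field_derivative_transform_within_open[of _ _ _ "{..<0}"]) (use less in \<open>auto simp: flat_def\<close>)
  then show ?thesis using less by (simp add: flat_def)
next
  case equal
  have "((\<lambda>h. (flat n (0 + h) - flat n 0) / h) \<longlongrightarrow> 0) (at 0)"
  proof (rule Lim_transform_eventually[OF flat_tendsto_0[of "n + 1"]])
    show "\<forall>\<^sub>F h in at 0. flat (n + 1) h = (flat n (0 + h) - flat n 0) / h"
      by (auto simp: eventually_at_filter flat_def divide_inverse)
  qed
  then show ?thesis unfolding DERIV_def equal by (simp add: flat_def)
next
  case greater
  have "((\<lambda>x. inverse x ^ n * exp (- inverse x)) has_real_derivative
      flat (n + 2) x - real n * flat (n + 1) x) (at x)"
  proof (cases n)
    case (Suc m)
    have i: "(inverse has_real_derivative - (inverse x ^ 2)) (at x)"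
      using DERIV_inverse[of x] greater by (simp add: numeral_2_eq_2)
    have "((\<lambda>x. exp (- inverse x)) has_real_derivative exp (- inverse x) * inverse x ^ 2) (at x)"
      using DERIV_chain2[OF DERIV_exp DERIV_minus[OF i]] by simp
    from DERIV_mult[OF DERIV_power[OF i, of n] this] show ?thesis
      using greater by (simp add: flat_def Suc algebra_simps power2_eq_square)
  qed (use greater in \<open>auto intro!: derivative_eq_intros simp: flat_def power2_eq_square algebra_simps\<close>)
  then show ?thesis
    by (rule has_field_derivative_transform_within_open[of _ _ _ "{0<..}"]) (use greater in \<open>auto simp: flat_def\<close>)
qed

lemma flat_zero: "x \<le> 0 \<Longrightarrow> flat n x = 0"
  by (simp add: flat_def)

definition bump :: "real \<Rightarrow> real \<Rightarrow> real"
  where "bump h x = flat 0 x * flat 0 (h - x)"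

lemma bump_zero: "x \<le> 0 \<or> h \<le> x \<Longrightarrow> bump h x = 0"
  by (auto simp: bump_def flat_def)

lemma bump_pos: "0 < x \<Longrightarrow> x < h \<Longrightarrow> 0 < bump h x"
  by (simp add: bump_def flat_def)

lemma continuous_flat: "continuous_on A (flat n)"
  by (rule DERIV_continuous_on) (rule has_field_derivative_at_within[OF flat_derivative])

lemma continuous_bump: "continuous_on A (bump h)"
proof -
  have "continuous_on A (\<lambda>x. flat 0 (h - x))"
    by (rule continuous_on_compose2[OF continuous_flat[of UNIV]]) (auto intro!: continuous_intros)
  then show ?thesis unfolding bump_def[abs_def] by (intro continuous_on_mult continuous_flat)
qed

text \<open>A smooth step: 0 to the left of 0 and constant to the right of h. The lower limit -1
  makes every point x \<ge> 0 interior to the interval of integration.\<close>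

definition step :: "real \<Rightarrow> real \<Rightarrow> real"
  where "step h x = integral {-1..x} (bump h)"

lemma step_zero: "x \<le> 0 \<Longrightarrow> step h x = 0"
proof -
  assume "x \<le> 0"
  then have "integral {-1..x} (bump h) = integral {-1..x} (\<lambda>x. 0)"
    by (intro integral_cong) (simp add: bump_zero)
  then show ?thesis by (simp add: step_def)
qed

lemma step_derivative: "(step h has_real_derivative bump h x) (at x)"
proof (cases "x < 0")
  case True
  have "((\<lambda>x. 0) has_real_derivative 0) (at x)" by simp
  then have "(step h has_real_derivative 0) (at x)"
    by (rule has_field_derivative_transform_within_open[of _ _ _ "{..<0}"]) (use True step_zero in auto)
  then show ?thesis using True by (simp add: bump_zero)
next
  case False
  have "((\<lambda>u. integral {-1..u} (bump h)) has_vector_derivative bump h x) (at x within {-1..x+1})"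
    by (rule integral_has_vector_derivative[OF continuous_bump]) (use False in auto)
  then have "((\<lambda>u. integral {-1..u} (bump h)) has_vector_derivative bump h x) (at x)"
    using False by (subst (asm) at_within_Icc_at) auto
  moreover have "(\<lambda>u. integral {-1..u} (bump h)) = step h" by (rule ext) (rule step_def[symmetric])
  ultimately show ?thesis unfolding has_real_derivative_iff_has_vector_derivative by (rule subst[rotated])
qed

definition step_total :: "real \<Rightarrow> real"
  where "step_total h = step h h"

lemma step_const: "h \<le> x \<Longrightarrow> step h x = step_total h"
  unfolding step_total_def
proof (rule ccontr)
  assume "h \<le> x" and ne: "step h x \<noteq> step h h"
  then have "h < x" by (metis order_le_less)
  then have "\<exists>z>h. z < x \<and> step h x - step h h = (x - h) * bump h z"
    by (rule MVT2) (rule step_derivative)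
  then obtain z where "h < z" "step h x - step h h = (x - h) * bump h z" by blast
  moreover have "bump h z = 0" using \<open>h < z\<close> by (simp add: bump_zero)
  ultimately have "step h x - step h h = 0" by simp
  then show False using ne by linarith
qed

lemma step_total_pos: "0 < h \<Longrightarrow> 0 < step_total h"
proof -
  assume h: "0 < h"
  then have "\<exists>z>0. z < h \<and> step h h - step h 0 = (h - 0) * bump h z"
    by (rule MVT2) (rule step_derivative)
  then obtain z where "0 < z" "z < h" "step h h - step h 0 = (h - 0) * bump h z" by blast
  then show ?thesis using h bump_pos[of z h] by (simp add: step_zero step_total_def)
qed

lemma lspan_x_power:
  assumes "f \<in> lspan {\<lambda>x y. u x | u. u \<in> U}"
  shows "(\<lambda>x y. of_real (x ^ n) * f x y) \<in> lspan {\<lambda>x y. of_real (x ^ n) * u x | n u. u \<in> U}"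
    (is "_ \<in> lspan ?S")
  using assms
proof induction
  case (base f) then show ?case by (auto intro!: lspan.base)
next
  case (add f g)
  from lspan.add[OF add.IH] show ?case by (simp add: distrib_left)
next
  case (scale f a)
  from lspan.scale[OF scale.IH, of a] show ?case by (simp add: mult.left_commute)
qed

text \<open>Compact support makes every product with a power of x bounded, so closure of the span of
  U under the derivative is the only remaining condition.\<close>

lemma Xi_compact_support:
  fixes U :: "(real \<Rightarrow> complex) set"
  assumes U: "\<And>u. u \<in> U \<Longrightarrow> (\<exists>M. \<forall>x. M < \<bar>x\<bar> \<longrightarrow> u x = 0) \<and>
      (\<exists>v. (\<forall>x. (u has_vector_derivative v x) (at x)) \<and> (\<lambda>x y. v x) \<in> lspan {\<lambda>x y. u x | u. u \<in> U})"
    and "u \<in> U"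
  shows "(\<lambda>x y. u x) \<in> Xi"
proof -
  define S :: "mfun set" where "S = {\<lambda>x y. of_real (x ^ n) * u x | n u. u \<in> U}"
  have "(\<lambda>x y. of_real (x ^ 0) * u x) \<in> S" using \<open>u \<in> U\<close> unfolding S_def by blast
  then have "(\<lambda>x y. u x) \<in> S" by simp
  then show ?thesis
  proof (rule Xi_coinduct[rotated])
    fix f assume "f \<in> S"
    then obtain n u where f: "f = (\<lambda>x y. of_real (x ^ n) * u x)" and u: "u \<in> U" by (auto simp: S_def)
    have mem: "(\<lambda>x y. of_real (x ^ n) * u x) \<in> lspan S" for n by (rule lspan.base) (use u in \<open>auto simp: S_def\<close>)
    obtain M v where M: "\<And>x. M < \<bar>x\<bar> \<Longrightarrow> u x = 0" and v: "\<And>x. (u has_vector_derivative v x) (at x)"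
      "(\<lambda>x y. v x) \<in> lspan {\<lambda>x y. u x | u. u \<in> U}" using U[OF u] by blast
    have d: "((\<lambda>x. of_real (x ^ n) * u x) has_vector_derivative
        of_nat n * (of_real (x ^ (n - 1)) * u x) + of_real (x ^ n) * v x) (at x)" for x
    proof -
      have "((\<lambda>x. of_real (x ^ n) :: complex) has_vector_derivative of_real (real n * x ^ (n - 1))) (at x)"
        by (rule has_vector_derivative_of_real) (auto intro!: derivative_eq_intros)
      from has_vector_derivative_mult[OF this v(1)] show ?thesis by (simp add: mult.assoc add.commute)
    qed
    have cont: "continuous_on A (\<lambda>x. of_real (x ^ n) * u x)" for A
      using d by (intro continuous_at_imp_continuous_on) (blast intro: has_vector_derivative_continuous)
    have "partials f (\<lambda>x y. of_nat n * (of_real (x ^ (n - 1)) * u x) + of_real (x ^ n) * v x) (\<lambda>x y. 0)"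
      unfolding f by (rule partials_x_only) (rule d)
    moreover have "(\<lambda>x y. of_nat n * (of_real (x ^ (n - 1)) * u x) + of_real (x ^ n) * v x) \<in> lspan S"
      using lspan_x_power[OF v(2), of n] by (intro lspan.add lspan.scale mem) (simp add: S_def)
    moreover have "(\<lambda>x y. 0) \<in> lspan S" using lspan.scale[OF mem[of 0], of 0] by simp
    moreover have "(\<lambda>x y. of_real x * f x y) \<in> lspan S" using mem[of "Suc n"] by (simp add: f mult.assoc)
    moreover have "continuous2 f"
      unfolding f case_prod_unfold
      by (rule continuous_on_compose2[OF cont[of UNIV]]) (auto intro!: continuous_intros)
    moreover have "periodic2 f" by (simp add: f)
    moreover have "bounded2 f"
    proof -
      have "compact ((\<lambda>x. of_real (x ^ n) * u x) ` {-\<bar>M\<bar>..\<bar>M\<bar>})" by (intro compact_continuous_image cont) simp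
      from compact_imp_bounded[OF this]
      obtain B where "\<forall>z \<in> (\<lambda>x. of_real (x ^ n) * u x) ` {-\<bar>M\<bar>..\<bar>M\<bar>}. norm z \<le> B" unfolding bounded_iff ..
      then have B: "norm (of_real (x ^ n) * u x) \<le> B" if "x \<in> {-\<bar>M\<bar>..\<bar>M\<bar>}" for x
        using that by (simp only: ball_simps(9))
      have "norm (f x y) \<le> max B 0" for x y
      proof (cases "x \<in> {-\<bar>M\<bar>..\<bar>M\<bar>}")
        case True then show ?thesis using B[OF True] by (simp add: f)
      next
        case False
        then have "M < \<bar>x\<bar>" by auto
        then show ?thesis using M by (simp add: f)
      qed
      then show ?thesis by blast
    qed
    ultimately show "schwartz_step (lspan S) f"
      by blast
  qed
qed

text \<open>The derivative of the difference is a combination of two bumps, and products of two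
  translated \<open>flat\<close> functions, one of them reflected, have a span closed under
  differentiation.\<close>

lemma Xi_step_difference:
  assumes h: "0 < h" "s \<le> t"
  shows "(\<lambda>x y. of_real ((step h (x - s) - step h (x - t)) / step_total h)) \<in> Xi"
proof -
  define F where "F m n r x = complex_of_real (flat m (x - r) * flat n (h - (x - r)))" for m n and r x :: real
  define u where "u x = complex_of_real ((step h (x - s) - step h (x - t)) / step_total h)" for x
  define U where "U = insert u {F m n r | m n r. True}"
  have F: "(\<lambda>x y. F m n r x) \<in> lspan {\<lambda>x y. u x | u. u \<in> U}" for m n r
    by (rule lspan.base) (auto simp: U_def)
  have "(\<lambda>x y. u x) \<in> Xi"
  proof (rule Xi_compact_support[of U])
    fix w assume "w \<in> U"
    then consider "w = u" | m n r where "w = F m n r" by (auto simp: U_def)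
    then show "(\<exists>M. \<forall>x. M < \<bar>x\<bar> \<longrightarrow> w x = 0) \<and>
      (\<exists>v. (\<forall>x. (w has_vector_derivative v x) (at x)) \<and> (\<lambda>x y. v x) \<in> lspan {\<lambda>x y. u x | u. u \<in> U})"
    proof cases
      case 1
      have "w x = 0" if "\<bar>s\<bar> + \<bar>t\<bar> + h < \<bar>x\<bar>" for x
      proof (cases "0 \<le> x")
        case True
        then have "h \<le> x - s" "h \<le> x - t" using that by auto
        then show ?thesis unfolding 1 u_def by (simp add: step_const)
      next
        case False
        then have "x - s \<le> 0" "x - t \<le> 0" using that h by auto
        then show ?thesis unfolding 1 u_def by (simp add: step_zero)
      qed
      moreover have "(w has_vector_derivative of_real ((bump h (x - s) - bump h (x - t)) / step_total h)) (at x)" for x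
      proof -
        have "((\<lambda>x. step h (x - r)) has_real_derivative bump h (x - r) * 1) (at x)" for r
          by (rule DERIV_chain2[OF step_derivative]) (auto intro!: derivative_eq_intros)
        then show ?thesis unfolding 1 u_def
          by (intro has_vector_derivative_of_real DERIV_cdivide DERIV_diff) simp_all
      qed
      moreover have "(\<lambda>x y. of_real ((bump h (x - s) - bump h (x - t)) / step_total h)) \<in> lspan {\<lambda>x y. u x | u. u \<in> U}"
      proof -
        have "(\<lambda>x y. of_real (1 / step_total h) * F 0 0 s x + of_real (- 1 / step_total h) * F 0 0 t x) \<in> lspan {\<lambda>x y. u x | u. u \<in> U}"
          by (intro lspan.add lspan.scale F)
        then show ?thesis by (simp add: F_def bump_def diff_divide_distrib)
      qed
      ultimately show ?thesis
        by (intro conjI exI[of _ "\<bar>s\<bar> + \<bar>t\<bar> + h"] exI[of _ "\<lambda>x. of_real ((bump h (x - s) - bump h (x - t)) / step_total h)"]) blast+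
    next
      case (2 m n r)
      have "w x = 0" if "\<bar>r\<bar> + h < \<bar>x\<bar>" for x
      proof -
        have "x - r \<le> 0 \<or> h - (x - r) \<le> 0" using that by linarith
        then show ?thesis unfolding 2 F_def by (auto simp: flat_zero)
      qed
      moreover have "(w has_vector_derivative (of_real (1::real) * F (m + 2) n r x + (of_real (- real m) * F (m + 1) n r x +
          (of_real (- 1::real) * F m (n + 2) r x + of_real (real n) * F m (n + 1) r x)))) (at x)" for x
      proof -
        have 1: "((\<lambda>x. flat m (x - r)) has_real_derivative (flat (m + 2) (x - r) - real m * flat (m + 1) (x - r)) * 1) (at x)"
          by (rule DERIV_chain2[OF flat_derivative]) (auto intro!: derivative_eq_intros)
        have 2: "((\<lambda>x. flat n (h - (x - r))) has_real_derivative
            (flat (n + 2) (h - (x - r)) - real n * flat (n + 1) (h - (x - r))) * (- 1)) (at x)"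
          by (rule DERIV_chain2[OF flat_derivative]) (auto intro!: derivative_eq_intros)
        show ?thesis unfolding \<open>w = F m n r\<close> F_def
          by (rule has_vector_derivative_eq_rhs[OF has_vector_derivative_of_real[OF DERIV_mult[OF 1 2]]])
            (simp add: algebra_simps)
      qed
      moreover have "(\<lambda>x y. of_real (1::real) * F (m + 2) n r x + (of_real (- real m) * F (m + 1) n r x +
          (of_real (- 1::real) * F m (n + 2) r x + of_real (real n) * F m (n + 1) r x))) \<in> lspan {\<lambda>x y. u x | u. u \<in> U}"
        by (intro lspan.add lspan.scale F)
      ultimately show ?thesis
        by (intro conjI exI[of _ "\<bar>r\<bar> + h"] exI[of _ "\<lambda>x. of_real (1::real) * F (m + 2) n r x + (of_real (- real m) * F (m + 1) n r x +
          (of_real (- 1::real) * F m (n + 2) r x + of_real (real n) * F m (n + 1) r x))"]) blast+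
    qed
  qed (simp add: U_def)
  then show ?thesis by (simp add: u_def)
qed

lemma infsum_finite_sum:
  fixes f :: "'a \<Rightarrow> 'b \<Rightarrow> complex"
  assumes "\<And>i. i \<in> I \<Longrightarrow> f i summable_on A"
  shows "(\<Sum>\<^sub>\<infinity>k\<in>A. \<Sum>i\<in>I. f i k) = (\<Sum>i\<in>I. \<Sum>\<^sub>\<infinity>k\<in>A. f i k)"
    and "(\<lambda>k. \<Sum>i\<in>I. f i k) summable_on A"
proof -
  have "(\<Sum>\<^sub>\<infinity>k\<in>A. \<Sum>i\<in>I. f i k) = (\<Sum>i\<in>I. \<Sum>\<^sub>\<infinity>k\<in>A. f i k) \<and> (\<lambda>k. \<Sum>i\<in>I. f i k) summable_on A"
    using assms
  proof (induction I rule: infinite_finite_induct)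
    case (insert i I)
    then show ?case by (auto simp: infsum_add intro: summable_on_add)
  qed auto
  then show "(\<Sum>\<^sub>\<infinity>k\<in>A. \<Sum>i\<in>I. f i k) = (\<Sum>i\<in>I. \<Sum>\<^sub>\<infinity>k\<in>A. f i k)" "(\<lambda>k. \<Sum>i\<in>I. f i k) summable_on A"
    by blast+
qed

lemma sum_telescope_int:
  fixes g :: "int \<Rightarrow> real"
  shows "(\<Sum>k\<in>{- int N..int N}. g k - g (k + 1)) = g (- int N) - g (int N + 1)"
proof (induction N)
  case (Suc N)
  have "{- int (Suc N)..int (Suc N)} = insert (- int (Suc N)) (insert (int (Suc N)) {- int N..int N})" by auto
  then show ?case using Suc by (simp add: add_ac)
qed simp

text \<open>A telescoping series: far to the left in k the translated step has its full height, far
  to the right it vanishes, so only finitely many terms are nonzero and their sum is the total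
  height.\<close>

lemma step_partition:
  assumes "0 < h" "0 < H"
  shows "((\<lambda>k::int. step h (x - of_int k * H) - step h (x - of_int k * H - H)) has_sum step_total h) UNIV"
proof -
  define g where "g k = step h (x - of_int k * H)" for k :: int
  obtain N :: nat where "(\<bar>x\<bar> + h) / H < real N" using reals_Archimedean2 by blast
  then have N: "\<bar>x\<bar> + h < real N * H" using assms(2) by (simp add: field_simps)
  have g1: "g (k + 1) = step h (x - of_int k * H - H)" for k by (simp add: g_def algebra_simps)
  have hi: "g k = step_total h" if "k \<le> - int N" for k
  proof -
    have "real N * H \<le> - of_int k * H" using that assms(2) by (intro mult_right_mono) linarith+
    then show ?thesis unfolding g_def using N by (intro step_const) linarith
  qed
  have lo: "g k = 0" if "int N \<le> k" for k
  proof -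
    have "real N * H \<le> of_int k * H" using that assms(2) by (intro mult_right_mono) linarith+
    then show ?thesis unfolding g_def using N assms by (intro step_zero) linarith
  qed
  have "((\<lambda>k. g k - g (k + 1)) has_sum (\<Sum>k\<in>{- int N..int N}. g k - g (k + 1))) UNIV"
  proof (rule has_sum_finite_neutralI)
    show "g k - g (k + 1) = 0" if "k \<in> UNIV - {- int N..int N}" for k
      using that hi[of k] hi[of "k + 1"] lo[of k] lo[of "k + 1"] by (cases "k \<le> 0") auto
  qed auto
  moreover have "(\<Sum>k\<in>{- int N..int N}. g k - g (k + 1)) = step_total h"
    unfolding sum_telescope_int using hi[of "- int N"] lo[of "int N + 1"] by simp
  ultimately show ?thesis unfolding g1 by (simp add: g_def)
qed

context heisenberg
begin

text \<open>The functions depend on \<open>x\<close> only. Their supports are shorter than 1, which kills the coefficients with \<open>p \<noteq> 0\<close>;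
  the coefficient at \<open>p = 0\<close> is a telescoping sum of translates of \<open>step\<close>.\<close>

lemma exists_frame:
  obtains n :: nat and \<xi> \<eta> :: "nat \<Rightarrow> mfun" where "\<And>i. \<xi> i \<in> Xi" "\<And>i. \<eta> i \<in> Xi"
    "(\<lambda>x y p. \<Sum>i<n. L (\<xi> i) (\<eta> i) x y p) = Id_E"
proof -
  \<comment> \<open>This n makes h at most 1/5. Below, \<phi> lives on [0, 2 h], \<psi> on
    [- h, 3 h] and \<psi> = 1 on the support of \<phi>; a product of \<phi> with an integer
    translate of \<psi> can be nonzero only if the translation is shorter than 3 h, hence is 0. The
    n translates by h fill one period 2 |\<mu>|.\<close>
  define n where "n = nat \<lceil>10 * \<bar>\<mu>\<bar>\<rceil>"
  have n: "10 * \<bar>\<mu>\<bar> \<le> real n" "0 < n" using mu by (auto simp: n_def)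
  define h where "h = 2 * \<bar>\<mu>\<bar> / real n"
  have h: "0 < h" "h \<le> 1 / 5" "real n * h = 2 * \<bar>\<mu>\<bar>" using n mu by (auto simp: h_def field_simps)
  define \<phi> where "\<phi> x = (step h (x - 0) - step h (x - h)) / step_total h" for x
  define \<psi> where "\<psi> x = (step h (x - (- h)) - step h (x - 2 * h)) / step_total h" for x
  define \<xi> where "\<xi> i = (\<lambda>x y::real. complex_of_real (\<phi> (x - real i * h)))" for i :: nat
  define \<eta> where "\<eta> i = (\<lambda>x y::real. complex_of_real (\<psi> (x - real i * h)))" for i :: nat
  have C: "0 < step_total h" by (rule step_total_pos[OF h(1)])
  have \<phi>0: "\<phi> x = 0" if "x \<le> 0 \<or> 2 * h \<le> x" for x
    using that h(1) by (auto simp: \<phi>_def step_zero step_const)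
  have \<psi>0: "\<psi> x = 0" if "x \<le> - h \<or> 3 * h \<le> x" for x
    using that h(1) by (auto simp: \<psi>_def step_zero step_const)
  have \<psi>1: "\<psi> x = 1" if "0 \<le> x" "x \<le> 2 * h" for x
    using that C by (simp add: \<psi>_def step_zero step_const)
  have \<phi>\<psi>: "\<phi> t * \<psi> (t + of_int p) = (if p = 0 then \<phi> t else 0)" for t and p :: int
  proof (cases "p = 0")
    case True then show ?thesis using \<phi>0[of t] \<psi>1[of t] by (cases "0 \<le> t \<and> t \<le> 2 * h") auto
  next
    case False
    then have "of_int p \<le> (- 1 :: real) \<or> (1 :: real) \<le> of_int p" by linarith
    then have "t \<le> 0 \<or> 2 * h \<le> t \<or> t + of_int p \<le> - h \<or> 3 * h \<le> t + of_int p" using h(2) by linarith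
    then show ?thesis using \<phi>0[of t] \<psi>0[of "t + of_int p"] False by auto
  qed
  have Xi: "\<xi> i \<in> Xi" "\<eta> i \<in> Xi" for i
  proof -
    have "(\<lambda>x y. complex_of_real (\<phi> x)) \<in> Xi" "(\<lambda>x y. complex_of_real (\<psi> x)) \<in> Xi"
      unfolding \<phi>_def \<psi>_def using h(1) by (intro Xi_step_difference; simp)+
    from this[THEN Xi_shift, of "- real i * h"] show "\<xi> i \<in> Xi" "\<eta> i \<in> Xi"
      by (simp_all add: \<xi>_def \<eta>_def)
  qed
  have L_term: "L_term (\<xi> i) (\<eta> i) p k x y = (if p = 0 then of_real (\<phi> (x - 2 * of_int k * \<mu> - real i * h)) else 0)" for i p k x y
  proof -
    have "L_term (\<xi> i) (\<eta> i) p k x y = ee (of_int (c * p * k) * (y - of_int k * \<nu>)) *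
        of_real (\<phi> (x - 2 * of_int k * \<mu> - real i * h) * \<psi> (x - 2 * of_int k * \<mu> - real i * h + of_int p))"
      by (simp add: L_term_def \<xi>_def \<eta>_def diff_add_eq)
    then show ?thesis unfolding \<phi>\<psi> by simp
  qed
  have "(\<Sum>i<n. L (\<xi> i) (\<eta> i) x y p) = Id_E x y p" for x y p
  proof (cases "p = 0")
    case False then show ?thesis by (simp add: inner_L_eq_sum L_term Id_E_def)
  next
    case True
    have tele: "(\<Sum>i<n. \<phi> (z - real i * h)) = (step h z - step h (z - 2 * \<bar>\<mu>\<bar>)) / step_total h" for z
    proof -
      have "(\<Sum>i<m. \<phi> (z - real i * h)) = (step h z - step h (z - real m * h)) / step_total h" for m
        by (induction m) (simp_all add: \<phi>_def diff_divide_distrib algebra_simps)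
      then show ?thesis by (simp add: h(3))
    qed
    have "(\<Sum>i<n. L (\<xi> i) (\<eta> i) x y p) = (\<Sum>\<^sub>\<infinity>k. \<Sum>i<n. L_term (\<xi> i) (\<eta> i) p k x y)"
      unfolding inner_L_eq_sum by (intro infsum_finite_sum(1)[symmetric] loc_summableD L_term_loc_summable Xi)
    also have "\<dots> = (\<Sum>\<^sub>\<infinity>k::int. of_real ((step h (x - 2 * of_int k * \<mu>) - step h (x - 2 * of_int k * \<mu> - 2 * \<bar>\<mu>\<bar>)) / step_total h))"
      by (simp add: L_term True tele flip: of_real_sum)
    also have "\<dots> = (\<Sum>\<^sub>\<infinity>k::int. of_real ((step h (x - of_int k * (2 * \<bar>\<mu>\<bar>)) - step h (x - of_int k * (2 * \<bar>\<mu>\<bar>) - 2 * \<bar>\<mu>\<bar>)) / step_total h))"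
    proof (cases "0 < \<mu>")
      case True then show ?thesis by (simp add: mult_ac)
    next
      case False
      then show ?thesis
        by (subst infsum_reindex_bij_betw[OF bij_uminus, symmetric]) (simp add: mult_ac)
    qed
    also have "\<dots> = 1"
    proof (rule infsumI)
      have "((\<lambda>k::int. (step h (x - of_int k * (2 * \<bar>\<mu>\<bar>)) - step h (x - of_int k * (2 * \<bar>\<mu>\<bar>) - 2 * \<bar>\<mu>\<bar>)) / step_total h)
          has_sum (step_total h / step_total h)) UNIV"
        by (intro has_sum_divide_const step_partition h(1)) (use mu in simp)
      then have "((\<lambda>k::int. (step h (x - of_int k * (2 * \<bar>\<mu>\<bar>)) - step h (x - of_int k * (2 * \<bar>\<mu>\<bar>) - 2 * \<bar>\<mu>\<bar>)) / step_total h)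
          has_sum 1) UNIV"
        using C by (simp only: divide_self_if less_irrefl if_False split: if_splits)
      from has_sum_of_real[OF this, where 'a = complex] show "((\<lambda>k::int. complex_of_real
          ((step h (x - of_int k * (2 * \<bar>\<mu>\<bar>)) - step h (x - of_int k * (2 * \<bar>\<mu>\<bar>) - 2 * \<bar>\<mu>\<bar>)) / step_total h)) has_sum 1) UNIV"
        by (simp only: of_real_1)
    qed
    finally show ?thesis using True by (simp add: Id_E_def)
  qed
  then have "(\<lambda>x y p. \<Sum>i<n. L (\<xi> i) (\<eta> i) x y p) = Id_E" by (intro ext)
  with Xi show thesis by (rule that)
qed

end

subsection \<open>The trace\<close>

lemma integral_infsum:
  fixes f :: "'i \<Rightarrow> real \<Rightarrow> complex"
  assumes c: "\<And>i. continuous_on {a..b} (f i)" and M: "M summable_on UNIV" "\<And>i x. x \<in> {a..b} \<Longrightarrow> norm (f i x) \<le> M i"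
  shows "((\<lambda>i. integral {a..b} (f i)) has_sum integral {a..b} (\<lambda>x. \<Sum>\<^sub>\<infinity>i. f i x)) UNIV"
proof -
  have "uniform_limit (cbox a b) (\<lambda>X x. \<Sum>i\<in>X. f i x) (\<lambda>x. \<Sum>\<^sub>\<infinity>i. f i x) (finite_subsets_at_top UNIV)"
    by (rule Weierstrass_m_test_general[OF _ M(1)]) (use M(2) in auto)
  moreover have "continuous_on (cbox a b) (\<lambda>x. \<Sum>i\<in>X. f i x)" for X
    using c by (intro continuous_on_sum) simp
  ultimately show ?thesis
  proof (rule uniform_limit_integral_cbox)
    fix I J assume I: "\<And>X. ((\<lambda>x. \<Sum>i\<in>X. f i x) has_integral I X) (cbox a b)"
      and J: "((\<lambda>x. \<Sum>\<^sub>\<infinity>i. f i x) has_integral J) (cbox a b)" and IJ: "(I \<longlongrightarrow> J) (finite_subsets_at_top UNIV)"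
    have "I X = (\<Sum>i\<in>X. integral {a..b} (f i))" for X
    proof (cases "finite X")
      case True
      have "integral {a..b} (\<lambda>x. \<Sum>i\<in>X. f i x) = (\<Sum>i\<in>X. integral {a..b} (f i))"
        using True c by (intro integral_sum integrable_continuous_interval) auto
      then show ?thesis using integral_unique[OF I[of X]] by simp
    next
      case False then show ?thesis using integral_unique[OF I[of X]] by simp
    qed
    then have "I = sum (\<lambda>i. integral {a..b} (f i))" by (intro ext) simp
    then show "((\<lambda>i. integral {a..b} (f i)) has_sum integral {a..b} (\<lambda>x. \<Sum>\<^sub>\<infinity>i. f i x)) UNIV"
      using IJ integral_unique[OF J] unfolding has_sum_def by simp
  qed simp
qed

text \<open>Unfolding: the integral of a periodization over one period is the integral over the
  whole line, obtained as a limit over symmetric intervals.\<close>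

lemma integral_line_sum:
  fixes \<phi> :: "real \<Rightarrow> complex"
  assumes c: "continuous_on UNIV \<phi>" and b: "\<And>x. norm (\<phi> x) \<le> C / wt x" and h: "0 < h"
  shows "(\<lambda>N. integral {- (real N * h)..real N * h} \<phi>) \<longlonglongrightarrow> integral {0..h} (\<lambda>x. \<Sum>\<^sub>\<infinity>k::int. \<phi> (x + of_int k * h))"
proof -
  have int: "\<phi> integrable_on {a..b}" for a b by (intro integrable_continuous_interval continuous_on_subset[OF c]) simp
  have "loc_summable (\<lambda>(k::int) x (y::real). \<phi> (x + of_int k * h))"
    by (rule loc_summable_wt[of h]) (use h b in auto)
  then obtain M where M: "M summable_on (UNIV :: int set)"
      "\<And>k x (y::real). \<bar>x\<bar> \<le> h \<Longrightarrow> norm (\<phi> (x + of_int k * h)) \<le> M k"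
    unfolding loc_summable_def by metis
  have "((\<lambda>k::int. integral {0..h} (\<lambda>x. \<phi> (x + of_int k * h))) has_sum
      integral {0..h} (\<lambda>x. \<Sum>\<^sub>\<infinity>k::int. \<phi> (x + of_int k * h))) UNIV"
  proof (rule integral_infsum[OF _ M(1)])
    show "continuous_on {0..h} (\<lambda>x. \<phi> (x + of_int k * h))" for k :: int
      by (rule continuous_on_compose2[OF c]) (auto intro!: continuous_intros)
  qed (use M(2) in auto)
  moreover have "integral {0..h} (\<lambda>x. \<phi> (x + of_int k * h)) = integral {of_int k * h..of_int (k + 1) * h} \<phi>" for k :: int
    using integral_shift_real_ivl[of "of_int k * h" "of_int k * h" "of_int (k + 1) * h" \<phi>]
    by (simp add: algebra_simps)
  ultimately have "(sum (\<lambda>k::int. integral {of_int k * h..of_int (k + 1) * h} \<phi>) \<longlongrightarrow>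
      integral {0..h} (\<lambda>x. \<Sum>\<^sub>\<infinity>k::int. \<phi> (x + of_int k * h))) (finite_subsets_at_top UNIV)"
    by (simp add: has_sum_def)
  \<comment> \<open>Unordered summation is evaluated along half-open index ranges, whose 2 N cells
    of length h tile [- N h, N h] exactly.\<close>
  moreover have "filterlim (\<lambda>N. {- int N..<int N}) (finite_subsets_at_top UNIV) sequentially"
    unfolding filterlim_finite_subsets_at_top
  proof (intro allI impI)
    fix X :: "int set" assume "finite X \<and> X \<subseteq> UNIV"
    then obtain m where m: "\<And>k. k \<in> X \<Longrightarrow> \<bar>k\<bar> \<le> m"
      using finite_imageI[of X abs] bdd_above_finite[of "abs ` X"] by (auto simp: bdd_above_def)
    show "\<forall>\<^sub>F N in sequentially. finite {- int N..<int N} \<and> X \<subseteq> {- int N..<int N} \<and> {- int N..<int N} \<subseteq> UNIV"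
      using eventually_gt_at_top[of "nat m"]
      by eventually_elim (use m in force)
  qed
  ultimately have "(\<lambda>N. \<Sum>k\<in>{- int N..<int N}. integral {of_int k * h..of_int (k + 1) * h} \<phi>) \<longlonglongrightarrow>
      integral {0..h} (\<lambda>x. \<Sum>\<^sub>\<infinity>k::int. \<phi> (x + of_int k * h))"
    by (rule filterlim_compose)
  moreover have "(\<Sum>k\<in>{- int N..<int N}. integral {of_int k * h..of_int (k + 1) * h} \<phi>) = integral {- (real N * h)..real N * h} \<phi>" for N
  proof (induction N)
    case (Suc N)
    have s: "{- int (Suc N)..<int (Suc N)} = insert (- int (Suc N)) (insert (int N) {- int N..<int N})" by auto
    let ?a = "real N * h" and ?b = "real (Suc N) * h"
    have ab: "- ?b \<le> - ?a" "- ?a \<le> ?a" "?a \<le> ?b" using h by (auto simp: algebra_simps)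
    have "integral {- ?b..- ?a} \<phi> + integral {- ?a..?b} \<phi> = integral {- ?b..?b} \<phi>"
      using ab by (intro Henstock_Kurzweil_Integration.integral_combine int) auto
    moreover have "integral {- ?a..?a} \<phi> + integral {?a..?b} \<phi> = integral {- ?a..?b} \<phi>"
      using ab by (intro Henstock_Kurzweil_Integration.integral_combine int) auto
    moreover have "of_int (- int (Suc N)) * h = - ?b" "of_int (- int (Suc N) + 1) * h = - ?a"
      "of_int (int N) * h = ?a" "of_int (int N + 1) * h = ?b" by (simp_all add: algebra_simps)
    moreover define f where "f k = integral {of_int k * h..of_int (k + 1) * h} \<phi>" for k :: int
    ultimately have "f (- int (Suc N)) + (f (int N) + integral {- ?a..?a} \<phi>) = integral {- ?b..?b} \<phi>"
      by (simp only: f_def) (simp only: add_ac)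
    moreover have "(\<Sum>k\<in>{- int (Suc N)..<int (Suc N)}. f k) = f (- int (Suc N)) + (f (int N) + (\<Sum>k\<in>{- int N..<int N}. f k))"
      unfolding s by simp
    ultimately show ?case using Suc by (simp only: f_def)
  qed simp
  ultimately show ?thesis by simp
qed

text \<open>Both sides are the integral over the line. The interval [- N h, N h] and the one with
  integer end points, m = floor of N h, differ by two pieces of length at most 1 on which \<phi> is
  at most C / wt m. This comparison of two periods is what matches the traces of the two
  algebras.\<close>

lemma integral_line_sum_eq:
  fixes \<phi> :: "real \<Rightarrow> complex"
  assumes c: "continuous_on UNIV \<phi>" and b: "\<And>x. norm (\<phi> x) \<le> C / wt x" and h: "0 < h"
  shows "integral {0..h} (\<lambda>x. \<Sum>\<^sub>\<infinity>k::int. \<phi> (x + of_int k * h)) = integral {0..1} (\<lambda>x. \<Sum>\<^sub>\<infinity>k::int. \<phi> (x + of_int k))"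
    (is "?J = ?J1")
proof -
  have int: "\<phi> integrable_on {a..b}" for a b by (intro integrable_continuous_interval continuous_on_subset[OF c]) simp
  define m where "m N = nat \<lfloor>real N * h\<rfloor>" for N
  have m: "real (m N) \<le> real N * h" "real N * h \<le> real (m N) + 1" for N
    using h by (auto simp: m_def of_nat_nat intro: less_imp_le floor_le_iff)
  have lim_m: "filterlim m at_top sequentially"
  proof -
    have "filterlim (\<lambda>N. real N * h) at_top sequentially"
      by (rule filterlim_at_top_mult_tendsto_pos[OF tendsto_const h filterlim_real_sequentially])
    then have "filterlim (\<lambda>N. nat \<lfloor>real N * h\<rfloor>) at_top sequentially"
      by (rule filterlim_compose[OF filterlim_nat_sequentially filterlim_compose[OF filterlim_floor_sequentially]])
    then show ?thesis by (simp add: m_def[abs_def])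
  qed
  have C0: "0 \<le> C" using order.trans[OF norm_ge_zero b[of 0]] by (simp add: wt_def)
  have part: "norm (integral {u..v} \<phi>) \<le> C / wt (real (m N))"
    if "u \<le> v" "v - u \<le> 1" "\<And>x. x \<in> {u..v} \<Longrightarrow> real (m N) \<le> \<bar>x\<bar>" for u v N
  proof -
    have "norm (integral {u..v} \<phi>) \<le> C / wt (real (m N)) * (v - u)"
    proof (rule integral_bound[OF that(1)])
      show "continuous_on {u..v} \<phi>" by (rule continuous_on_subset[OF c]) simp
      show "norm (\<phi> x) \<le> C / wt (real (m N))" if "x \<in> {u..v}" for x
      proof -
        have "wt (real (m N)) \<le> wt x" using \<open>\<And>x. x \<in> {u..v} \<Longrightarrow> real (m N) \<le> \<bar>x\<bar>\<close>[OF that]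
          by (simp add: wt_def abs_le_square_iff[symmetric])
        then have "C / wt x \<le> C / wt (real (m N))" using C0 by (intro divide_left_mono mult_pos_pos) simp_all
        then show ?thesis using b[of x] by linarith
      qed
    qed
    also have "\<dots> \<le> C / wt (real (m N)) * 1" using that(2) C0 by (intro mult_left_mono) simp_all
    finally show ?thesis by simp
  qed
  have diff: "norm (integral {- (real N * h)..real N * h} \<phi> - integral {- real (m N)..real (m N)} \<phi>) \<le> 2 * C / wt (real (m N))" for N
  proof -
    let ?a = "real (m N)" and ?b = "real N * h"
    have 1: "integral {- ?b..- ?a} \<phi> + integral {- ?a..?b} \<phi> = integral {- ?b..?b} \<phi>"
      using m[of N] by (intro Henstock_Kurzweil_Integration.integral_combine int) linarith+
    have 2: "integral {- ?a..?a} \<phi> + integral {?a..?b} \<phi> = integral {- ?a..?b} \<phi>"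
      using m[of N] by (intro Henstock_Kurzweil_Integration.integral_combine int) linarith+
    have 3: "integral {- ?b..?b} \<phi> - integral {- ?a..?a} \<phi> = integral {- ?b..- ?a} \<phi> + integral {?a..?b} \<phi>"
      unfolding 1[symmetric] 2[symmetric] by simp
    have "norm (integral {- ?b..- ?a} \<phi> + integral {?a..?b} \<phi>) \<le> C / wt ?a + C / wt ?a"
      using m[of N] by (intro norm_add_rule_thm part) auto
    then show ?thesis unfolding 3 by simp
  qed
  have "(\<lambda>n. 2 * C / wt (real n)) \<longlonglongrightarrow> 0"
    using summable_LIMSEQ_zero[OF summable_mult[OF summable_inverse_wt_nat, of "2 * C"]] by simp
  then have "(\<lambda>N. 2 * C / wt (real (m N))) \<longlonglongrightarrow> 0" by (rule filterlim_compose[OF _ lim_m])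
  then have "(\<lambda>N. integral {- (real N * h)..real N * h} \<phi> - integral {- real (m N)..real (m N)} \<phi>) \<longlonglongrightarrow> 0"
    by (rule Lim_null_comparison[rotated]) (use diff in simp)
  moreover have "(\<lambda>N. integral {- real (m N)..real (m N)} \<phi>) \<longlonglongrightarrow> ?J1"
    using filterlim_compose[OF integral_line_sum[OF c b, of 1] lim_m] by simp
  ultimately have "(\<lambda>N. integral {- (real N * h)..real N * h} \<phi>) \<longlonglongrightarrow> 0 + ?J1"
    using tendsto_add by fastforce
  then show ?thesis using integral_line_sum[OF c b h] LIMSEQ_unique by force
qed

lemma integral_periodic_shift:
  fixes g :: "real \<Rightarrow> complex"
  assumes c: "continuous_on UNIV g" and p: "\<And>y. g (y + 1) = g y"
  shows "integral {0..1} (\<lambda>y. g (y + s)) = integral {0..1} g"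
proof -
  have int: "g integrable_on {a..b}" for a b by (intro integrable_continuous_interval continuous_on_subset[OF c]) simp
  have per: "g (y + of_int n) = g y" for y n
  proof (induction n rule: int_induct[where k = 0])
    case (step1 i) then show ?case using p[of "y + of_int i"] by (simp add: add_ac)
  next
    case (step2 i) then show ?case using p[of "y + of_int (i - 1)"] by (simp add: add_ac)
  qed simp
  have sh: "integral {a + of_int n..b + of_int n} g = integral {a..b} g" for a b n
    using integral_shift_real_ivl[of "a + of_int n" "of_int n" "b + of_int n" g] by (simp add: per)
  define n where "n = \<lfloor>s\<rfloor>"
  have n: "of_int n \<le> s" "s \<le> of_int n + 1" unfolding n_def by linarith+
  have "integral {0..1} (\<lambda>y. g (y + s)) = integral {s..s + 1} g"
    using integral_shift_real_ivl[of s s "s + 1" g] by simp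
  also have "\<dots> = integral {s..of_int n + 1} g + integral {of_int n + 1..s + 1} g"
    using n by (intro Henstock_Kurzweil_Integration.integral_combine[symmetric] int) auto
  also have "integral {of_int n + 1..s + 1} g = integral {of_int n..s} g"
    using sh[of "of_int n" 1 s] by simp
  also have "integral {s..of_int n + 1} g + integral {of_int n..s} g = integral {of_int n..of_int n + 1} g"
    using n Henstock_Kurzweil_Integration.integral_combine[of "of_int n" s "of_int n + 1" g] int by (simp add: add.commute)
  also have "\<dots> = integral {0..1} g" using sh[of 0 n 1] by (simp add: add.commute)
  finally show ?thesis .
qed

text \<open>The width a is 1 for the trace on D and 2 |\<mu>| for the trace on E.\<close>

definition I2 :: "real \<Rightarrow> mfun \<Rightarrow> complex"
  where "I2 a u = integral {0..a} (\<lambda>x. integral {0..1} (u x))"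

lemma continuous_inner_integral:
  "continuous2 u \<Longrightarrow> continuous_on A (\<lambda>x. integral {0..1} (u x))"
proof -
  assume u: "continuous2 u"
  have "continuous_on UNIV (\<lambda>x. integral (cbox 0 1) (u x))"
    by (rule integral_continuous_on_param) (rule continuous_on_subset[OF u], simp)
  then show ?thesis by (auto intro: continuous_on_subset)
qed

lemma I2_add: "continuous2 u \<Longrightarrow> continuous2 v \<Longrightarrow> I2 a (\<lambda>x y. u x y + v x y) = I2 a u + I2 a v"
  unfolding I2_def
  by (simp add: integral_add integrable_continuous_interval continuous2_y continuous_inner_integral)

lemma I2_cmult: "I2 a (\<lambda>x y. z * u x y) = z * I2 a u"
  unfolding I2_def by simp

lemma continuous2_cmult: "continuous2 u \<Longrightarrow> continuous2 (\<lambda>x y. z * u x y)"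
  unfolding case_prod_unfold by (rule continuous_on_mult_left)

lemma continuous2_sum: "(\<And>i. i \<in> I \<Longrightarrow> continuous2 (u i)) \<Longrightarrow> continuous2 (\<lambda>x y. \<Sum>i\<in>I. u i x y)"
  unfolding case_prod_unfold by (rule continuous_on_sum)

lemma I2_sum: "(\<And>i. i \<in> I \<Longrightarrow> continuous2 (u i)) \<Longrightarrow> I2 a (\<lambda>x y. \<Sum>i\<in>I. u i x y) = (\<Sum>i\<in>I. I2 a (u i))"
proof (induction I rule: infinite_finite_induct)
  case (insert i I)
  then show ?case by (simp add: I2_add continuous2_sum)
qed (simp_all add: I2_def)

lemma tau_D_I2: "tau_D \<Phi> = I2 1 (\<lambda>x y. \<Phi> x y 0)"
  by (simp add: tau_D_def I2_def)

text \<open>Integrating over a full period in y removes the shifts k s, which leaves the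
  one-dimensional statement for the integral of F over y.\<close>

lemma I2_periodization:
  assumes F: "F \<in> Xi" and h: "h \<noteq> 0"
  shows "I2 \<bar>h\<bar> (\<lambda>x y. \<Sum>\<^sub>\<infinity>k::int. F (x + of_int k * h) (y + of_int k * s)) = I2 1 (\<lambda>x y. \<Sum>\<^sub>\<infinity>k::int. F (x + of_int k) y)"
proof -
  define \<phi> where "\<phi> x = integral {0..1} (F x)" for x
  obtain C where C: "0 \<le> C" "\<And>x y. norm (F x y) \<le> C / wt x ^ 1" using Xi_decay[OF F] by blast
  have c\<phi>: "continuous_on UNIV \<phi>" unfolding \<phi>_def by (rule continuous_inner_integral[OF Xi_continuous[OF F]])
  have b\<phi>: "norm (\<phi> x) \<le> C / wt x" for x
    unfolding \<phi>_def using integral_bound[of 0 1 "F x" "C / wt x"] C(2) continuous2_y[OF Xi_continuous[OF F]] by simp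
  have inner: "integral {0..1} (\<lambda>y. \<Sum>\<^sub>\<infinity>k::int. F (x + of_int k * a) (y + of_int k * s)) = (\<Sum>\<^sub>\<infinity>k::int. \<phi> (x + of_int k * a))"
    if a: "a \<noteq> 0" for x a s
  proof -
    have "loc_summable (\<lambda>(k::int) x y. F (x + of_int k * a) (y + of_int k * s))"
      by (rule loc_summable_wt[OF a]) (use C(2) in auto)
    then obtain M where M: "M summable_on (UNIV :: int set)"
        "\<And>k u v. \<bar>u\<bar> \<le> \<bar>x\<bar> \<Longrightarrow> norm (F (u + of_int k * a) (v + of_int k * s)) \<le> M k"
      unfolding loc_summable_def by metis
    have "((\<lambda>k::int. integral {0..1} (\<lambda>y. F (x + of_int k * a) (y + of_int k * s))) has_sum
        integral {0..1} (\<lambda>y. \<Sum>\<^sub>\<infinity>k::int. F (x + of_int k * a) (y + of_int k * s))) UNIV"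
    proof (rule integral_infsum[OF _ M(1)])
      show "continuous_on {0..1} (\<lambda>y. F (x + of_int k * a) (y + of_int k * s))" for k :: int
        by (rule continuous2_y[OF continuous2_cong_shift[OF Xi_continuous[OF F]]])
    qed (use M(2) in auto)
    moreover have "integral {0..1} (\<lambda>y. F (x + of_int k * a) (y + of_int k * s)) = \<phi> (x + of_int k * a)" for k :: int
      unfolding \<phi>_def
      by (rule integral_periodic_shift) (auto intro: continuous2_y Xi_continuous Xi_periodic F)
    ultimately show ?thesis by (simp add: infsumI)
  qed
  have "I2 \<bar>h\<bar> (\<lambda>x y. \<Sum>\<^sub>\<infinity>k::int. F (x + of_int k * h) (y + of_int k * s)) = integral {0..\<bar>h\<bar>} (\<lambda>x. \<Sum>\<^sub>\<infinity>k::int. \<phi> (x + of_int k * h))"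
    unfolding I2_def inner[OF h] ..
  also have "(\<lambda>x. \<Sum>\<^sub>\<infinity>k::int. \<phi> (x + of_int k * h)) = (\<lambda>x. \<Sum>\<^sub>\<infinity>k::int. \<phi> (x + of_int k * \<bar>h\<bar>))"
  proof (cases "0 < h")
    case False
    show ?thesis
    proof
      fix x
      show "(\<Sum>\<^sub>\<infinity>k::int. \<phi> (x + of_int k * h)) = (\<Sum>\<^sub>\<infinity>k::int. \<phi> (x + of_int k * \<bar>h\<bar>))"
        using infsum_reindex_bij_betw[OF bij_uminus, of "\<lambda>k::int. \<phi> (x + of_int k * h)"] False by simp
    qed
  qed simp
  also have "integral {0..\<bar>h\<bar>} \<dots> = integral {0..1} (\<lambda>x. \<Sum>\<^sub>\<infinity>k::int. \<phi> (x + of_int k))"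
    by (rule integral_line_sum_eq[OF c\<phi> b\<phi>]) (use h in simp)
  also have "\<dots> = I2 1 (\<lambda>x y. \<Sum>\<^sub>\<infinity>k::int. F (x + of_int k) y)"
    unfolding I2_def using inner[of 1 _ 0] by simp
  finally show ?thesis .
qed

context heisenberg
begin

text \<open>At p = 0 the phases are 1, and both inner products are periodizations of the same
  function g times the conjugate of f: along integer translations in x for \<open>R\<close>, along
  multiples of (-2 \<mu>, -2 \<nu>) for \<open>L\<close>.\<close>

lemma tau_D_inner_R:
  assumes "f \<in> Xi" "g \<in> Xi"
  shows "tau_D (R g f) = I2 \<bar>- 2 * \<mu>\<bar> (\<lambda>x y. L f g x y 0)"
proof -
  define F where "F = (\<lambda>x y. g x y * cnj (f x y))"
  have F: "F \<in> Xi" unfolding F_def by (intro Xi_mult Xi_cnj assms)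
  have "L f g x y 0 = (\<Sum>\<^sub>\<infinity>k::int. F (x + of_int k * (- 2 * \<mu>)) (y + of_int k * (- 2 * \<nu>)))" for x y
    by (simp add: inner_L_def F_def mult_ac)
  moreover have "R g f x y 0 = (\<Sum>\<^sub>\<infinity>k::int. F (x + of_int k) y)" for x y
    by (simp add: inner_R_def F_def)
  ultimately show ?thesis unfolding tau_D_I2 by (simp only: I2_periodization[OF F two_mu])
qed

text \<open>The definite description in \<open>tau_E\<close> has a unique solution because every
  representation of \<Psi> by inner products yields the integral of \<Psi> at p = 0, which depends
  on \<Psi> alone.\<close>

lemma tau_E_eqI:
  assumes "\<And>i. i < n \<Longrightarrow> \<xi> i \<in> Xi" "\<And>i. i < n \<Longrightarrow> \<eta> i \<in> Xi"
    and "\<Psi> = (\<lambda>x y p. \<Sum>i<n. L (\<xi> i) (\<eta> i) x y p)"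
  shows "tau_E c \<mu> \<nu> \<Psi> = (\<Sum>i<(n::nat). tau_D (R (\<eta> i) (\<xi> i)))" "tau_E c \<mu> \<nu> \<Psi> = I2 \<bar>- 2 * \<mu>\<bar> (\<lambda>x y. \<Psi> x y 0)"
proof -
  have val: "(\<Sum>i<(n::nat). tau_D (R (\<eta> i) (\<xi> i))) = I2 \<bar>- 2 * \<mu>\<bar> (\<lambda>x y. \<Psi> x y 0)"
    if "\<And>i. i < n \<Longrightarrow> \<xi> i \<in> Xi" "\<And>i. i < n \<Longrightarrow> \<eta> i \<in> Xi"
      "\<Psi> = (\<lambda>x y p. \<Sum>i<n. L (\<xi> i) (\<eta> i) x y p)" for n \<xi> \<eta>
    unfolding that(3) using that(1,2) by (subst I2_sum) (auto simp: tau_D_inner_R intro: inner_L_continuous)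
  show 1: "tau_E c \<mu> \<nu> \<Psi> = (\<Sum>i<n. tau_D (R (\<eta> i) (\<xi> i)))"
    unfolding tau_E_def
  proof (rule the_equality)
    show "\<exists>(n'::nat) \<xi>' \<eta>'. (\<forall>i<n'. \<xi>' i \<in> Xi \<and> \<eta>' i \<in> Xi) \<and> \<Psi> = (\<lambda>x y p. \<Sum>i<n'. L (\<xi>' i) (\<eta>' i) x y p) \<and>
        (\<Sum>i<n. tau_D (R (\<eta> i) (\<xi> i))) = (\<Sum>i<n'. tau_D (R (\<eta>' i) (\<xi>' i)))"
      by (rule exI[of _ n], rule exI[of _ \<xi>], rule exI[of _ \<eta>]) (intro conjI allI impI assms refl)
  next
    fix t assume "\<exists>(n::nat) \<xi> \<eta>. (\<forall>i<n. \<xi> i \<in> Xi \<and> \<eta> i \<in> Xi) \<and> \<Psi> = (\<lambda>x y p. \<Sum>i<n. L (\<xi> i) (\<eta> i) x y p) \<and>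
        t = (\<Sum>i<n. tau_D (R (\<eta> i) (\<xi> i)))"
    then obtain n' :: nat and \<xi>' \<eta>' where i: "\<forall>i<n'. \<xi>' i \<in> Xi \<and> \<eta>' i \<in> Xi"
      and \<Psi>: "\<Psi> = (\<lambda>x y p. \<Sum>i<n'. L (\<xi>' i) (\<eta>' i) x y p)"
      and t: "t = (\<Sum>i<n'. tau_D (R (\<eta>' i) (\<xi>' i)))" by (elim exE conjE)
    have "t = I2 \<bar>- 2 * \<mu>\<bar> (\<lambda>x y. \<Psi> x y 0)"
      unfolding t by (rule val[OF _ _ \<Psi>]) (use i in blast)+
    then show "t = (\<Sum>i<n. tau_D (R (\<eta> i) (\<xi> i)))" using val[OF assms] by (rule trans[OF _ sym])
  qed
  show "tau_E c \<mu> \<nu> \<Psi> = I2 \<bar>- 2 * \<mu>\<bar> (\<lambda>x y. \<Psi> x y 0)" using 1 val[OF assms] by simp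
qed

lemma tau_D_add:
  assumes "f \<in> Xi" "g \<in> Xi" "f' \<in> Xi" "g' \<in> Xi"
  shows "tau_D (\<lambda>x y p. R f g x y p + R f' g' x y p) = tau_D (R f g) + tau_D (R f' g')"
  unfolding tau_D_I2 by (intro I2_add inner_R_continuous assms)

lemma tau_D_inner_R_add:
  "f \<in> Xi \<Longrightarrow> g \<in> Xi \<Longrightarrow> g' \<in> Xi \<Longrightarrow> tau_D (R f (\<lambda>x y. g x y + g' x y)) = tau_D (R f g) + tau_D (R f g')"
  using tau_D_add[of f g f g'] by (simp add: inner_R_add_right tau_D_def)

lemma tau_D_inner_R_cmult: "tau_D (R f (\<lambda>x y. a * g x y)) = cnj a * tau_D (R f g)"
  unfolding tau_D_I2 inner_R_cmult_right I2_cmult ..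

text \<open>At p = 0 an inner product is periodic with period 1 in both variables and the terms of
  the derivations with factor p vanish; integrals of derivatives over a period are 0.\<close>

lemma tau_D_delta:
  assumes "f \<in> Xi" "g \<in> Xi" shows "tau_D (delta c \<mu> W (R f g)) = 0"
proof -
  obtain a b z where W: "W = (a, b, z)" by (cases W)
  define u where "u = (\<lambda>x y. R f g x y 0)"
  define ux where "ux = (\<lambda>x y. R (partial_x f) g x y 0 + R f (partial_x g) x y 0)"
  define uy where "uy = (\<lambda>x y. R (partial_y f) g x y 0 + R f (partial_y g) x y 0)"
  have P: "partials u ux uy" using inner_R_partials[OF assms, of 0] by (simp add: u_def ux_def uy_def)
  have c: "continuous2 ux" "continuous2 uy"
    unfolding ux_def uy_def case_prod_unfold
    by (intro continuous_on_add; rule inner_R_continuous[unfolded case_prod_unfold]; intro assms Xi_partial_x Xi_partial_y)+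
  have "u x (y + 1) = u x y" for x y
    using rapid_inner_R[OF assms] by (simp add: u_def rapid_def)
  from this[of _ 0] have per_y: "u x 1 = u x 0" for x by simp
  have "u (x + 1) y = u x y" for x y
    using inner_R_invariant[of f g, unfolded D_invariant_def, rule_format, of 1 0 y x] by (simp add: u_def)
  from this[of 0] have per_x: "u 1 y = u 0 y" for y by simp
  have "integral {0..1} (uy x) = 0" for x
    using integral_unique[OF fundamental_theorem_of_calculus[of 0 1 "u x" "uy x"]] partials_y[OF P] per_y
    by (auto intro: has_vector_derivative_at_within)
  then have y: "I2 1 uy = 0" by (simp add: I2_def)
  have "integral {0..1} (\<lambda>x. ux x y) = 0" for y
    using integral_unique[OF fundamental_theorem_of_calculus[of 0 1 "\<lambda>x. u x y" "\<lambda>x. ux x y"]] partials_x[OF P] per_x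
    by (auto intro: has_vector_derivative_at_within)
  moreover have "I2 1 ux = integral {0..1} (\<lambda>y. integral {0..1} (\<lambda>x. ux x y))"
    unfolding I2_def using integral_swap_continuous[of 0 0 1 1 ux] continuous_on_subset[OF c(1)] by auto
  ultimately have x: "I2 1 ux = 0" by simp
  have "delta c \<mu> W (R f g) x y 0 = (- of_real a) * uy x y + (- of_real b) * ux x y" for x y
    using partials_imp(2,3)[OF P] by (simp add: delta_def W delta_X_def delta_Y_def delta_Z_def u_def)
  then have "tau_D (delta c \<mu> W (R f g)) = I2 1 (\<lambda>x y. (- of_real a) * uy x y + (- of_real b) * ux x y)"
    by (simp add: tau_D_I2)
  also have "\<dots> = (- of_real a) * I2 1 uy + (- of_real b) * I2 1 ux"
    by (simp only: I2_add I2_cmult continuous2_cmult c)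
  finally show ?thesis using x y by simp
qed


section \<open>Module endomorphisms and compatible connections\<close>

lemma Xi_ract: "f \<in> Xi \<Longrightarrow> g \<in> Xi \<Longrightarrow> h \<in> Xi \<Longrightarrow> ra f (R g h) \<in> Xi"
  by (simp add: lact_inner_L(2) triple_sum_Xi Xi_cnj)

lemma lact_sum:
  assumes "\<And>i. i \<in> I \<Longrightarrow> f i \<in> Xi" "\<And>i. i \<in> I \<Longrightarrow> g i \<in> Xi" "h \<in> Xi"
  shows "lact (\<lambda>x y p. \<Sum>i\<in>I. L (f i) (g i) x y p) h x y = (\<Sum>i\<in>I. ra (f i) (R (g i) h) x y)"
proof -
  obtain B where B: "\<And>x y. norm (h x y) \<le> B" using Xi_bounded[OF assms(3)] by blast
  have "(\<lambda>q. cnj (L (f i) (g i) x y q) * h (x + of_int q) y) summable_on UNIV" if i: "i \<in> I" for i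
  proof -
    obtain C where C: "0 \<le> C" "\<And>p x y. norm (L (f i) (g i) x y p) \<le> C / wt (of_int p) ^ 2"
      using inner_L_decay[OF assms(1,2)[OF i]] by blast
    show ?thesis
    proof (rule summable_on_bound)
      show "(\<lambda>q. (C * B) * (1 / wt (of_int q))) summable_on (UNIV :: int set)"
        by (rule summable_on_cmult_right[OF summable_inverse_wt])
      show "norm (cnj (L (f i) (g i) x y q) * h (x + of_int q) y) \<le> (C * B) * (1 / wt (of_int q))" for q
      proof -
        have "norm (cnj (L (f i) (g i) x y q) * h (x + of_int q) y) \<le> (C / wt (of_int q)) * B"
          unfolding norm_mult complex_mod_cnj
          using C(1) order.trans[OF C(2) divide_wt_square_le[OF C(1)]] by (intro mult_mono B) simp_all
        then show ?thesis by simp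
      qed
    qed
  qed
  then have "lact (\<lambda>x y p. \<Sum>i\<in>I. L (f i) (g i) x y p) h x y = (\<Sum>i\<in>I. lact (L (f i) (g i)) h x y)"
    unfolding lact_def by (subst infsum_finite_sum(1)[symmetric]) (simp_all add: sum_distrib_right)
  also have "\<dots> = (\<Sum>i\<in>I. ra (f i) (R (g i) h) x y)"
    using assms by (intro sum.cong) (simp_all add: lact_inner_L)
  finally show ?thesis .
qed

lemma mult_E_sum:
  assumes \<Psi>: "\<Psi> \<in> E_cstar c \<mu> \<nu>" and "\<And>i. i \<in> I \<Longrightarrow> f i \<in> Xi" "\<And>i. i \<in> I \<Longrightarrow> g i \<in> Xi"
  shows "mult_E \<Psi> (\<lambda>x y p. \<Sum>i\<in>I. L (f i) (g i) x y p) = (\<lambda>x y p. \<Sum>i\<in>I. L (lact \<Psi> (f i)) (g i) x y p)"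
proof (intro ext)
  fix x y p
  obtain B where B: "0 \<le> B" "\<And>x y p. norm (\<Psi> x y p) \<le> B" using E_cstar_bounded[OF \<Psi>] by blast
  have "(\<lambda>q. \<Psi> x y q * L (f i) (g i) (x + of_int q) y (p - q)) summable_on UNIV" if i: "i \<in> I" for i
  proof -
    obtain C where C: "0 \<le> C" "\<And>p x y. norm (L (f i) (g i) x y p) \<le> C / wt (of_int p) ^ 2"
      using inner_L_decay[OF assms(2,3)[OF i]] by blast
    show ?thesis
    proof (rule summable_on_bound)
      show "(\<lambda>q. (B * C * (2 * wt (of_int p))) * (1 / wt (of_int q))) summable_on (UNIV :: int set)"
        by (rule summable_on_cmult_right[OF summable_inverse_wt])
      show "norm (\<Psi> x y q * L (f i) (g i) (x + of_int q) y (p - q)) \<le> (B * C * (2 * wt (of_int p))) * (1 / wt (of_int q))" for q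
      proof -
        have "wt (of_int q) \<le> 2 * wt (of_int p) * wt (of_int (p - q))" using wt_diff[of "of_int p" "of_int (p - q)"] by simp
        then have "1 / wt (of_int (p - q)) \<le> 2 * wt (of_int p) / wt (of_int q)" by (simp add: field_simps)
        then have "C / wt (of_int (p - q)) \<le> C * (2 * wt (of_int p) / wt (of_int q))"
          using mult_left_mono[OF _ C(1)] by fastforce
        moreover have "norm (\<Psi> x y q * L (f i) (g i) (x + of_int q) y (p - q)) \<le> B * (C / wt (of_int (p - q)))"
          unfolding norm_mult
          by (intro mult_mono B order.trans[OF C(2) divide_wt_square_le[OF C(1)]]) simp_all
        ultimately show ?thesis using mult_left_mono[OF _ B(1)] by fastforce
      qed
    qed
  qed
  then have "mult_E \<Psi> (\<lambda>x y p. \<Sum>i\<in>I. L (f i) (g i) x y p) x y p = (\<Sum>i\<in>I. mult_E \<Psi> (L (f i) (g i)) x y p)"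
    unfolding mult_E_def by (subst infsum_finite_sum(1)[symmetric]) (simp_all add: sum_distrib_left)
  also have "\<dots> = (\<Sum>i\<in>I. L (lact \<Psi> (f i)) (g i) x y p)"
    using assms by (intro sum.cong) (simp_all add: mult_E_inner_L)
  finally show "mult_E \<Psi> (\<lambda>x y p. \<Sum>i\<in>I. L (f i) (g i) x y p) x y p = (\<Sum>i\<in>I. L (lact \<Psi> (f i)) (g i) x y p)" .
qed

lemma mult_E_Id: "mult_E \<Psi> Id_E = \<Psi>"
proof (intro ext)
  fix x y p
  have "((\<lambda>q. \<Psi> x y q * Id_E (x + of_int q) y (p - q)) has_sum (\<Sum>q\<in>{p}. \<Psi> x y q * Id_E (x + of_int q) y (p - q))) UNIV"
    by (rule has_sum_finite_neutralI[where B = "{p}"]) (auto simp: Id_E_def)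
  then show "mult_E \<Psi> Id_E x y p = \<Psi> x y p" unfolding mult_E_def by (simp add: infsumI Id_E_def)
qed

lemma lact_scalar: "lact (\<lambda>x y p. a * Id_E x y p) f = (\<lambda>x y. cnj a * f x y)"
proof (intro ext)
  fix x y
  have "((\<lambda>q. cnj (a * Id_E x y q) * f (x + of_int q) y) has_sum (\<Sum>q\<in>{0}. cnj (a * Id_E x y q) * f (x + of_int q) y)) UNIV"
    by (rule has_sum_finite_neutralI[where B = "{0}"]) (auto simp: Id_E_def)
  then show "lact (\<lambda>x y p. a * Id_E x y p) f x y = cnj a * f x y" unfolding lact_def by (simp add: infsumI Id_E_def)
qed

lemma scalar_E_smooth: "(\<lambda>x y p. a * Id_E x y p) \<in> E_smooth c \<mu> \<nu>"
proof -
  have "rapid (\<lambda>x y p. a * Id_E x y p)"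
    unfolding rapid_def
    by (intro conjI allI exI[of _ "norm a"]) (simp_all add: Id_E_def case_prod_unfold wt_def)
  moreover have "E_invariant (\<lambda>x y p. a * Id_E x y p)" by (simp add: E_invariant_def Id_E_def)
  ultimately show ?thesis unfolding E_smooth_def by (simp add: E_cstarI lact_scalar Xi_cmult)
qed

text \<open>Endomorphisms of the right module, with commutation required only for elements of the
  form \<open>R g h\<close>: these are the ones occurring in a frame expansion, so they already
  determine the operator from its values on the frame.\<close>

definition dlin :: "(mfun \<Rightarrow> mfun) \<Rightarrow> bool"
  where "dlin T \<longleftrightarrow> (\<forall>f\<in>Xi. T f \<in> Xi) \<and>
    (\<forall>f\<in>Xi. \<forall>g\<in>Xi. \<forall>a b. T (\<lambda>x y. a * f x y + b * g x y) = (\<lambda>x y. a * T f x y + b * T g x y)) \<and>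
    (\<forall>f\<in>Xi. \<forall>g\<in>Xi. \<forall>h\<in>Xi. T (ra f (R g h)) = ra (T f) (R g h))"

lemma dlin_Xi: "dlin T \<Longrightarrow> f \<in> Xi \<Longrightarrow> T f \<in> Xi"
  and dlin_lin: "dlin T \<Longrightarrow> f \<in> Xi \<Longrightarrow> g \<in> Xi \<Longrightarrow> T (\<lambda>x y. a * f x y + b * g x y) = (\<lambda>x y. a * T f x y + b * T g x y)"
  and dlin_ract: "dlin T \<Longrightarrow> f \<in> Xi \<Longrightarrow> g \<in> Xi \<Longrightarrow> h \<in> Xi \<Longrightarrow> T (ra f (R g h)) = ra (T f) (R g h)"
  unfolding dlin_def by blast+

text \<open>Operators may be arbitrary outside \<open>Xi\<close>, so identities hold only on
  \<open>Xi\<close> and the property has to be transferred along them.\<close>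

lemma dlin_cong:
  assumes S: "dlin S" and eq: "\<And>f. f \<in> Xi \<Longrightarrow> T f = S f" shows "dlin T"
  unfolding dlin_def
proof (intro conjI ballI allI)
  fix f assume f: "f \<in> Xi"
  show "T f \<in> Xi" unfolding eq[OF f] by (rule dlin_Xi[OF S f])
  fix g assume g: "g \<in> Xi"
  show "T (\<lambda>x y. a * f x y + b * g x y) = (\<lambda>x y. a * T f x y + b * T g x y)" for a b
    unfolding eq[OF f] eq[OF g] eq[OF Xi_add[OF Xi_cmult[OF f] Xi_cmult[OF g]]] by (rule dlin_lin[OF S f g])
  fix h assume h: "h \<in> Xi"
  show "T (ra f (R g h)) = ra (T f) (R g h)"
    unfolding eq[OF f] eq[OF Xi_ract[OF f g h]] by (rule dlin_ract[OF S f g h])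
qed

lemma dlin_combination:
  assumes "dlin S" "dlin T" shows "dlin (\<lambda>f x y. a * S f x y + b * T f x y)"
  unfolding dlin_def
proof (intro conjI ballI allI)
  fix f assume f: "f \<in> Xi"
  show "(\<lambda>x y. a * S f x y + b * T f x y) \<in> Xi" by (intro Xi_add Xi_cmult dlin_Xi[OF assms(1)] dlin_Xi[OF assms(2)] f)
  fix g assume g: "g \<in> Xi"
  show "(\<lambda>x y. a * S (\<lambda>x y. d * f x y + e * g x y) x y + b * T (\<lambda>x y. d * f x y + e * g x y) x y) =
      (\<lambda>x y. d * (a * S f x y + b * T f x y) + e * (a * S g x y + b * T g x y))" for d e
    by (simp add: dlin_lin[OF assms(1) f g] dlin_lin[OF assms(2) f g] algebra_simps)
  fix h assume h: "h \<in> Xi"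
  show "(\<lambda>x y. a * S (ra f (R g h)) x y + b * T (ra f (R g h)) x y) = ra (\<lambda>x y. a * S f x y + b * T f x y) (R g h)"
    by (intro ext) (simp add: dlin_ract[OF assms(1)] dlin_ract[OF assms(2)] dlin_Xi[OF assms(1)] dlin_Xi[OF assms(2)]
      ract_add_left ract_cmult_left Xi_cmult bounded3_inner_R f g h)
qed

lemma dlin_comp:
  assumes "dlin S" "dlin T" shows "dlin (\<lambda>f. S (T f))"
  unfolding dlin_def using assms
  by (intro conjI ballI allI) (simp_all add: dlin_Xi[OF assms(1)] dlin_Xi[OF assms(2)] dlin_lin[OF assms(1)] dlin_lin[OF assms(2)]
    dlin_ract[OF assms(1)] dlin_ract[OF assms(2)])

lemma dlin_zero: "dlin T \<Longrightarrow> T (\<lambda>x y. 0) = (\<lambda>x y. 0)"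
  using dlin_lin[OF _ Xi_zero Xi_zero, of T 0 0] by simp

lemma dlin_add: "dlin T \<Longrightarrow> f \<in> Xi \<Longrightarrow> g \<in> Xi \<Longrightarrow> T (\<lambda>x y. f x y + g x y) = (\<lambda>x y. T f x y + T g x y)"
  using dlin_lin[of T f g 1 1] by simp

lemma dlin_cmult: "dlin T \<Longrightarrow> f \<in> Xi \<Longrightarrow> T (\<lambda>x y. a * f x y) = (\<lambda>x y. a * T f x y)"
  using dlin_lin[of T f f a 0] by simp

lemma dlin_sum:
  assumes "dlin T" "\<And>i. i \<in> I \<Longrightarrow> f i \<in> Xi"
  shows "T (\<lambda>x y. \<Sum>i\<in>I. f i x y) = (\<lambda>x y. \<Sum>i\<in>I. T (f i) x y)"
  using assms(2)
proof (induction I rule: infinite_finite_induct)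
  case (insert i I)
  then show ?case by (simp add: dlin_add[OF assms(1)] Xi_sum)
qed (simp_all add: dlin_zero[OF assms(1)])

lemma dlin_lact:
  assumes "\<Psi> \<in> E_smooth c \<mu> \<nu>" shows "dlin (lact \<Psi>)"
proof -
  have \<Psi>: "\<Psi> \<in> E_cstar c \<mu> \<nu>" and pres: "\<And>f. f \<in> Xi \<Longrightarrow> lact \<Psi> f \<in> Xi" using assms by (auto simp: E_smooth_def)
  obtain B where B: "0 \<le> B" "\<And>x y p. norm (\<Psi> x y p) \<le> B" using E_cstar_bounded[OF \<Psi>] by blast
  have sm: "(\<lambda>q. cnj (\<Psi> x y q) * f (x + of_int q) y) summable_on UNIV" if f: "f \<in> Xi" for f x y
  proof -
    obtain A where A: "0 \<le> A" "\<And>x y. norm (f x y) \<le> A / wt x ^ 1" using Xi_decay[OF f] by blast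
    have "loc_summable (\<lambda>q u v. cnj (\<Psi> x y q) * f (u + of_int q * 1) v)"
    proof (rule loc_summable_wt)
      show "norm (cnj (\<Psi> x y q) * f (u + of_int q * 1) v) \<le> (B * A) / wt (u + of_int q * 1)" for q u v
        using mult_mono[OF B(2) A(2) B(1) norm_ge_zero, of x y q "u + of_int q" v] by (simp add: norm_mult)
    qed simp
    from loc_summableD[OF this, of x y] show ?thesis by simp
  qed
  have "lact \<Psi> (\<lambda>x y. a * f x y + b * g x y) = (\<lambda>x y. a * lact \<Psi> f x y + b * lact \<Psi> g x y)"
    if f: "f \<in> Xi" and g: "g \<in> Xi" for f g a b
  proof (intro ext)
    fix x y
    have "cnj (\<Psi> x y q) * (a * f (x + of_int q) y + b * g (x + of_int q) y) =
        a * (cnj (\<Psi> x y q) * f (x + of_int q) y) + b * (cnj (\<Psi> x y q) * g (x + of_int q) y)" for q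
      by (simp add: algebra_simps)
    then show "lact \<Psi> (\<lambda>x y. a * f x y + b * g x y) x y = a * lact \<Psi> f x y + b * lact \<Psi> g x y"
      unfolding lact_def
      by (simp only: infsum_add infsum_cmult_right' summable_on_cmult_right sm[OF f] sm[OF g])
  qed
  then show ?thesis unfolding dlin_def using pres lact_ract[OF \<Psi>] by blast
qed

definition connection :: "(heis \<Rightarrow> mfun \<Rightarrow> mfun) \<Rightarrow> bool"
  where "connection nabla \<longleftrightarrow> nabla \<in> compatible_connections c \<mu> \<nu>"

lemma connection_Xi: "connection nabla \<Longrightarrow> f \<in> Xi \<Longrightarrow> nabla W f \<in> Xi"
  and connection_lin: "connection nabla \<Longrightarrow> f \<in> Xi \<Longrightarrow> g \<in> Xi \<Longrightarrow>
    nabla W (\<lambda>x y. a * f x y + b * g x y) = (\<lambda>x y. a * nabla W f x y + b * nabla W g x y)"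
  and connection_heis: "connection nabla \<Longrightarrow> f \<in> Xi \<Longrightarrow>
    nabla (r *\<^sub>R V + s *\<^sub>R W) f = (\<lambda>x y. of_real r * nabla V f x y + of_real s * nabla W f x y)"
  and connection_delta: "connection nabla \<Longrightarrow> f \<in> Xi \<Longrightarrow> g \<in> Xi \<Longrightarrow>
    delta c \<mu> W (R f g) = (\<lambda>x y p. R (nabla W f) g x y p + R f (nabla W g) x y p)"
  and connection_leibniz: "connection nabla \<Longrightarrow> f \<in> Xi \<Longrightarrow> \<Phi> \<in> D_smooth c \<mu> \<nu> \<Longrightarrow>
    nabla W (ra f \<Phi>) = (\<lambda>x y. ra (nabla W f) \<Phi> x y + ra f (delta c \<mu> W \<Phi>) x y)"
  unfolding connection_def compatible_connections_def linear_connection_def by blast+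

text \<open>The Leibniz rule combined with compatibility: a compatible connection acts as a
  derivation on the triple product of f, g and h.\<close>

lemma connection_ract:
  assumes "connection nabla" "f \<in> Xi" "g \<in> Xi" "h \<in> Xi"
  shows "nabla W (ra f (R g h)) =
    (\<lambda>x y. ra (nabla W f) (R g h) x y + (ra f (R (nabla W g) h) x y + ra f (R g (nabla W h)) x y))"
  by (simp add: connection_leibniz[OF assms(1)] inner_R_D_smooth connection_delta[OF assms(1)] ract_add_right
    bounded3_inner_R connection_Xi[OF assms(1)] assms(2-))

lemma connection_add: "connection nabla \<Longrightarrow> f \<in> Xi \<Longrightarrow> g \<in> Xi \<Longrightarrow> nabla W (\<lambda>x y. f x y + g x y) = (\<lambda>x y. nabla W f x y + nabla W g x y)"
  using connection_lin[of nabla f g W 1 1] by simp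

lemma connection_diff: "connection nabla \<Longrightarrow> f \<in> Xi \<Longrightarrow> g \<in> Xi \<Longrightarrow> nabla W (\<lambda>x y. f x y - g x y) = (\<lambda>x y. nabla W f x y - nabla W g x y)"
  using connection_lin[of nabla f g W 1 "-1"] by simp

lemma connection_cmult: "connection nabla \<Longrightarrow> f \<in> Xi \<Longrightarrow> nabla W (\<lambda>x y. a * f x y) = (\<lambda>x y. a * nabla W f x y)"
  using connection_lin[of nabla f f W a 0] by simp

lemma connection_sum:
  assumes "connection nabla" "\<And>i. i \<in> I \<Longrightarrow> f i \<in> Xi"
  shows "nabla W (\<lambda>x y. \<Sum>i\<in>I. f i x y) = (\<lambda>x y. \<Sum>i\<in>I. nabla W (f i) x y)"
  using assms(2)
proof (induction I rule: infinite_finite_induct)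
  case (insert i I)
  then show ?case by (simp add: connection_add[OF assms(1)] Xi_sum)
qed (use connection_cmult[OF assms(1) Xi_zero, of W 0] in simp_all)

lemma connection_zero: "connection nabla \<Longrightarrow> f \<in> Xi \<Longrightarrow> nabla 0 f = (\<lambda>x y. 0)"
  using connection_heis[of nabla f 0 0 0 0] by simp

lemma connection_nab0: "connection nab0"
  unfolding connection_def by (rule nab0_compatible)

text \<open>The term of the Leibniz rule in which \<Phi> is differentiated is the same for all
  connections and cancels in the difference.\<close>

lemma dlin_connection_diff:
  assumes "connection nabla" "connection nabla'" shows "dlin (\<lambda>f x y. nabla W f x y - nabla' W f x y)"
  unfolding dlin_def
proof (intro conjI ballI allI)
  fix f assume f: "f \<in> Xi"
  show "(\<lambda>x y. nabla W f x y - nabla' W f x y) \<in> Xi" by (intro Xi_diff connection_Xi[OF assms(1)] connection_Xi[OF assms(2)] f)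
  fix g assume g: "g \<in> Xi"
  show "(\<lambda>x y. nabla W (\<lambda>x y. d * f x y + e * g x y) x y - nabla' W (\<lambda>x y. d * f x y + e * g x y) x y) =
      (\<lambda>x y. d * (nabla W f x y - nabla' W f x y) + e * (nabla W g x y - nabla' W g x y))" for d e
    by (simp add: connection_lin[OF assms(1) f g] connection_lin[OF assms(2) f g] algebra_simps)
  fix h assume h: "h \<in> Xi"
  have d: "ra f (delta c \<mu> W (R g h)) x y = ra f (R (nabla W g) h) x y + ra f (R g (nabla W h)) x y"
    if "connection nabla" for nabla x y
    by (simp add: connection_delta[OF that] ract_add_right bounded3_inner_R connection_Xi[OF that] f g h)
  have "ra (\<lambda>x y. nabla W f x y + (- 1) * nabla' W f x y) (R g h) x y =
      ra (nabla W f) (R g h) x y + (- 1) * ra (nabla' W f) (R g h) x y" for x y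
    by (simp only: ract_add_left ract_cmult_left connection_Xi[OF assms(1)] connection_Xi[OF assms(2)] Xi_cmult bounded3_inner_R f g h)
  then show "(\<lambda>x y. nabla W (ra f (R g h)) x y - nabla' W (ra f (R g h)) x y) =
      ra (\<lambda>x y. nabla W f x y - nabla' W f x y) (R g h)"
    using d[OF assms(1)] d[OF assms(2)]
    by (intro ext) (simp add: connection_ract[OF assms(1) f g h] connection_ract[OF assms(2) f g h])
qed

text \<open>The terms in which g or h is differentiated occur in both products, because B passes
  through the right action, and cancel.\<close>

lemma dlin_commutator:
  assumes "connection nabla" "dlin B" shows "dlin (\<lambda>f x y. nabla W (B f) x y - B (nabla W f) x y)"
  unfolding dlin_def
proof (intro conjI ballI allI)
  note I = connection_Xi[OF assms(1)] dlin_Xi[OF assms(2)] Xi_ract Xi_add Xi_cmult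
  fix f assume f: "f \<in> Xi"
  show "(\<lambda>x y. nabla W (B f) x y - B (nabla W f) x y) \<in> Xi" by (intro Xi_diff I f)
  fix g assume g: "g \<in> Xi"
  show "(\<lambda>x y. nabla W (B (\<lambda>x y. d * f x y + e * g x y)) x y - B (nabla W (\<lambda>x y. d * f x y + e * g x y)) x y) =
      (\<lambda>x y. d * (nabla W (B f) x y - B (nabla W f) x y) + e * (nabla W (B g) x y - B (nabla W g) x y))" for d e
    by (simp add: connection_lin[OF assms(1)] dlin_lin[OF assms(2)] f g I algebra_simps)
  fix h assume h: "h \<in> Xi"
  have "ra (\<lambda>x y. nabla W (B f) x y + (- 1) * B (nabla W f) x y) (R g h) x y =
      ra (nabla W (B f)) (R g h) x y + (- 1) * ra (B (nabla W f)) (R g h) x y" for x y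
    by (simp only: ract_add_left ract_cmult_left I bounded3_inner_R f g h)
  moreover have "B (nabla W (ra f (R g h))) = (\<lambda>x y. ra (B (nabla W f)) (R g h) x y +
      (ra (B f) (R (nabla W g) h) x y + ra (B f) (R g (nabla W h)) x y))"
    by (simp add: connection_ract[OF assms(1)] dlin_add[OF assms(2)] dlin_ract[OF assms(2)] I f g h)
  ultimately show "(\<lambda>x y. nabla W (B (ra f (R g h))) x y - B (nabla W (ra f (R g h))) x y) =
      ra (\<lambda>x y. nabla W (B f) x y - B (nabla W f) x y) (R g h)"
    by (intro ext) (simp add: connection_ract[OF assms(1)] dlin_ract[OF assms(2)] I f g h)
qed

lemma inner_R_diff_left: "f \<in> Xi \<Longrightarrow> f' \<in> Xi \<Longrightarrow> g \<in> Xi \<Longrightarrow> R (\<lambda>x y. f x y - f' x y) g x y p = R f g x y p - R f' g x y p"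
  using inner_R_add_left[of f "\<lambda>x y. (- 1) * f' x y" g x y p] inner_R_cmult_left[of "- 1" f' g x y p]
  by (simp add: Xi_uminus)

lemma inner_R_diff_right: "f \<in> Xi \<Longrightarrow> g \<in> Xi \<Longrightarrow> g' \<in> Xi \<Longrightarrow> R f (\<lambda>x y. g x y - g' x y) x y p = R f g x y p - R f g' x y p"
  using inner_R_add_right[of f g "\<lambda>x y. (- 1) * g' x y" x y p] inner_R_cmult_right[of f "- 1" g' x y p]
  by (simp add: Xi_uminus)

lemma ract_diff_left:
  "f \<in> Xi \<Longrightarrow> f' \<in> Xi \<Longrightarrow> bounded3 \<Phi> \<Longrightarrow> ra (\<lambda>x y. f x y - f' x y) \<Phi> x y = ra f \<Phi> x y - ra f' \<Phi> x y"
  using ract_add_left[of f "\<lambda>x y. (- 1) * f' x y" \<Phi> x y] ract_cmult_left[of "- 1" f' \<Phi> x y]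
  by (simp add: Xi_uminus)

lemma curvature_op_Xi:
  assumes "connection nabla" "f \<in> Xi" shows "curvature_op c nabla V W f \<in> Xi"
  unfolding curvature_op_def by (intro Xi_diff connection_Xi[OF assms(1)] assms(2))

lemma delta_delta:
  assumes "connection nabla" "g \<in> Xi" "h \<in> Xi"
  shows "delta c \<mu> V (delta c \<mu> W (R g h)) x y p = (R (nabla V (nabla W g)) h x y p + R (nabla W g) (nabla V h) x y p) +
    (R (nabla V g) (nabla W h) x y p + R g (nabla V (nabla W h)) x y p)"
proof -
  have "partially_differentiable (\<lambda>x y. R f f' x y p)" if "f \<in> Xi" "f' \<in> Xi" for f f' p
    by (rule partials_imp(1)[OF inner_R_partials[OF that]])
  then show ?thesis
    by (simp add: connection_delta[OF assms(1)] delta_add connection_Xi[OF assms(1)] assms(2-))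
qed

text \<open>Each application of \<open>delta\<close> is distributed over the two slots by
  compatibility; the mixed terms, with one derivative in each slot, cancel under antisymmetrization
  in V and W.\<close>

lemma curvature_op_skew_eq:
  assumes "connection nabla" "g \<in> Xi" "h \<in> Xi"
  shows "R (curvature_op c nabla V W g) h x y p + R g (curvature_op c nabla V W h) x y p =
    delta c \<mu> V (delta c \<mu> W (R g h)) x y p - delta c \<mu> W (delta c \<mu> V (R g h)) x y p - delta c \<mu> (bracket c V W) (R g h) x y p"
  unfolding delta_delta[OF assms] curvature_op_def
  by (simp add: connection_delta[OF assms(1)] inner_R_diff_left inner_R_diff_right connection_Xi[OF assms(1)] Xi_diff assms(2-))

text \<open>The right-hand side above does not depend on the connection, so skewness need only be checked for \<open>nab0\<close>.\<close>

lemma curvature_op_skew: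
  assumes "connection nabla" "g \<in> Xi" "h \<in> Xi"
  shows "R (curvature_op c nabla V W g) h x y p + R g (curvature_op c nabla V W h) x y p = 0"
proof -
  obtain v1 v2 v3 w1 w2 w3 where VW: "V = (v1, v2, v3)" "W = (w1, w2, w3)" by (cases V; cases W)
  have "R (curvature_op c nab0 V W g) h x y p + R g (curvature_op c nab0 V W h) x y p = 0"
    unfolding VW curvature_op_nab0[OF assms(2)] curvature_op_nab0[OF assms(3)] inner_R_cmult_left inner_R_cmult_right
    by simp
  then show ?thesis
    unfolding curvature_op_skew_eq[OF assms] curvature_op_skew_eq[OF connection_nab0 assms(2,3)] .
qed

text \<open>Expanding on the triple product of f, g and h leaves, besides the wanted term, the
  action on f of the curvature of \<open>R g h\<close>, that is of the expression shown to vanish by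
  skewness.\<close>

lemma dlin_curvature_op:
  assumes conn: "connection nabla" shows "dlin (curvature_op c nabla V W)"
  unfolding dlin_def
proof (intro conjI ballI allI)
  note I = connection_Xi[OF conn] Xi_ract Xi_add Xi_cmult Xi_diff bounded3_inner_R
  fix f assume f: "f \<in> Xi"
  show "curvature_op c nabla V W f \<in> Xi" by (rule curvature_op_Xi[OF conn f])
  fix g assume g: "g \<in> Xi"
  show "curvature_op c nabla V W (\<lambda>x y. d * f x y + e * g x y) =
      (\<lambda>x y. d * curvature_op c nabla V W f x y + e * curvature_op c nabla V W g x y)" for d e
    by (simp add: curvature_op_def connection_lin[OF conn] f g I algebra_simps)
  fix h assume h: "h \<in> Xi"
  show "curvature_op c nabla V W (ra f (R g h)) = ra (curvature_op c nabla V W f) (R g h)"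
  proof (intro ext)
    fix x y
    have "ra f (\<lambda>x y p. R (curvature_op c nabla V W g) h x y p + R g (curvature_op c nabla V W h) x y p) x y = 0"
      by (simp add: curvature_op_skew[OF conn g h] ract_def)
    then have "ra f (R (curvature_op c nabla V W g) h) x y + ra f (R g (curvature_op c nabla V W h)) x y = 0"
      by (simp add: ract_add_right f g h I curvature_op_Xi[OF conn])
    moreover have "R (curvature_op c nabla V W g) h = (\<lambda>x y p. R (nabla V (nabla W g)) h x y p +
        ((- 1) * R (nabla W (nabla V g)) h x y p + (- 1) * R (nabla (bracket c V W) g) h x y p))"
      unfolding curvature_op_def by (intro ext) (simp add: inner_R_diff_left g h I)
    moreover have "R g (curvature_op c nabla V W h) = (\<lambda>x y p. R g (nabla V (nabla W h)) x y p +
        ((- 1) * R g (nabla W (nabla V h)) x y p + (- 1) * R g (nabla (bracket c V W) h) x y p))"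
      unfolding curvature_op_def by (intro ext) (simp add: inner_R_diff_right g h I)
    ultimately have skew: "(ra f (R (nabla V (nabla W g)) h) x y + ((- 1) * ra f (R (nabla W (nabla V g)) h) x y + (- 1) * ra f (R (nabla (bracket c V W) g) h) x y)) +
        (ra f (R g (nabla V (nabla W h))) x y + ((- 1) * ra f (R g (nabla W (nabla V h))) x y + (- 1) * ra f (R g (nabla (bracket c V W) h)) x y)) = 0"
      by (simp only: ract_add_right ract_cmult_right bounded3_add bounded3_cmult f g h I complex_cnj_minus complex_cnj_one)
    show "curvature_op c nabla V W (ra f (R g h)) x y = ra (curvature_op c nabla V W f) (R g h) x y"
      using skew unfolding curvature_op_def
      by (simp add: connection_ract[OF conn] connection_add[OF conn] ract_diff_left ract_add_left f g h I algebra_simps)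
  qed
qed

end

section \<open>Endomorphisms as elements of E, and their trace\<close>

locale heisenberg_frame = heisenberg +
  fixes n :: nat and \<xi> \<eta> :: "nat \<Rightarrow> mfun"
  assumes \<xi>: "\<And>i. \<xi> i \<in> Xi" and \<eta>: "\<And>i. \<eta> i \<in> Xi"
    and frame: "(\<lambda>x y p. \<Sum>i<n. L (\<xi> i) (\<eta> i) x y p) = Id_E"
begin

definition rep :: "(mfun \<Rightarrow> mfun) \<Rightarrow> mzfun"
  where "rep T = (\<lambda>x y p. \<Sum>i<n. L (T (\<xi> i)) (\<eta> i) x y p)"

text \<open>The operator stands in the second slot of \<open>R\<close>, so this is conjugate-linear
  in T, in accordance with \<open>lact\<close>.\<close>

definition tr :: "(mfun \<Rightarrow> mfun) \<Rightarrow> complex"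
  where "tr T = (\<Sum>i<n. tau_D (R (\<eta> i) (T (\<xi> i))))"

text \<open>Right multiplication by \<open>Id_E\<close>, written as a sum of inner products, moves
  \<Psi> into the first slots. In particular the action on the frame determines \<Psi>.\<close>

lemma E_cstar_rep:
  assumes "\<Psi> \<in> E_cstar c \<mu> \<nu>" shows "\<Psi> = rep (lact \<Psi>)"
  using mult_E_sum[OF assms, of "{..<n}" \<xi> \<eta>] \<xi> \<eta> unfolding frame mult_E_Id rep_def by simp

text \<open>The identity element acts trivially, and the imprimitivity identity rewrites each of its
  summands as a right action on \<open>\<xi> i\<close>.\<close>

lemma frame_expansion:
  assumes "f \<in> Xi" shows "f = (\<lambda>x y. \<Sum>i<n. ra (\<xi> i) (R (\<eta> i) f) x y)"
proof (intro ext)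
  fix x y
  have "lact Id_E f x y = (\<Sum>i<n. ra (\<xi> i) (R (\<eta> i) f) x y)"
    unfolding frame[symmetric] by (rule lact_sum) (auto simp: \<xi> \<eta> assms)
  then show "f x y = (\<Sum>i<n. ra (\<xi> i) (R (\<eta> i) f) x y)" using lact_scalar[of 1 f] by simp
qed

lemma dlin_expansion:
  assumes T: "dlin T" and f: "f \<in> Xi"
  shows "T f = (\<lambda>x y. \<Sum>i<n. ra (T (\<xi> i)) (R (\<eta> i) f) x y)"
proof -
  have "T (\<lambda>x y. \<Sum>i<n. ra (\<xi> i) (R (\<eta> i) f) x y) = (\<lambda>x y. \<Sum>i<n. T (ra (\<xi> i) (R (\<eta> i) f)) x y)"
    by (rule dlin_sum[OF T]) (intro Xi_ract \<xi> \<eta> f)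
  then show ?thesis unfolding frame_expansion[OF f, symmetric] dlin_ract[OF T \<xi> \<eta> f] .
qed

lemma lact_rep:
  assumes T: "dlin T" and f: "f \<in> Xi" shows "lact (rep T) f = T f"
  unfolding rep_def dlin_expansion[OF T f]
  by (intro ext lact_sum) (simp_all add: \<eta> f dlin_Xi[OF T \<xi>])

lemma rapid_rep: "(\<And>i. T (\<xi> i) \<in> Xi) \<Longrightarrow> rapid (rep T)"
  unfolding rep_def by (intro rapid_sum rapid_inner_L \<eta>)

lemma E_invariant_rep: "E_invariant (rep T)"
  unfolding rep_def by (intro E_invariant_sum inner_L_invariant)

lemma rep_E_cstar: "dlin T \<Longrightarrow> rep T \<in> E_cstar c \<mu> \<nu>"
  by (intro E_cstarI rapid_rep E_invariant_rep) (simp add: dlin_Xi[of T] \<xi>)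

text \<open>Smoothness of \<open>rep T\<close> is free: its action is \<open>T\<close>, which preserves \<open>Xi\<close>.\<close>

lemma rep_E_smooth: "dlin T \<Longrightarrow> rep T \<in> E_smooth c \<mu> \<nu>"
  unfolding E_smooth_def by (simp add: rep_E_cstar lact_rep dlin_Xi[of T])

text \<open>Two elements with the same action have the same representation by the frame, so the
  definite description in \<open>curvature\<close> is unique.\<close>

lemma curvature_eqI:
  assumes "\<Psi> \<in> E_smooth c \<mu> \<nu>" "\<And>f. f \<in> Xi \<Longrightarrow> lact \<Psi> f = curvature_op c nabla V W f"
  shows "curvature c \<mu> \<nu> nabla V W = \<Psi>"
  unfolding curvature_def
proof (rule the_equality)
  fix \<Psi>' assume *: "\<Psi>' \<in> E_smooth c \<mu> \<nu> \<and> (\<forall>f\<in>Xi. lact \<Psi>' f = curvature_op c nabla V W f)"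
  then have "\<Psi>' = rep (lact \<Psi>')" "\<Psi> = rep (lact \<Psi>)" using assms(1) by (auto simp: E_smooth_def intro: E_cstar_rep)
  moreover have "rep (lact \<Psi>') = rep (lact \<Psi>)" unfolding rep_def using * assms(2) \<xi> by simp
  ultimately show "\<Psi>' = \<Psi>" by simp
qed (use assms in blast)

lemma curvature_rep: "dlin (curvature_op c nabla V W) \<Longrightarrow> curvature c \<mu> \<nu> nabla V W = rep (curvature_op c nabla V W)"
  by (intro curvature_eqI rep_E_smooth lact_rep)

lemma mult_E_rep:
  assumes "dlin S" "dlin T" shows "mult_E (rep S) (rep T) = rep (\<lambda>f. S (T f))"
proof -
  have "mult_E (rep S) (rep T) = (\<lambda>x y p. \<Sum>i<n. L (lact (rep S) (T (\<xi> i))) (\<eta> i) x y p)"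
    unfolding rep_def[of T] by (rule mult_E_sum[OF rep_E_cstar[OF assms(1)]]) (intro dlin_Xi[OF assms(2)] \<xi> \<eta>)+
  then show ?thesis
    by (simp add: lact_rep[OF assms(1) dlin_Xi[OF assms(2) \<xi>]] rep_def[of "\<lambda>f. S (T f)"])
qed

lemma tau_E_rep: "(\<And>i. T (\<xi> i) \<in> Xi) \<Longrightarrow> tau_E c \<mu> \<nu> (rep T) = tr T"
  unfolding tr_def by (rule tau_E_eqI(1)[OF _ _ rep_def]) (simp_all add: \<eta>)

lemma tr_cong: "(\<And>f. f \<in> Xi \<Longrightarrow> S f = T f) \<Longrightarrow> tr S = tr T"
  unfolding tr_def using \<xi> by simp

lemma tr_add:
  assumes "\<And>f. f \<in> Xi \<Longrightarrow> S f \<in> Xi" "\<And>f. f \<in> Xi \<Longrightarrow> T f \<in> Xi"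
  shows "tr (\<lambda>f x y. S f x y + T f x y) = tr S + tr T"
  unfolding tr_def by (simp add: tau_D_inner_R_add assms \<xi> \<eta> sum.distrib)

lemma tr_cmult: "tr (\<lambda>f x y. a * T f x y) = cnj a * tr T"
  unfolding tr_def by (simp add: tau_D_inner_R_cmult sum_distrib_left)

lemma tr_diff:
  assumes "\<And>f. f \<in> Xi \<Longrightarrow> S f \<in> Xi" "\<And>f. f \<in> Xi \<Longrightarrow> T f \<in> Xi"
  shows "tr (\<lambda>f x y. S f x y - T f x y) = tr S - tr T"
  using tr_add[of S "\<lambda>f x y. (- 1) * T f x y"] tr_cmult[of "- 1" T] assms by (simp add: Xi_uminus)

text \<open>The value is the area of the strip over which \<open>Id_E\<close> is integrated; it is
  nonzero, so traces determine scalars.\<close>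

lemma tr_id: "tr (\<lambda>f. f) = of_real (2 * \<bar>\<mu>\<bar>)"
proof -
  have "tr (\<lambda>f. f) = I2 \<bar>- 2 * \<mu>\<bar> (\<lambda>x y. Id_E x y 0)"
    unfolding tr_def using tau_E_eqI[of n \<xi> \<eta>, OF \<xi> \<eta> frame[symmetric]] by metis
  also have "\<dots> = of_real (2 * \<bar>\<mu>\<bar>)" by (simp add: I2_def Id_E_def abs_mult scaleR_conv_of_real)
  finally show ?thesis .
qed

lemma tr_scalar: "tr (\<lambda>f x y. a * f x y) = cnj a * of_real (2 * \<bar>\<mu>\<bar>)"
  using tr_cmult[of a "\<lambda>f. f"] by (simp only: tr_id)

text \<open>Applied to an operator \<open>f \<mapsto> \<Sum> \<xi> \<langle>\<eta>, f\<rangle>\<close>, the commutator with a compatible connection differentiates both \<open>\<xi>\<close> and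
  \<open>\<eta>\<close>; the trace of the result is \<open>tau_D\<close> of a derivative.\<close>

lemma tr_commutator:
  assumes conn: "connection nabla" and B: "dlin B"
  shows "tr (\<lambda>f x y. nabla W (B f) x y - B (nabla W f) x y) = 0"
proof -
  define T where "T f = (\<lambda>x y. nabla W (B f) x y - B (nabla W f) x y)" for f
  have T: "dlin T" unfolding T_def[abs_def] by (rule dlin_commutator[OF conn B])
  have B\<xi>: "B (\<xi> i) \<in> Xi" for i by (rule dlin_Xi[OF B \<xi>])
  have nB\<xi>: "nabla W (B (\<xi> i)) \<in> Xi" and n\<eta>: "nabla W (\<eta> i) \<in> Xi" for i
    by (rule connection_Xi[OF conn B\<xi>], rule connection_Xi[OF conn \<eta>])
  define F where "F = (\<lambda>x y p. \<Sum>i<n. L (nabla W (B (\<xi> i))) (\<eta> i) x y p)"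
  define G where "G = (\<lambda>x y p. \<Sum>i<n. L (B (\<xi> i)) (nabla W (\<eta> i)) x y p)"
  \<comment> \<open>In the expansion of both products the terms containing \<open>nabla W h\<close>
    coincide and drop out, so h itself is left undifferentiated.\<close>
  have ex: "T h = (\<lambda>x y. (\<Sum>i<n. ra (nabla W (B (\<xi> i))) (R (\<eta> i) h) x y) + (\<Sum>i<n. ra (B (\<xi> i)) (R (nabla W (\<eta> i)) h) x y))"
    if h: "h \<in> Xi" for h
  proof -
    have "nabla W (B h) = (\<lambda>x y. \<Sum>i<n. nabla W (ra (B (\<xi> i)) (R (\<eta> i) h)) x y)"
      unfolding dlin_expansion[OF B h] by (rule connection_sum[OF conn]) (intro Xi_ract B\<xi> \<eta> h)
    moreover have "B (nabla W h) = (\<lambda>x y. \<Sum>i<n. ra (B (\<xi> i)) (R (\<eta> i) (nabla W h)) x y)"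
      by (rule dlin_expansion[OF B connection_Xi[OF conn h]])
    ultimately show ?thesis
      unfolding T_def by (simp add: connection_ract[OF conn B\<xi> \<eta> h] sum.distrib)
  qed
  have "lact (\<lambda>x y p. F x y p + G x y p) h = T h" if h: "h \<in> Xi" for h
  proof (intro ext)
    fix x y
    \<comment> \<open>Indexing by a disjoint sum treats F + G as one sum of inner products, to which
      \<open>lact_sum\<close> applies.\<close>
    have "lact (\<lambda>x y p. \<Sum>i\<in>{..<n} <+> {..<n}. L ((case i of Inl i \<Rightarrow> nabla W (B (\<xi> i)) | Inr i \<Rightarrow> B (\<xi> i)))
        (case i of Inl i \<Rightarrow> \<eta> i | Inr i \<Rightarrow> nabla W (\<eta> i)) x y p) h x y =
      (\<Sum>i\<in>{..<n} <+> {..<n}. ra (case i of Inl i \<Rightarrow> nabla W (B (\<xi> i)) | Inr i \<Rightarrow> B (\<xi> i))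
        (R (case i of Inl i \<Rightarrow> \<eta> i | Inr i \<Rightarrow> nabla W (\<eta> i)) h) x y)"
      by (rule lact_sum) (auto simp: nB\<xi> B\<xi> \<eta> n\<eta> h)
    then show "lact (\<lambda>x y p. F x y p + G x y p) h x y = T h x y"
      unfolding F_def G_def ex[OF h] by (simp add: sum.Plus)
  qed
  moreover have "(\<lambda>x y p. F x y p + G x y p) \<in> E_cstar c \<mu> \<nu>"
  proof (rule E_cstarI)
    show "rapid (\<lambda>x y p. F x y p + G x y p)"
      unfolding F_def G_def by (intro rapid_add rapid_sum rapid_inner_L nB\<xi> B\<xi> \<eta> n\<eta>)
    have "E_invariant F" "E_invariant G" unfolding F_def G_def by (intro E_invariant_sum inner_L_invariant)+
    then show "E_invariant (\<lambda>x y p. F x y p + G x y p)" by (simp add: E_invariant_def distrib_left)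
  qed
  ultimately have eq: "rep T = (\<lambda>x y p. F x y p + G x y p)"
    using E_cstar_rep[of "\<lambda>x y p. F x y p + G x y p"] \<xi> unfolding rep_def by simp
  have "tr T = I2 \<bar>- 2 * \<mu>\<bar> (\<lambda>x y. rep T x y 0)"
    unfolding tau_E_rep[of T, OF dlin_Xi[OF T \<xi>], symmetric] by (rule tau_E_eqI(2)[OF _ _ rep_def]) (simp_all add: dlin_Xi[OF T \<xi>] \<eta>)
  also have "\<dots> = (\<Sum>i<n. I2 \<bar>- 2 * \<mu>\<bar> (\<lambda>x y. L (nabla W (B (\<xi> i))) (\<eta> i) x y 0)) +
      (\<Sum>i<n. I2 \<bar>- 2 * \<mu>\<bar> (\<lambda>x y. L (B (\<xi> i)) (nabla W (\<eta> i)) x y 0))"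
    unfolding eq F_def G_def
    by (subst I2_add I2_sum, (intro continuous2_sum inner_L_continuous nB\<xi> B\<xi> \<eta> n\<eta>)+)+ (rule refl)
  also have "\<dots> = (\<Sum>i<n. tau_D (R (\<eta> i) (nabla W (B (\<xi> i)))) + tau_D (R (nabla W (\<eta> i)) (B (\<xi> i))))"
    by (simp only: tau_D_inner_R[OF nB\<xi> \<eta>] tau_D_inner_R[OF B\<xi> n\<eta>] sum.distrib)
  also have "\<dots> = (\<Sum>i<n. tau_D (delta c \<mu> W (R (\<eta> i) (B (\<xi> i)))))"
    unfolding connection_delta[OF conn \<eta> B\<xi>] by (simp add: tau_D_add nB\<xi> B\<xi> \<eta> n\<eta> add.commute)
  also have "\<dots> = 0" by (simp add: tau_D_delta \<eta> B\<xi>)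
  finally show ?thesis by (simp add: T_def[abs_def])
qed

section \<open>Curvature values, the functional and its critical points\<close>

definition theta_YZ :: "complex" where "theta_YZ = of_real pi * \<i> / of_real \<mu>"

text \<open>The difference of the two curvatures is [\<open>nabla V\<close>, B] -
  [\<open>nab0 W\<close>, A]. Pairing one commutator with \<open>nabla\<close> and the other with
  \<open>nab0\<close> absorbs the quadratic term [A, B], so both parts are traceless.\<close>

lemma tr_curvature_eq:
  assumes conn: "connection nabla" and b: "bracket c V W = 0"
  shows "tr (curvature_op c nabla V W) = tr (curvature_op c nab0 V W)"
proof -
  define A where "A f = (\<lambda>x y. nabla V f x y - nab0 V f x y)" for f
  define B where "B f = (\<lambda>x y. nabla W f x y - nab0 W f x y)" for f
  have A: "dlin A" and B: "dlin B"
    unfolding A_def[abs_def] B_def[abs_def] by (rule dlin_connection_diff[OF conn connection_nab0])+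
  note n0 = connection_Xi[OF connection_nab0] and n1 = connection_Xi[OF conn]
  define P where "P f = (\<lambda>x y. nabla V (B f) x y - B (nabla V f) x y)" for f
  define Q where "Q f = (\<lambda>x y. nab0 W (A f) x y - A (nab0 W f) x y)" for f
  have tP: "tr P = 0" and tQ: "tr Q = 0"
    unfolding P_def[abs_def] Q_def[abs_def] by (rule tr_commutator[OF conn B], rule tr_commutator[OF connection_nab0 A])
  have dP: "dlin P" and dQ: "dlin Q"
    unfolding P_def[abs_def] Q_def[abs_def] by (rule dlin_commutator[OF conn B], rule dlin_commutator[OF connection_nab0 A])
  have "tr (curvature_op c nabla V W) = tr (\<lambda>f x y. (\<lambda>x y. curvature_op c nab0 V W f x y + P f x y) x y - Q f x y)"
  proof (rule tr_cong)
    fix f assume f: "f \<in> Xi"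
    have "curvature_op c nabla V W f = (\<lambda>x y. nabla V (nabla W f) x y - nabla W (nabla V f) x y)"
      "curvature_op c nab0 V W f = (\<lambda>x y. nab0 V (nab0 W f) x y - nab0 W (nab0 V f) x y)"
      unfolding curvature_op_def b by (simp_all add: connection_zero[OF conn f] connection_zero[OF connection_nab0 f])
    then show "curvature_op c nabla V W f = (\<lambda>x y. (\<lambda>x y. curvature_op c nab0 V W f x y + P f x y) x y - Q f x y)"
      unfolding P_def Q_def A_def B_def
      by (simp add: connection_diff[OF conn] connection_diff[OF connection_nab0] n0 n1 f)
  qed
  also have "\<dots> = tr (curvature_op c nab0 V W)"
    using dlin_Xi[OF dP] dlin_Xi[OF dQ] curvature_op_Xi[OF connection_nab0]
    by (subst tr_diff tr_add; simp add: Xi_add tP tQ tr_add)+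
  finally show ?thesis .
qed

lemma curvature_op_scalar:
  assumes "connection nabla" "curvature c \<mu> \<nu> nabla V W = (\<lambda>x y p. a * Id_E x y p)" "f \<in> Xi"
  shows "curvature_op c nabla V W f = (\<lambda>x y. cnj a * f x y)"
  using lact_rep[OF dlin_curvature_op[OF assms(1), of V W] assms(3)]
  unfolding curvature_rep[OF dlin_curvature_op[OF assms(1)], symmetric] assms(2) lact_scalar by simp

lemma bracket_hXYZ: "bracket c hX hZ = 0" "bracket c hY hZ = 0"
  by (simp_all add: bracket_def hX_def hY_def hZ_def zero_prod_def)

lemma curvature_op_nab0_XYZ:
  assumes "f \<in> Xi"
  shows "curvature_op c nab0 hX hY f = (\<lambda>x y. 0 * f x y)" "curvature_op c nab0 hX hZ f = (\<lambda>x y. 0 * f x y)"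
    "curvature_op c nab0 hY hZ f = (\<lambda>x y. cnj theta_YZ * f x y)"
  unfolding hX_def hY_def hZ_def curvature_op_nab0[OF assms] by (simp_all add: theta_YZ_def)

text \<open>The trace fixes the two values whose bracket vanishes. The X, Y value is not fixed in
  this way, since the trace of the Z component enters; skewness only forces it to be purely
  imaginary, which leaves the real parameter b.\<close>

lemma constant_curvature_values:
  assumes conn: "connection nabla" and const: "constant_curvature c \<mu> \<nu> nabla"
  obtains b where "curvature c \<mu> \<nu> nabla hX hY = (\<lambda>x y p. (\<i> * of_real b) * Id_E x y p)"
    "curvature c \<mu> \<nu> nabla hX hZ = (\<lambda>x y p. 0 * Id_E x y p)"
    "curvature c \<mu> \<nu> nabla hY hZ = (\<lambda>x y p. theta_YZ * Id_E x y p)"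
proof -
  have tr0: "of_real (2 * \<bar>\<mu>\<bar>) \<noteq> (0 :: complex)" using mu by simp
  obtain a1 a2 a3 where a: "curvature c \<mu> \<nu> nabla hX hY = (\<lambda>x y p. a1 * Id_E x y p)"
    "curvature c \<mu> \<nu> nabla hX hZ = (\<lambda>x y p. a2 * Id_E x y p)"
    "curvature c \<mu> \<nu> nabla hY hZ = (\<lambda>x y p. a3 * Id_E x y p)"
    using const unfolding constant_curvature_def by metis
  note op = curvature_op_scalar[OF conn]
  have trs: "tr T = cnj a * of_real (2 * \<bar>\<mu>\<bar>)" if "\<And>f. f \<in> Xi \<Longrightarrow> T f = (\<lambda>x y. a * f x y)" for T a
    using tr_cong[of T "\<lambda>f x y. a * f x y", OF that] unfolding tr_scalar by blast
  have "a2 * of_real (2 * \<bar>\<mu>\<bar>) = tr (curvature_op c nabla hX hZ)"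
    using trs[of "curvature_op c nabla hX hZ" "cnj a2"] op[OF a(2)] by simp
  also have "\<dots> = 0"
    unfolding tr_curvature_eq[OF conn bracket_hXYZ(1)]
    using trs[of "curvature_op c nab0 hX hZ" 0] curvature_op_nab0_XYZ(2) by simp
  finally have a2: "a2 = 0" using tr0 by simp
  have "a3 * of_real (2 * \<bar>\<mu>\<bar>) = tr (curvature_op c nabla hY hZ)"
    using trs[of "curvature_op c nabla hY hZ" "cnj a3"] op[OF a(3)] by simp
  also have "\<dots> = theta_YZ * of_real (2 * \<bar>\<mu>\<bar>)"
    unfolding tr_curvature_eq[OF conn bracket_hXYZ(2)]
    using trs[of "curvature_op c nab0 hY hZ" "cnj theta_YZ"] curvature_op_nab0_XYZ(3) by simp
  finally have a3: "a3 = theta_YZ" using tr0 by simp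
  \<comment> \<open>Skewness gives an equation multiplied by an inner product, so a nonzero one is
    needed for division; if all vanished on the frame, the identity would have trace 0.\<close>
  have "\<exists>i x y p. R (\<eta> i) (\<xi> i) x y p \<noteq> 0"
  proof (rule ccontr)
    assume "\<nexists>i x y p. R (\<eta> i) (\<xi> i) x y p \<noteq> 0"
    then have "tr (\<lambda>f. f) = 0" by (simp add: tr_def tau_D_def)
    then show False using tr0 unfolding tr_id by simp
  qed
  then obtain i x y p where nz: "R (\<eta> i) (\<xi> i) x y p \<noteq> 0" by blast
  have "(cnj a1 + a1) * R (\<eta> i) (\<xi> i) x y p = 0"
    using curvature_op_skew[OF conn \<eta> \<xi>, of hX hY i i x y p]
    unfolding op[OF a(1) \<eta>] op[OF a(1) \<xi>] inner_R_cmult_left inner_R_cmult_right by (simp add: algebra_simps)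
  then have "cnj a1 + a1 = 0" using nz by simp
  then have "Re a1 = 0" by (simp add: complex_eq_iff)
  then have "a1 = \<i> * of_real (Im a1)" by (simp add: complex_eq_iff)
  then show ?thesis using that a a2 a3 by metis
qed

text \<open>Stated for curvature operators that are module maps rather than for compatible
  connections, so that it applies directly to the deformations in the critical point
  condition.\<close>

lemma YM_tr:
  assumes "dlin (curvature_op c nabla hX hY)" "dlin (curvature_op c nabla hX hZ)" "dlin (curvature_op c nabla hY hZ)"
  shows "YM c \<mu> \<nu> nabla = - Re (tr (\<lambda>f. curvature_op c nabla hX hY (curvature_op c nabla hX hY f)) +
    tr (\<lambda>f. curvature_op c nabla hX hZ (curvature_op c nabla hX hZ f)) +
    tr (\<lambda>f. curvature_op c nabla hY hZ (curvature_op c nabla hY hZ f)))"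
proof -
  define S1 S2 S3 where "S1 f = curvature_op c nabla hX hY (curvature_op c nabla hX hY f)"
    and "S2 f = curvature_op c nabla hX hZ (curvature_op c nabla hX hZ f)"
    and "S3 f = curvature_op c nabla hY hZ (curvature_op c nabla hY hZ f)" for f
  have S: "S1 f \<in> Xi" "S2 f \<in> Xi" "S3 f \<in> Xi" if "f \<in> Xi" for f
    unfolding S1_def S2_def S3_def by (intro dlin_Xi[OF assms(1)] dlin_Xi[OF assms(2)] dlin_Xi[OF assms(3)] that)+
  have "(\<lambda>x y p. rep S1 x y p + rep S2 x y p + rep S3 x y p) = rep (\<lambda>f x y. (\<lambda>x y. S1 f x y + S2 f x y) x y + S3 f x y)"
    unfolding rep_def by (intro ext) (simp add: inner_L_add_left S \<xi> \<eta> Xi_add sum.distrib)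
  moreover have "tau_E c \<mu> \<nu> (rep (\<lambda>f x y. (\<lambda>x y. S1 f x y + S2 f x y) x y + S3 f x y)) = tr S1 + tr S2 + tr S3"
    by (subst tau_E_rep) (simp_all add: Xi_add S \<xi> tr_add[of "\<lambda>f x y. S1 f x y + S2 f x y" S3] tr_add[of S1 S2])
  ultimately show ?thesis
    unfolding YM_def curvature_rep[OF assms(1)] curvature_rep[OF assms(2)] curvature_rep[OF assms(3)]
      mult_E_rep[OF assms(1,1)] mult_E_rep[OF assms(2,2)] mult_E_rep[OF assms(3,3)]
    unfolding S1_def[symmetric] S2_def[symmetric] S3_def[symmetric] by simp
qed

lemma tr_square_scalar:
  assumes T: "\<And>f. f \<in> Xi \<Longrightarrow> T f = (\<lambda>x y. cnj a * f x y)"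
  shows "tr (\<lambda>f. T (T f)) = a\<^sup>2 * of_real (2 * \<bar>\<mu>\<bar>)"
proof -
  have "tr (\<lambda>f. T (T f)) = tr (\<lambda>f x y. cnj (a\<^sup>2) * f x y)"
    by (rule tr_cong) (simp add: T Xi_cmult power2_eq_square mult.assoc)
  then show ?thesis unfolding tr_scalar by simp
qed

lemma YM_constant:
  assumes conn: "connection nabla"
    and a: "curvature c \<mu> \<nu> nabla hX hY = (\<lambda>x y p. (\<i> * of_real b) * Id_E x y p)"
      "curvature c \<mu> \<nu> nabla hX hZ = (\<lambda>x y p. 0 * Id_E x y p)"
      "curvature c \<mu> \<nu> nabla hY hZ = (\<lambda>x y p. theta_YZ * Id_E x y p)"
  shows "YM c \<mu> \<nu> nabla = 2 * \<bar>\<mu>\<bar> * (b\<^sup>2 + (pi / \<mu>)\<^sup>2)"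
proof -
  note d = dlin_curvature_op[OF conn]
  have "YM c \<mu> \<nu> nabla = - Re ((\<i> * of_real b)\<^sup>2 * of_real (2 * \<bar>\<mu>\<bar>) + 0\<^sup>2 * of_real (2 * \<bar>\<mu>\<bar>) + theta_YZ\<^sup>2 * of_real (2 * \<bar>\<mu>\<bar>))"
    unfolding YM_tr[OF d d d]
    by (simp only: tr_square_scalar[OF curvature_op_scalar[OF conn a(1)]] tr_square_scalar[OF curvature_op_scalar[OF conn a(2)]]
      tr_square_scalar[OF curvature_op_scalar[OF conn a(3)]])
  also have "theta_YZ\<^sup>2 = of_real (- ((pi / \<mu>)\<^sup>2))"
    by (simp add: theta_YZ_def power_divide power_mult_distrib)
  also have "(\<i> * of_real b)\<^sup>2 = (of_real (- (b\<^sup>2)) :: complex)" by (simp add: power_mult_distrib)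
  finally show ?thesis by (simp only: of_real_mult[symmetric] of_real_add[symmetric] Re_complex_of_real zero_power2 mult_zero_left add_0_right)
      (simp add: algebra_simps)
qed

lemma curvature_nab0:
  "constant_curvature c \<mu> \<nu> nab0" "curvature c \<mu> \<nu> nab0 hX hY = (\<lambda>x y p. (\<i> * of_real 0) * Id_E x y p)"
proof -
  have *: "curvature c \<mu> \<nu> nab0 V W = (\<lambda>x y p. a * Id_E x y p)"
    if "\<And>f. f \<in> Xi \<Longrightarrow> curvature_op c nab0 V W f = (\<lambda>x y. cnj a * f x y)" for V W a
    by (rule curvature_eqI[OF scalar_E_smooth]) (simp add: lact_scalar that)
  show "constant_curvature c \<mu> \<nu> nab0"
    unfolding constant_curvature_def
  proof (intro allI)
    fix V W :: heis
    obtain v1 v2 v3 w1 w2 w3 where VW: "V = (v1, v2, v3)" "W = (w1, w2, w3)" by (cases V; cases W)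
    have "curvature c \<mu> \<nu> nab0 V W = (\<lambda>x y p. (of_real (v2 * w3 - v3 * w2) * theta_YZ) * Id_E x y p)"
      by (rule *) (simp add: VW curvature_op_nab0 theta_YZ_def)
    then show "\<exists>a. curvature c \<mu> \<nu> nab0 V W = (\<lambda>x y p. a * Id_E x y p)" by blast
  qed
  show "curvature c \<mu> \<nu> nab0 hX hY = (\<lambda>x y p. (\<i> * of_real 0) * Id_E x y p)"
    by (rule *) (simp add: curvature_op_nab0_XYZ)
qed

text \<open>The coefficient of t is the trace of 2 s A, which vanishes by hypothesis. A polynomial
  in t without linear term has derivative 0 at 0.\<close>

lemma tr_square_deformation:
  assumes A: "dlin A" and B: "dlin B" and s: "s = 0 \<or> tr A = 0"
    and T: "\<And>t f. f \<in> Xi \<Longrightarrow> T t f = (\<lambda>x y. s * f x y + of_real t * A f x y + of_real (t\<^sup>2) * B f x y)"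
  shows "\<exists>k0 k2 k3 k4. \<forall>t. tr (\<lambda>f. T t (T t f)) = k0 + k2 * of_real (t ^ 2) + k3 * of_real (t ^ 3) + k4 * of_real (t ^ 4)"
proof (intro exI allI)
  fix t :: real
  define k1 where "k1 = (\<lambda>f x y. 2 * s * A f x y)"
  define k2 where "k2 = (\<lambda>f x y. 2 * s * B f x y + A (A f) x y)"
  define k3 where "k3 = (\<lambda>f x y. A (B f) x y + B (A f) x y)"
  define k4 where "k4 = (\<lambda>f. B (B f))"
  note I = Xi_add Xi_cmult dlin_Xi[OF A] dlin_Xi[OF B]
  have K: "k1 f \<in> Xi" "k2 f \<in> Xi" "k3 f \<in> Xi" "k4 f \<in> Xi" if "f \<in> Xi" for f
    unfolding k1_def k2_def k3_def k4_def by (intro I that)+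
  have "tr (\<lambda>f. T t (T t f)) = tr (\<lambda>f x y. (\<lambda>x y. s\<^sup>2 * f x y + of_real t * k1 f x y) x y +
      ((\<lambda>x y. of_real (t ^ 2) * k2 f x y + (\<lambda>x y. of_real (t ^ 3) * k3 f x y + of_real (t ^ 4) * k4 f x y) x y) x y))"
  proof (rule tr_cong)
    fix f assume f: "f \<in> Xi"
    have lin: "D (\<lambda>x y. s * f x y + of_real t * A f x y + of_real (t\<^sup>2) * B f x y) =
        (\<lambda>x y. s * D f x y + of_real t * D (A f) x y + of_real (t\<^sup>2) * D (B f) x y)" if D: "dlin D" for D
      by (simp add: dlin_add[OF D] dlin_cmult[OF D] I f)
    have Tf: "T t f \<in> Xi" unfolding T[OF f] by (intro I f)
    show "T t (T t f) = (\<lambda>x y. (\<lambda>x y. s\<^sup>2 * f x y + of_real t * k1 f x y) x y +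
      ((\<lambda>x y. of_real (t ^ 2) * k2 f x y + (\<lambda>x y. of_real (t ^ 3) * k3 f x y + of_real (t ^ 4) * k4 f x y) x y) x y))"
      unfolding T[OF Tf] unfolding T[OF f] lin[OF A] lin[OF B] k1_def k2_def k3_def k4_def
      by (intro ext) (simp add: algebra_simps power2_eq_square power3_eq_cube power4_eq_xxxx)
  qed
  also have "\<dots> = tr (\<lambda>f x y. s\<^sup>2 * f x y) + of_real t * tr k1 + (of_real (t ^ 2) * tr k2 + (of_real (t ^ 3) * tr k3 + of_real (t ^ 4) * tr k4))"
    using tr_cmult[of "of_real t" k1] tr_cmult[of "of_real (t ^ 2)" k2] tr_cmult[of "of_real (t ^ 3)" k3] tr_cmult[of "of_real (t ^ 4)" k4]
    by (simp add: tr_add I K)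
  also have "tr k1 = 0" unfolding k1_def tr_cmult using s by auto
  finally show "tr (\<lambda>f. T t (T t f)) = tr (\<lambda>f x y. s\<^sup>2 * f x y) + tr (\<lambda>f x y. 2 * s * B f x y + A (A f) x y) * of_real (t ^ 2) +
      tr (\<lambda>f x y. A (B f) x y + B (A f) x y) * of_real (t ^ 3) + tr (\<lambda>f. B (B f)) * of_real (t ^ 4)"
    unfolding k2_def k3_def k4_def by (simp only: mult.commute mult_zero_right mult_zero_left add_0_right add.assoc)
qed

text \<open>A is the first variation of the curvature and B its second-order part. For X, Y and X, Z
  the scalar s is 0, so the trace of A is irrelevant there; for Y, Z the bracket vanishes and A is a
  difference of traceless commutators.\<close>

lemma critical_pointI:
  assumes conn: "connection nabla"
    and a: "curvature c \<mu> \<nu> nabla hX hY = (\<lambda>x y p. 0 * Id_E x y p)"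
      "curvature c \<mu> \<nu> nabla hX hZ = (\<lambda>x y p. 0 * Id_E x y p)"
      "curvature c \<mu> \<nu> nabla hY hZ = (\<lambda>x y p. theta_YZ * Id_E x y p)"
  shows "critical_point c \<mu> \<nu> nabla"
  unfolding critical_point_def
proof (intro allI impI)
  fix H assume "linear_skew_adjoint c \<mu> \<nu> H"
  then have HE: "\<And>W. H W \<in> E_smooth c \<mu> \<nu>"
    and Hl: "\<And>V W a b. H (a *\<^sub>R V + b *\<^sub>R W) = (\<lambda>x y p. of_real a * H V x y p + of_real b * H W x y p)"
    unfolding linear_skew_adjoint_def by blast+
  define h where "h W = lact (H W)" for W
  have h: "dlin (h W)" for W unfolding h_def by (rule dlin_lact[OF HE])
  have h0: "h 0 f = (\<lambda>x y. 0)" for f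
    using Hl[of 0 0 0 0] by (simp add: h_def lact_def)
  define nt where "nt t W f = (\<lambda>x y. nabla W f x y + of_real t * h W f x y)" for t W f
  define cm where "cm V W f = (\<lambda>x y. nabla V (h W f) x y - h W (nabla V f) x y)" for V W f
  have cm: "dlin (cm V W)" "tr (cm V W) = 0" for V W
    unfolding cm_def[abs_def] by (rule dlin_commutator[OF conn h], rule tr_commutator[OF conn h])
  define A where "A V W f = (\<lambda>x y. 1 * (\<lambda>x y. 1 * cm V W f x y + (- 1) * cm W V f x y) x y + (- 1) * h (bracket c V W) f x y)" for V W f
  define B where "B V W f = (\<lambda>x y. 1 * h V (h W f) x y + (- 1) * h W (h V f) x y)" for V W f
  have A: "dlin (A V W)" for V W
    unfolding A_def[abs_def] by (intro dlin_combination cm h)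
  have B: "dlin (B V W)" for V W
    unfolding B_def[abs_def] by (rule dlin_combination[OF dlin_comp[OF h h] dlin_comp[OF h h]])
  note I = Xi_add Xi_cmult connection_Xi[OF conn] dlin_Xi[OF h]
  have op: "curvature_op c (nt t) V W f = (\<lambda>x y. curvature_op c nabla V W f x y + of_real t * A V W f x y + of_real (t\<^sup>2) * B V W f x y)"
    if f: "f \<in> Xi" for t V W f
  proof (intro ext)
    fix x y
    have e: "nabla V (\<lambda>x y. nabla W f x y + of_real t * h W f x y) = (\<lambda>x y. nabla V (nabla W f) x y + of_real t * nabla V (h W f) x y)"
      "h V (\<lambda>x y. nabla W f x y + of_real t * h W f x y) = (\<lambda>x y. h V (nabla W f) x y + of_real t * h V (h W f) x y)" for V W
      by (simp_all only: connection_add[OF conn] connection_cmult[OF conn] dlin_add[OF h] dlin_cmult[OF h] I f)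
    show "curvature_op c (nt t) V W f x y = curvature_op c nabla V W f x y + of_real t * A V W f x y + of_real (t\<^sup>2) * B V W f x y"
      unfolding curvature_op_def nt_def A_def B_def cm_def e by (simp add: algebra_simps power2_eq_square)
  qed
  \<comment> \<open>The curvature of the deformation is a module map because on \<open>Xi\<close> it
    is a combination of module maps; compatibility of the deformation is not invoked.\<close>
  have d: "dlin (curvature_op c (nt t) V W)" for t V W
  proof (rule dlin_cong)
    show "dlin (\<lambda>f x y. 1 * (\<lambda>x y. 1 * curvature_op c nabla V W f x y + of_real t * A V W f x y) x y + of_real (t\<^sup>2) * B V W f x y)"
      by (intro dlin_combination A B dlin_curvature_op[OF conn])
  qed (simp add: op)
  have trA: "tr (A hY hZ) = 0"
  proof -
    have "tr (A hY hZ) = tr (\<lambda>f x y. cm hY hZ f x y - cm hZ hY f x y)"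
      by (rule tr_cong) (simp add: A_def bracket_hXYZ h0)
    then show ?thesis using dlin_Xi[OF cm(1)] by (simp add: tr_diff cm(2))
  qed
  have sq: "\<exists>k0 k2 k3 k4. \<forall>t. tr (\<lambda>f. curvature_op c (nt t) V W (curvature_op c (nt t) V W f)) =
      k0 + k2 * of_real (t ^ 2) + k3 * of_real (t ^ 3) + k4 * of_real (t ^ 4)"
    if that1: "curvature c \<mu> \<nu> nabla V W = (\<lambda>x y p. s * Id_E x y p)" and that2: "cnj s = 0 \<or> tr (A V W) = 0" for V W s
    by (rule tr_square_deformation[OF A B that2]) (simp add: op curvature_op_scalar[OF conn that1])
  obtain p0 p2 p3 p4 where p: "\<And>t. tr (\<lambda>f. curvature_op c (nt t) hX hY (curvature_op c (nt t) hX hY f)) =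
      p0 + p2 * of_real (t ^ 2) + p3 * of_real (t ^ 3) + p4 * of_real (t ^ 4)"
    using sq[OF a(1)] by auto
  obtain q0 q2 q3 q4 where q: "\<And>t. tr (\<lambda>f. curvature_op c (nt t) hX hZ (curvature_op c (nt t) hX hZ f)) =
      q0 + q2 * of_real (t ^ 2) + q3 * of_real (t ^ 3) + q4 * of_real (t ^ 4)"
    using sq[OF a(2)] by auto
  obtain r0 r2 r3 r4 where r: "\<And>t. tr (\<lambda>f. curvature_op c (nt t) hY hZ (curvature_op c (nt t) hY hZ f)) =
      r0 + r2 * of_real (t ^ 2) + r3 * of_real (t ^ 3) + r4 * of_real (t ^ 4)"
    using sq[OF a(3)] trA by auto
  define k0 k2 k3 k4 where "k0 = - Re (p0 + q0 + r0)" and "k2 = - Re (p2 + q2 + r2)"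
    and "k3 = - Re (p3 + q3 + r3)" and "k4 = - Re (p4 + q4 + r4)"
  have "YM c \<mu> \<nu> (nt t) = k0 + k2 * t ^ 2 + k3 * t ^ 3 + k4 * t ^ 4" for t
    unfolding YM_tr[OF d d d] p q r k0_def k2_def k3_def k4_def
    by (simp add: algebra_simps flip: of_real_power)
  moreover have "((\<lambda>t::real. k0 + k2 * t ^ 2 + k3 * t ^ 3 + k4 * t ^ 4) has_real_derivative 0) (at 0)"
    by (auto intro!: derivative_eq_intros)
  ultimately have "((\<lambda>t. YM c \<mu> \<nu> (nt t)) has_real_derivative 0) (at 0)" by simp
  then show "((\<lambda>t. YM c \<mu> \<nu> (\<lambda>W f x y. nabla W f x y + of_real t * lact (H W) f x y)) has_real_derivative 0) (at 0)"
    by (simp add: nt_def[abs_def] h_def)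
qed

lemma Yang_Mills_iff:
  "Yang_Mills_constant_curvature c \<mu> \<nu> nabla \<longleftrightarrow>
    nabla \<in> compatible_connections c \<mu> \<nu> \<and> constant_curvature c \<mu> \<nu> nabla \<and>
    curvature c \<mu> \<nu> nabla hX hY = (\<lambda>x y p. 0) \<and>
    curvature c \<mu> \<nu> nabla hX hZ = (\<lambda>x y p. 0) \<and>
    curvature c \<mu> \<nu> nabla hY hZ = (\<lambda>x y p. of_real pi * \<i> / of_real \<mu> * Id_E x y p)"
proof
  assume YM: "Yang_Mills_constant_curvature c \<mu> \<nu> nabla"
  then have conn: "connection nabla" and const: "constant_curvature c \<mu> \<nu> nabla"
    and min: "YM c \<mu> \<nu> nabla \<le> YM c \<mu> \<nu> nab0"
    using nab0_compatible curvature_nab0(1) by (auto simp: Yang_Mills_constant_curvature_def connection_def)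
  obtain b where b: "curvature c \<mu> \<nu> nabla hX hY = (\<lambda>x y p. (\<i> * of_real b) * Id_E x y p)"
    "curvature c \<mu> \<nu> nabla hX hZ = (\<lambda>x y p. 0 * Id_E x y p)"
    "curvature c \<mu> \<nu> nabla hY hZ = (\<lambda>x y p. theta_YZ * Id_E x y p)"
    using constant_curvature_values[OF conn const] by blast
  obtain b0 where b0: "curvature c \<mu> \<nu> nab0 hX hY = (\<lambda>x y p. (\<i> * of_real b0) * Id_E x y p)"
    "curvature c \<mu> \<nu> nab0 hX hZ = (\<lambda>x y p. 0 * Id_E x y p)"
    "curvature c \<mu> \<nu> nab0 hY hZ = (\<lambda>x y p. theta_YZ * Id_E x y p)"
    using constant_curvature_values[OF connection_nab0 curvature_nab0(1)] by blast
  have "2 * \<bar>\<mu>\<bar> * (b\<^sup>2 + (pi / \<mu>)\<^sup>2) \<le> 2 * \<bar>\<mu>\<bar> * (0\<^sup>2 + (pi / \<mu>)\<^sup>2)"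
    using min unfolding YM_constant[OF conn b] YM_constant[OF connection_nab0 curvature_nab0(2) b0(2,3)] .
  then have "b\<^sup>2 \<le> 0" using mu by simp
  then have "b = 0" by simp
  then show "nabla \<in> compatible_connections c \<mu> \<nu> \<and> constant_curvature c \<mu> \<nu> nabla \<and>
    curvature c \<mu> \<nu> nabla hX hY = (\<lambda>x y p. 0) \<and>
    curvature c \<mu> \<nu> nabla hX hZ = (\<lambda>x y p. 0) \<and>
    curvature c \<mu> \<nu> nabla hY hZ = (\<lambda>x y p. of_real pi * \<i> / of_real \<mu> * Id_E x y p)"
    using b conn const by (simp add: connection_def theta_YZ_def)
next
  assume asm: "nabla \<in> compatible_connections c \<mu> \<nu> \<and> constant_curvature c \<mu> \<nu> nabla \<and>
    curvature c \<mu> \<nu> nabla hX hY = (\<lambda>x y p. 0) \<and>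
    curvature c \<mu> \<nu> nabla hX hZ = (\<lambda>x y p. 0) \<and>
    curvature c \<mu> \<nu> nabla hY hZ = (\<lambda>x y p. of_real pi * \<i> / of_real \<mu> * Id_E x y p)"
  then have conn: "connection nabla" by (simp add: connection_def)
  have a: "curvature c \<mu> \<nu> nabla hX hY = (\<lambda>x y p. 0 * Id_E x y p)" "curvature c \<mu> \<nu> nabla hX hZ = (\<lambda>x y p. 0 * Id_E x y p)"
    "curvature c \<mu> \<nu> nabla hY hZ = (\<lambda>x y p. theta_YZ * Id_E x y p)" using asm by (simp_all add: theta_YZ_def)
  then have a1: "curvature c \<mu> \<nu> nabla hX hY = (\<lambda>x y p. (\<i> * of_real 0) * Id_E x y p)" by simp
  have "YM c \<mu> \<nu> nabla \<le> YM c \<mu> \<nu> nabla'" if n': "nabla' \<in> compatible_connections c \<mu> \<nu>" "constant_curvature c \<mu> \<nu> nabla'" for nabla'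
  proof -
    have conn': "connection nabla'" using n'(1) by (simp add: connection_def)
    obtain b where b: "curvature c \<mu> \<nu> nabla' hX hY = (\<lambda>x y p. (\<i> * of_real b) * Id_E x y p)"
      "curvature c \<mu> \<nu> nabla' hX hZ = (\<lambda>x y p. 0 * Id_E x y p)"
      "curvature c \<mu> \<nu> nabla' hY hZ = (\<lambda>x y p. theta_YZ * Id_E x y p)"
      using constant_curvature_values[OF conn' n'(2)] by blast
    show ?thesis unfolding YM_constant[OF conn a1 a(2,3)] YM_constant[OF conn' b] by (intro mult_left_mono) simp_all
  qed
  then show "Yang_Mills_constant_curvature c \<mu> \<nu> nabla"
    using asm critical_pointI[OF conn a] unfolding Yang_Mills_constant_curvature_def by blast
qed

end

theorem corollary4p5:
  fixes c :: int and \<mu> \<nu> :: real and nabla :: "heis \<Rightarrow> mfun \<Rightarrow> mfun"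
  assumes "c \<ge> 1" and "\<mu> \<noteq> 0"
  shows "Yang_Mills_constant_curvature c \<mu> \<nu> nabla \<longleftrightarrow>
    nabla \<in> compatible_connections c \<mu> \<nu> \<and> constant_curvature c \<mu> \<nu> nabla \<and>
    curvature c \<mu> \<nu> nabla hX hY = (\<lambda>x y p. 0) \<and>
    curvature c \<mu> \<nu> nabla hX hZ = (\<lambda>x y p. 0) \<and>
    curvature c \<mu> \<nu> nabla hY hZ = (\<lambda>x y p. of_real pi * \<i> / of_real \<mu> * Id_E x y p)"
proof -
  interpret heisenberg c \<mu> \<nu> by unfold_locales (rule assms(2))
  show ?thesis
  proof (rule exists_frame)
    fix n :: nat and \<xi> \<eta>
    assume "\<And>i. \<xi> i \<in> Xi" "\<And>i. \<eta> i \<in> Xi" "(\<lambda>x y p. \<Sum>i<n. inner_L c \<mu> \<nu> (\<xi> i) (\<eta> i) x y p) = Id_E"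
    then interpret heisenberg_frame c \<mu> \<nu> n \<xi> \<eta> by unfold_locales
    show ?thesis by (rule Yang_Mills_iff)
  qed
qed

end
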